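(* Let $V$ be a finite dimensional rational $G$-module with $V=M\oplus N$ as $G_r$-modules, and suppose that every $G_r$-summand of $V$ isomorphic to $M$ is a $G_r$-complement to $N$. Let $H\le G$ be a closed subgroup. The following are equivalent: (1) There is a $G_rH$-decomposition $V\cong M\oplus N$; that is, there are $G_rH$-submodules $M',N'$ of $V$ with $V=M'\oplus N'$ and with $M'\cong M$, $N'\cong N$ over $G_r$. (2) $H$ acts with a fixed point on $\mathfrak{X}^V_M\times\mathfrak{X}^V_N$. (3) The action of $H$ on $\mathfrak{X}^V_M\times\mathfrak{X}^V_N$ is linearizable.
   Context: $k$ is an algebraically closed field of characteristic $p>0$, $G$ is a simple simply connected algebraic group over $k$, and $G_r$ ($r\ge 1$) is its $r$-th Frobenius kernel. A $G_r$-summand of $V$ is a $G_r$-submodule having a $G_r$-stable complement in $V$. For a $G_r$-summand $M$ of $V$ of dimension $m$, $\mathfrak{X}^V_M$ is the set of all $G_r$-summands of $V$ isomorphic to $M$ as $G_r$-modules. It is an orbit of $\mathrm{Aut}_{G_r}(V)\le GL(V)$ on the Grassmannian $\mathfrak{Grass}_m(V)$ of $m$-dimensional subspaces of $V$, and is given the structure of a (reduced, locally closed) subvariety of it; $G$ (hence $H$) acts on it through its action on $V$, and acts diagonally on $\mathfrak{X}^V_M\times\mathfrak{X}^V_N$. Under the stated hypothesis, $\mathfrak{X}^V_M\times\mathfrak{X}^V_N$ is isomorphic as a variety to the affine space $\mathrm{Hom}_{G_r}(M,N)\times\mathrm{Hom}_{G_r}(N,M)$, and its points are the decompositions $V=M'\oplus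 N'$ over $G_r$ with $M'\cong M$ and $N'\cong N$. An action of a linear algebraic group $H$ on a variety isomorphic to $\mathbb{A}^n$ is linearizable if the variety is $H$-equivariantly isomorphic (as a variety) to a finite dimensional rational $H$-module. The hypothesis on $M$ and $N$ is equivalent to each of: every $G_r$-summand isomorphic to $N$ is a $G_r$-complement to $M$; every $G_r$-summand isomorphic to $M$ is a $G_r$-complement to every $G_r$-summand isomorphic to $N$; $\mathrm{Aut}_{G_r}(V)$ equals $\mathrm{Aut}_{G_r}(M)\times\mathrm{Hom}_{G_r}(M,N)\times\mathrm{Hom}_{G_r}(N,M)\times\mathrm{Aut}_{G_r}(N)$ in block form; every element of $\mathrm{Hom}_{G_r}(M,N)\oplus\mathrm{Hom}_{G_r}(N,M)$ is a nilpotent endomorphism of $V$. *)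

theory Defs
  imports
    "HOL-Analysis.Abstract_Topology"
    "HOL-Library.Function_Algebras"
    "HOL-Algebra.Coset"
    "Jordan_Normal_Form.Determinant"
begin

section \<open>Spaces with functions\<close>

text \<open>
  Varieties over a field are treated as spaces with functions: a topological space together
  with, for every open \<open>U\<close>, the set of regular functions on \<open>U\<close>.  Functions are total on the
  underlying type; membership in the set of regular functions on \<open>U\<close> only depends on the values
  on \<open>U\<close>.
\<close>

record ('a, 'k) fspace =
  top_of :: "'a topology"
  reg_of :: "'a set \<Rightarrow> ('a \<Rightarrow> 'k) set"

definition fspace_morphism ::
    "('a, 'k) fspace \<Rightarrow> ('b, 'k) fspace \<Rightarrow> ('a \<Rightarrow> 'b) \<Rightarrow> bool" where
  "fspace_morphism X Y \<phi> \<longleftrightarrow>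
     continuous_map (top_of X) (top_of Y) \<phi> \<and>
     (\<forall>U. openin (top_of Y) U \<longrightarrow>
        (\<forall>f \<in> reg_of Y U. f \<circ> \<phi> \<in> reg_of X {x \<in> topspace (top_of X). \<phi> x \<in> U}))"

definition fspace_iso ::
    "('a, 'k) fspace \<Rightarrow> ('b, 'k) fspace \<Rightarrow> ('a \<Rightarrow> 'b) \<Rightarrow> bool" where
  "fspace_iso X Y \<phi> \<longleftrightarrow>
     (\<exists>\<psi>. fspace_morphism X Y \<phi> \<and> fspace_morphism Y X \<psi> \<and>
          (\<forall>x \<in> topspace (top_of X). \<psi> (\<phi> x) = x) \<and>
          (\<forall>y \<in> topspace (top_of Y). \<phi> (\<psi> y) = y))"

text \<open>The algebra of functions generated by \<open>S\<close>, that is, polynomials in the members of \<open>S\<close>.\<close>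

inductive_set fun_algebra :: "('a \<Rightarrow> 'k::comm_ring_1) set \<Rightarrow> ('a \<Rightarrow> 'k) set"
  for S where
  const: "(\<lambda>_. c) \<in> fun_algebra S"
| gen: "f \<in> S \<Longrightarrow> f \<in> fun_algebra S"
| add: "f \<in> fun_algebra S \<Longrightarrow> g \<in> fun_algebra S \<Longrightarrow> (\<lambda>x. f x + g x) \<in> fun_algebra S"
| mult: "f \<in> fun_algebra S \<Longrightarrow> g \<in> fun_algebra S \<Longrightarrow> (\<lambda>x. f x * g x) \<in> fun_algebra S"

definition zariski :: "'a set \<Rightarrow> ('a \<Rightarrow> 'k::zero) set \<Rightarrow> 'a topology" where
  "zariski X A = topology_generated_by {{x \<in> X. f x \<noteq> 0} | f. f \<in> A}"

text \<open>
  The (quasi-)affine structure on \<open>X\<close> defined by an algebra \<open>A\<close> of functions: the Zariski topology,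
  with regular functions those that are locally fractions of members of \<open>A\<close>.
\<close>

definition affine_fspace :: "'a set \<Rightarrow> ('a \<Rightarrow> 'k::field) set \<Rightarrow> ('a, 'k) fspace" where
  "affine_fspace X A =
     \<lparr> top_of = zariski X A,
       reg_of = (\<lambda>U. {f. \<forall>x \<in> U. \<exists>a \<in> A. \<exists>b \<in> A. b x \<noteq> 0 \<and>
                            (\<forall>y \<in> U. b y \<noteq> 0 \<longrightarrow> f y = a y / b y)}) \<rparr>"

text \<open>
  The structure induced on a subset: regular functions are locally restrictions of regular
  functions of the ambient space.  On a locally closed subset of a variety this is the reduced
  subvariety structure.
\<close>

definition sub_fspace :: "('a, 'k) fspace \<Rightarrow> 'a set \<Rightarrow> ('a, 'k) fspace" where
  "sub_fspace X S =
     \<lparr> top_of = subtopology (top_of X) S,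
       reg_of = (\<lambda>U. {f. \<forall>x \<in> U. \<exists>U'. openin (top_of X) U' \<and> x \<in> U' \<and>
                            (\<exists>g \<in> reg_of X U'. \<forall>y \<in> U \<inter> U'. f y = g y)}) \<rparr>"

text \<open>The quotient structure on the image of \<open>X\<close> under \<open>q\<close>.\<close>

definition quotient_fspace :: "('a, 'k) fspace \<Rightarrow> ('a \<Rightarrow> 'b) \<Rightarrow> ('b, 'k) fspace" where
  "quotient_fspace X q =
     \<lparr> top_of = topology (\<lambda>U. U \<subseteq> q ` topspace (top_of X) \<and>
                              openin (top_of X) {x \<in> topspace (top_of X). q x \<in> U}),
       reg_of = (\<lambda>U. {f. f \<circ> q \<in> reg_of X {x \<in> topspace (top_of X). q x \<in> U}}) \<rparr>"

lemma istopology_quotient_fspace: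
  "istopology (\<lambda>U. U \<subseteq> q ` topspace T \<and> openin T {x \<in> topspace T. q x \<in> U})"
proof -
  have "{x \<in> topspace T. q x \<in> U \<inter> U'} =
      {x \<in> topspace T. q x \<in> U} \<inter> {x \<in> topspace T. q x \<in> U'}" for U U'
    by auto
  moreover have "{x \<in> topspace T. q x \<in> \<Union>\<K>} = (\<Union>U \<in> \<K>. {x \<in> topspace T. q x \<in> U})" for \<K>
    by auto
  ultimately show ?thesis
    unfolding istopology_def by (auto simp del: Union_iff)
qed

text \<open>
  The product of varieties.  On \<open>U \<times> U'\<close> the functions \<open>\<Sum>i. f\<^sub>i(x) g\<^sub>i(y)\<close> are the image of the
  tensor product of the two algebras of regular functions; their nonvanishing loci form a basis
  of the topology, which is finer than the product topology.
\<close>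

definition tensor_funs ::
    "('a \<Rightarrow> 'k::comm_ring_1) set \<Rightarrow> ('b \<Rightarrow> 'k) set \<Rightarrow> ('a \<times> 'b \<Rightarrow> 'k) set" where
  "tensor_funs A B =
     {\<lambda>(x, y). \<Sum>i<l. f i x * g i y | (l::nat) f g. (\<forall>i<l. f i \<in> A \<and> g i \<in> B)}"

definition prod_fspace ::
    "('a, 'k::field) fspace \<Rightarrow> ('b, 'k) fspace \<Rightarrow> ('a \<times> 'b, 'k) fspace" where
  "prod_fspace X Y =
     \<lparr> top_of = topology_generated_by
         {{z \<in> U \<times> U'. f z \<noteq> 0} | U U' f.
            openin (top_of X) U \<and> openin (top_of Y) U' \<and>
            f \<in> tensor_funs (reg_of X U) (reg_of Y U')},
       reg_of = (\<lambda>W. {f. \<forall>z \<in> W. \<exists>U U'. openin (top_of X) U \<and> openin (top_of Y) U' \<and>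
           z \<in> U \<times> U' \<and>
           (\<exists>a \<in> tensor_funs (reg_of X U) (reg_of Y U').
            \<exists>b \<in> tensor_funs (reg_of X U) (reg_of Y U').
              b z \<noteq> 0 \<and> (\<forall>w \<in> W \<inter> (U \<times> U'). b w \<noteq> 0 \<longrightarrow> f w = a w / b w))}) \<rparr>"

section \<open>Linear algebraic groups\<close>

definition GL :: "nat \<Rightarrow> 'k::field mat monoid" where
  "GL n = \<lparr> carrier = {A \<in> carrier_mat n n. det A \<noteq> 0}, monoid.mult = (*), one = 1\<^sub>m n \<rparr>"

text \<open>
  The coordinate ring of a subset \<open>G\<close> of \<open>GL n\<close>, consisting of the functions that agree on \<open>G\<close>
  with a polynomial in the matrix entries and the inverse of the determinant.
\<close>

definition coord_ring :: "nat \<Rightarrow> 'k::field mat set \<Rightarrow> ('k mat \<Rightarrow> 'k) set" where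
  "coord_ring n G =
     {f. \<exists>F \<in> fun_algebra (insert (\<lambda>A. inverse (det A))
                              {\<lambda>A. A $$ (i, j) | i j. i < n \<and> j < n}).
           \<forall>g \<in> G. f g = F g}"

definition GL_zariski :: "nat \<Rightarrow> 'k::field mat topology" where
  "GL_zariski n = zariski (carrier (GL n)) (coord_ring n (carrier (GL n)))"

definition algebraic_group :: "nat \<Rightarrow> 'k::field mat set \<Rightarrow> bool" where
  "algebraic_group n G \<longleftrightarrow> subgroup G (GL n) \<and> closedin (GL_zariski n) G"

abbreviation group_of :: "nat \<Rightarrow> 'k::field mat set \<Rightarrow> 'k mat monoid" where
  "group_of n G \<equiv> (GL n) \<lparr> carrier := G \<rparr>"

definition closed_subgroup :: "nat \<Rightarrow> 'k::field mat set \<Rightarrow> 'k mat set \<Rightarrow> bool" where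
  "closed_subgroup n H G \<longleftrightarrow> subgroup H (group_of n G) \<and> closedin (GL_zariski n) H"

text \<open>The ideal of \<open>A\<close> generated by \<open>S\<close>, where functions are only compared on \<open>G\<close>.\<close>

definition fun_ideal ::
    "'a set \<Rightarrow> ('a \<Rightarrow> 'k::comm_ring_1) set \<Rightarrow> ('a \<Rightarrow> 'k) set \<Rightarrow> ('a \<Rightarrow> 'k) set" where
  "fun_ideal G A S =
     {f. \<exists>(l::nat) a s. (\<forall>i<l. a i \<in> A \<and> s i \<in> S) \<and> (\<forall>g \<in> G. f g = (\<Sum>i<l. a i g * s i g))}"

definition augmentation_ideal :: "nat \<Rightarrow> 'k::field mat set \<Rightarrow> ('k mat \<Rightarrow> 'k) set" where
  "augmentation_ideal n G = {f \<in> coord_ring n G. f (1\<^sub>m n) = 0}"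

subsection \<open>Simple simply connected groups\<close>

definition connected_group :: "nat \<Rightarrow> 'k::field mat set \<Rightarrow> bool" where
  "connected_group n G \<longleftrightarrow> algebraic_group n G \<and> connectedin (GL_zariski n) G"

text \<open>Simple as an algebraic group; finite normal subgroups are allowed.\<close>

definition simple_group :: "nat \<Rightarrow> 'k::field mat set \<Rightarrow> bool" where
  "simple_group n G \<longleftrightarrow>
     connected_group n G \<and> (\<exists>g \<in> G. \<exists>h \<in> G. g * h \<noteq> h * g) \<and>
     (\<forall>K. K \<lhd> group_of n G \<and> closedin (GL_zariski n) K \<and> connectedin (GL_zariski n) K \<longrightarrow>
          K = {1\<^sub>m n} \<or> K = G)"

definition group_morphism ::
    "nat \<Rightarrow> 'k::field mat set \<Rightarrow> nat \<Rightarrow> 'k mat set \<Rightarrow> ('k mat \<Rightarrow> 'k mat) \<Rightarrow> bool" where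
  "group_morphism n' G' n G \<pi> \<longleftrightarrow>
     \<pi> \<in> hom (group_of n' G') (group_of n G) \<and>
     (\<forall>f \<in> coord_ring n G. f \<circ> \<pi> \<in> coord_ring n' G')"

definition group_isomorphism ::
    "nat \<Rightarrow> 'k::field mat set \<Rightarrow> nat \<Rightarrow> 'k mat set \<Rightarrow> ('k mat \<Rightarrow> 'k mat) \<Rightarrow> bool" where
  "group_isomorphism n' G' n G \<pi> \<longleftrightarrow>
     group_morphism n' G' n G \<pi> \<and> bij_betw \<pi> G' G \<and>
     group_morphism n G n' G' (the_inv_into G' \<pi>)"

text \<open>
  A central isogeny is a surjective morphism with finite kernel whose scheme-theoretic kernel is
  central.  That kernel is cut out by the ideal generated by the pullback of the augmentation
  ideal of \<open>G\<close>; it is central if conjugation by every point of \<open>G'\<close> restricts to the identity on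
  it.  (For instance, Frobenius isogenies have trivial kernel on points but are not central.)
\<close>

definition central_isogeny ::
    "nat \<Rightarrow> 'k::field mat set \<Rightarrow> nat \<Rightarrow> 'k mat set \<Rightarrow> ('k mat \<Rightarrow> 'k mat) \<Rightarrow> bool" where
  "central_isogeny n' G' n G \<pi> \<longleftrightarrow>
     group_morphism n' G' n G \<pi> \<and> \<pi> ` G' = G \<and>
     finite (kernel (group_of n' G') (group_of n G) \<pi>) \<and>
     (\<forall>g \<in> G'. \<forall>f \<in> coord_ring n' G'.
        (\<lambda>x. f (g * x * inv\<^bsub>GL n'\<^esub> g) - f x)
          \<in> fun_ideal G' (coord_ring n' G') {u \<circ> \<pi> | u. u \<in> augmentation_ideal n G})"

definition simply_connected_group :: "nat \<Rightarrow> 'k::field mat set \<Rightarrow> bool" where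
  "simply_connected_group n G \<longleftrightarrow>
     (\<forall>n' G' \<pi>. connected_group n' G' \<and> central_isogeny n' G' n G \<pi> \<longrightarrow>
        group_isomorphism n' G' n G \<pi>)"

subsection \<open>Closed subgroup schemes\<close>

text \<open>
  Closed subgroup schemes of \<open>G\<close> are given by their ideals in the coordinate ring of \<open>G\<close>.
  The Frobenius kernel \<open>G\<^sub>r\<close> is defined by the \<open>p\<^sup>r\<close>-th powers of the functions vanishing at
  the identity.
\<close>

definition frobenius_kernel_ideal ::
    "nat \<Rightarrow> 'k::field mat set \<Rightarrow> nat \<Rightarrow> ('k mat \<Rightarrow> 'k) set" where
  "frobenius_kernel_ideal n G r =
     fun_ideal G (coord_ring n G) {\<lambda>g. f g ^ (CHAR('k) ^ r) | f. f \<in> augmentation_ideal n G}"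

text \<open>
  \<open>G\<^sub>r H\<close> is the scheme-theoretic image of the multiplication map from \<open>G\<^sub>r \<times> H\<close> to \<open>G\<close>, so its
  ideal is the kernel of the comorphism into the tensor product of the two coordinate rings.
  Since \<open>H\<close> is reduced, this kernel can be tested at the points of \<open>H\<close>.
\<close>

definition GrH_ideal ::
    "nat \<Rightarrow> 'k::field mat set \<Rightarrow> nat \<Rightarrow> 'k mat set \<Rightarrow> ('k mat \<Rightarrow> 'k) set" where
  "GrH_ideal n G r H =
     {f \<in> coord_ring n G. \<forall>h \<in> H. (\<lambda>g. f (g * h)) \<in> frobenius_kernel_ideal n G r}"

section \<open>Rational modules\<close>

definition fin_dim_subspace ::
    "('k::field \<Rightarrow> 'v::ab_group_add \<Rightarrow> 'v) \<Rightarrow> 'v set \<Rightarrow> bool" where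
  "fin_dim_subspace scale V \<longleftrightarrow>
     Vector_Spaces.vector_space scale \<and> (\<exists>B. finite B \<and> V = Modules.module.span scale B)"

abbreviation functional :: "('k::field \<Rightarrow> 'v::ab_group_add \<Rightarrow> 'v) \<Rightarrow> ('v \<Rightarrow> 'k) \<Rightarrow> bool" where
  "functional scale \<xi> \<equiv> Vector_Spaces.linear scale (*) \<xi>"

text \<open>
  Modules live on a subspace \<open>V\<close> of an ambient vector space.  Every linear form on a subspace
  extends to the ambient space, so it suffices to speak about linear forms on the latter.
\<close>

definition rational_module ::
    "nat \<Rightarrow> 'k::field mat set \<Rightarrow> ('k \<Rightarrow> 'v::ab_group_add \<Rightarrow> 'v) \<Rightarrow> 'v set \<Rightarrow>
     ('k mat \<Rightarrow> 'v \<Rightarrow> 'v) \<Rightarrow> bool" where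
  "rational_module n G scale V \<rho> \<longleftrightarrow>
     fin_dim_subspace scale V \<and>
     (\<forall>g \<in> G. \<forall>v \<in> V. \<rho> g v \<in> V) \<and>
     (\<forall>g \<in> G. \<forall>u \<in> V. \<forall>v \<in> V. \<rho> g (u + v) = \<rho> g u + \<rho> g v) \<and>
     (\<forall>g \<in> G. \<forall>c. \<forall>v \<in> V. \<rho> g (scale c v) = scale c (\<rho> g v)) \<and>
     (\<forall>v \<in> V. \<rho> (1\<^sub>m n) v = v) \<and>
     (\<forall>g \<in> G. \<forall>h \<in> G. \<forall>v \<in> V. \<rho> (g * h) v = \<rho> g (\<rho> h v)) \<and>
     (\<forall>\<xi>. functional scale \<xi> \<longrightarrow> (\<forall>v \<in> V. (\<lambda>g. \<xi> (\<rho> g v)) \<in> coord_ring n G))"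

text \<open>
  Let \<open>J\<close> be the ideal of a closed subgroup scheme of \<open>G\<close>.  A subspace \<open>W\<close> of a \<open>G\<close>-module is a
  submodule for this scheme if the comodule map modulo \<open>J\<close> sends \<open>W\<close> into the tensor product of
  \<open>W\<close> with the coordinate ring modulo \<open>J\<close>, that is, if the matrix coefficients of vectors in \<open>W\<close>
  against linear forms killing \<open>W\<close> lie in \<open>J\<close>.
\<close>

definition scheme_submodule ::
    "('k::field mat \<Rightarrow> 'k) set \<Rightarrow> ('k \<Rightarrow> 'v::ab_group_add \<Rightarrow> 'v) \<Rightarrow> 'v set \<Rightarrow>
     ('k mat \<Rightarrow> 'v \<Rightarrow> 'v) \<Rightarrow> 'v set \<Rightarrow> bool" where
  "scheme_submodule J scale V \<rho> W \<longleftrightarrow>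
     Modules.module.subspace scale W \<and> W \<subseteq> V \<and>
     (\<forall>w \<in> W. \<forall>\<xi>. functional scale \<xi> \<and> (\<forall>u \<in> W. \<xi> u = 0) \<longrightarrow> (\<lambda>g. \<xi> (\<rho> g w)) \<in> J)"

text \<open>
  Isomorphism of submodules \<open>M\<close> and \<open>N\<close> over the scheme defined by \<open>J\<close>: a linear isomorphism
  that commutes with the comodule maps modulo \<open>J\<close>.  The map is extended linearly to the ambient
  space because \<open>\<rho> g v\<close> need not lie in \<open>M\<close>; the choice of the extension is immaterial as \<open>M\<close>
  is a submodule.
\<close>

definition scheme_iso ::
    "('k::field mat \<Rightarrow> 'k) set \<Rightarrow> ('k \<Rightarrow> 'v::ab_group_add \<Rightarrow> 'v) \<Rightarrow>
     ('k mat \<Rightarrow> 'v \<Rightarrow> 'v) \<Rightarrow> 'v set \<Rightarrow> 'v set \<Rightarrow> bool" where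
  "scheme_iso J scale \<rho> M N \<longleftrightarrow>
     (\<exists>\<phi>. Vector_Spaces.linear scale scale \<phi> \<and> bij_betw \<phi> M N \<and>
        (\<forall>v \<in> M. \<forall>\<xi>. functional scale \<xi> \<longrightarrow> (\<lambda>g. \<xi> (\<rho> g (\<phi> v)) - \<xi> (\<phi> (\<rho> g v))) \<in> J))"

definition direct_decomp :: "'v::ab_group_add set \<Rightarrow> 'v set \<Rightarrow> 'v set \<Rightarrow> bool" where
  "direct_decomp V M N \<longleftrightarrow> V = {x + y | x y. x \<in> M \<and> y \<in> N} \<and> M \<inter> N = {0}"

definition scheme_summand ::
    "('k::field mat \<Rightarrow> 'k) set \<Rightarrow> ('k \<Rightarrow> 'v::ab_group_add \<Rightarrow> 'v) \<Rightarrow> 'v set \<Rightarrow>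
     ('k mat \<Rightarrow> 'v \<Rightarrow> 'v) \<Rightarrow> 'v set \<Rightarrow> bool" where
  "scheme_summand J scale V \<rho> W \<longleftrightarrow>
     scheme_submodule J scale V \<rho> W \<and>
     (\<exists>W'. scheme_submodule J scale V \<rho> W' \<and> direct_decomp V W W')"

section \<open>Grassmannians and varieties of summands\<close>

definition vector_fspace ::
    "('k::field \<Rightarrow> 'v::ab_group_add \<Rightarrow> 'v) \<Rightarrow> 'v set \<Rightarrow> ('v, 'k) fspace" where
  "vector_fspace scale V = affine_fspace V (fun_algebra {\<xi>. functional scale \<xi>})"

definition frames ::
    "('k::field \<Rightarrow> 'v::ab_group_add \<Rightarrow> 'v) \<Rightarrow> 'v set \<Rightarrow> nat \<Rightarrow> 'v list set" where
  "frames scale V m =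
     {ws. length ws = m \<and> set ws \<subseteq> V \<and> distinct ws \<and>
          \<not> Modules.module.dependent scale (set ws)}"

definition frame_fspace ::
    "('k::field \<Rightarrow> 'v::ab_group_add \<Rightarrow> 'v) \<Rightarrow> 'v set \<Rightarrow> nat \<Rightarrow> ('v list, 'k) fspace" where
  "frame_fspace scale V m =
     affine_fspace (frames scale V m)
       (fun_algebra {\<lambda>ws. \<xi> (ws ! i) | \<xi> i. functional scale \<xi> \<and> i < m})"

text \<open>
  The Grassmannian of \<open>m\<close>-dimensional subspaces, as the quotient of the open subvariety of
  \<open>m\<close>-frames in \<open>V\<^sup>m\<close> by the change of basis action of the general linear group.
\<close>

definition grassmannian ::
    "('k::field \<Rightarrow> 'v::ab_group_add \<Rightarrow> 'v) \<Rightarrow> 'v set \<Rightarrow> nat \<Rightarrow> ('v set, 'k) fspace" where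
  "grassmannian scale V m =
     quotient_fspace (frame_fspace scale V m) (\<lambda>ws. Modules.module.span scale (set ws))"

definition summands ::
    "('k::field mat \<Rightarrow> 'k) set \<Rightarrow> ('k \<Rightarrow> 'v::ab_group_add \<Rightarrow> 'v) \<Rightarrow> 'v set \<Rightarrow>
     ('k mat \<Rightarrow> 'v \<Rightarrow> 'v) \<Rightarrow> 'v set \<Rightarrow> 'v set set" where
  "summands J scale V \<rho> M = {M'. scheme_summand J scale V \<rho> M' \<and> scheme_iso J scale \<rho> M M'}"

definition summand_variety ::
    "('k::field mat \<Rightarrow> 'k) set \<Rightarrow> ('k \<Rightarrow> 'v::ab_group_add \<Rightarrow> 'v) \<Rightarrow> 'v set \<Rightarrow>
     ('k mat \<Rightarrow> 'v \<Rightarrow> 'v) \<Rightarrow> 'v set \<Rightarrow> ('v set, 'k) fspace" where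
  "summand_variety J scale V \<rho> M =
     sub_fspace (grassmannian scale V (Vector_Spaces.vector_space.dim scale M))
       (summands J scale V \<rho> M)"

definition diag_action :: "('k mat \<Rightarrow> 'v \<Rightarrow> 'v) \<Rightarrow> 'k mat \<Rightarrow> 'v set \<times> 'v set \<Rightarrow> 'v set \<times> 'v set" where
  "diag_action \<rho> h = (\<lambda>(M, N). (\<rho> h ` M, \<rho> h ` N))"

section \<open>Fixed points and linearizability\<close>

definition has_fixed_point :: "'h set \<Rightarrow> 'x set \<Rightarrow> ('h \<Rightarrow> 'x \<Rightarrow> 'x) \<Rightarrow> bool" where
  "has_fixed_point H X act \<longleftrightarrow> (\<exists>x \<in> X. \<forall>h \<in> H. act h x = x)"

text \<open>
  Every finite dimensional rational module is isomorphic to one whose underlying space is a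
  subspace of the space of sequences, so this type accommodates all candidates.
\<close>

definition linearizable ::
    "nat \<Rightarrow> 'k::field mat set \<Rightarrow> ('x, 'k) fspace \<Rightarrow> ('k mat \<Rightarrow> 'x \<Rightarrow> 'x) \<Rightarrow> bool" where
  "linearizable n H X act \<longleftrightarrow>
     (\<exists>(W :: (nat \<Rightarrow> 'k) set) \<sigma> \<phi>.
        rational_module n H (\<lambda>c v i. c * v i) W \<sigma> \<and>
        fspace_iso X (vector_fspace (\<lambda>c v i. c * v i) W) \<phi> \<and>
        (\<forall>h \<in> H. \<forall>x \<in> topspace (top_of X). \<phi> (act h x) = \<sigma> h (\<phi> x)))"

end

theory Submission
  imports Defs "HOL-Library.Nat_Bijection"
begin

text \<open>
  Write a point of \<open>End\<^sub>G\<^sub>r(V)\<close> in block form with respect to \<open>V = M \<oplus> N\<close>. The hypothesis on \<open>N\<close>, applied to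
  the images of \<open>M\<close> under products of unipotent automorphisms, says that \<open>1 + b a\<close> is invertible
  for all \<open>a : M \<rightarrow> N\<close> and \<open>b : N \<rightarrow> M\<close>. Therefore every summand isomorphic to \<open>M\<close> is the graph of
  some \<open>a\<close>, every summand isomorphic to \<open>N\<close> is the graph of some \<open>b\<close>, and any two such graphs are
  complementary; no cancellation theorem is needed. If \<open>M\<close> and \<open>N\<close> are stable under \<open>H\<close>, then
  passing to graphs is an equivariant isomorphism from the \<open>H\<close>-module of pairs \<open>(a, b)\<close>, with
  Cramer's rule showing that the inverse is regular. Conversely the origin of a linear action is
  fixed; here one needs that \<open>G\<close> preserves the isomorphism class of a summand, which holds because
  near the identity the idempotents defining a summand and its translate are conjugate and \<open>G\<close>
  is connected.
\<close>

text \<open>A fixed point of H is in general not the given pair (M, N), while the origin of a linear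
  action is fixed. The affine coordinates therefore have to be centred at the fixed pair (M', N').
  This is legitimate because the varieties of summands depend only on the isomorphism classes over
  \<open>G_r\<close>, and because tightness, once rephrased as complementarity of every graph over M
  with every graph over N, passes to (M', N'). In these coordinates \<open>h\<close> acts by
  conjugation, T going to \<open>h T h^-1\<close>, since \<open>h\<close> carries the graph of T to
  the graph of the conjugate as soon as it stabilizes both summands.

  The group scheme \<open>G_r\<close> enters through its ideal, seen as a linear space of functions
  stable under conjugation by G. Hence conjugation by a point of G preserves endomorphisms over
  \<open>G_r\<close>; this one fact yields both that translates of summands are summands and that H
  acts on the off-diagonal endomorphisms.

  The Grassmannian being a quotient of the space of frames, regularity is checked on frames: maps
  into it are lifted to frames, and functions on it are pulled back to frames.\<close>

section \<open>Spaces with functions\<close>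

text \<open>The rules shared by affine, quotient, induced and product structures, so that the
  criteria for morphisms are proved once. Open nonvanishing loci together with division make a
  pulled back fraction regular near every point where its denominator does not vanish.\<close>

locale function_sheaf =
  fixes X :: "('a, 'k::field) fspace"
  assumes const_reg: "openin (top_of X) U \<Longrightarrow> (\<lambda>_. c) \<in> reg_of X U"
    and add_reg: "openin (top_of X) U \<Longrightarrow> f \<in> reg_of X U \<Longrightarrow> g \<in> reg_of X U \<Longrightarrow>
      (\<lambda>x. f x + g x) \<in> reg_of X U"
    and mult_reg: "openin (top_of X) U \<Longrightarrow> f \<in> reg_of X U \<Longrightarrow> g \<in> reg_of X U \<Longrightarrow>
      (\<lambda>x. f x * g x) \<in> reg_of X U"
    and divide_reg: "openin (top_of X) U \<Longrightarrow> f \<in> reg_of X U \<Longrightarrow> g \<in> reg_of X U \<Longrightarrow>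
      (\<And>x. x \<in> U \<Longrightarrow> g x \<noteq> 0) \<Longrightarrow> (\<lambda>x. f x / g x) \<in> reg_of X U"
    and restrict_reg: "openin (top_of X) U \<Longrightarrow> openin (top_of X) U' \<Longrightarrow> U' \<subseteq> U \<Longrightarrow>
      f \<in> reg_of X U \<Longrightarrow> f \<in> reg_of X U'"
    and glue_reg: "openin (top_of X) U \<Longrightarrow>
      (\<And>x. x \<in> U \<Longrightarrow> \<exists>U' g. openin (top_of X) U' \<and> x \<in> U' \<and> g \<in> reg_of X U' \<and>
                            (\<forall>y \<in> U \<inter> U'. f y = g y)) \<Longrightarrow> f \<in> reg_of X U"
    and openin_nonvanishing: "openin (top_of X) U \<Longrightarrow> f \<in> reg_of X U \<Longrightarrow>
      openin (top_of X) {x \<in> U. f x \<noteq> 0}"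
begin

lemma sum_reg:
  assumes U: "openin (top_of X) U" and f: "\<And>i. i \<in> I \<Longrightarrow> f i \<in> reg_of X U"
  shows "(\<lambda>x. \<Sum>i\<in>I. f i x) \<in> reg_of X U"
  using f by (induction I rule: infinite_finite_induct) (auto intro: const_reg add_reg U)

lemma fun_algebra_reg:
  assumes U: "openin (top_of X) U" and f: "\<And>f. f \<in> S \<Longrightarrow> (\<lambda>x. f (\<phi> x)) \<in> reg_of X U"
    and F: "F \<in> fun_algebra S"
  shows "(\<lambda>x. F (\<phi> x)) \<in> reg_of X U"
  using F by induction (auto intro: const_reg[OF U] add_reg[OF U] mult_reg[OF U] f)

end

lemma fun_algebra_sum:
  assumes "\<And>i. i \<in> I \<Longrightarrow> f i \<in> fun_algebra S"
  shows "(\<lambda>x. \<Sum>i\<in>I. f i x) \<in> fun_algebra S"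
  using assms
  by (induction I rule: infinite_finite_induct) (auto intro: fun_algebra.intros)

lemma fun_algebra_prod:
  assumes "\<And>i. i \<in> I \<Longrightarrow> f i \<in> fun_algebra S"
  shows "(\<lambda>x. \<Prod>i\<in>I. f i x) \<in> fun_algebra S"
  using assms
  by (induction I rule: infinite_finite_induct) (auto intro: fun_algebra.intros)

text \<open>Source of the polynomial functions used later: the equation of the complement of a
  chart, the numerators in Cramer's rule and the entries of an inverse matrix.\<close>

lemma fun_algebra_det:
  fixes A :: "'a \<Rightarrow> 'k::comm_ring_1 mat"
  assumes "\<And>x. A x \<in> carrier_mat m m"
    and "\<And>i j. i < m \<Longrightarrow> j < m \<Longrightarrow> (\<lambda>x. A x $$ (i, j)) \<in> fun_algebra S"
  shows "(\<lambda>x. det (A x)) \<in> fun_algebra S"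
proof -
  have "(\<lambda>x. \<Sum>\<pi> \<in> {\<pi>. \<pi> permutes {0..<m}}. signof \<pi> * (\<Prod>i = 0..<m. A x $$ (i, \<pi> i)))
      \<in> fun_algebra S"
    by (intro fun_algebra_sum fun_algebra.mult[OF fun_algebra.const] fun_algebra_prod assms)
       (auto simp: permutes_in_image)
  then show ?thesis
    by (simp add: det_def'[OF assms(1)])
qed

section \<open>Zariski topology and affine structures\<close>

lemma topspace_zariski:
  fixes S :: "('a \<Rightarrow> 'k::field) set"
  shows "topspace (zariski X (fun_algebra S)) = X"
proof -
  have "{x \<in> X. (1::'k) \<noteq> 0} \<in> {{x \<in> X. f x \<noteq> 0} |f. f \<in> fun_algebra S}"
    by (rule CollectI, rule exI[of _ "\<lambda>_. 1"]) (simp add: fun_algebra.const)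
  then show ?thesis
    unfolding zariski_def topology_generated_by_topspace by auto
qed

lemma openin_zariski_basic: "f \<in> A \<Longrightarrow> openin (zariski X A) {x \<in> X. f x \<noteq> 0}"
  unfolding zariski_def by (rule topology_generated_by_Basis) auto

text \<open>The generating sets are only a subbase by definition. They form a base because the
  algebra is closed under products, and the nonvanishing locus of a product is the intersection of
  the loci.\<close>

lemma zariski_base:
  fixes S :: "('a \<Rightarrow> 'k::field) set"
  assumes "openin (zariski X (fun_algebra S)) U" "x \<in> U"
  obtains h where "h \<in> fun_algebra S" "h x \<noteq> 0" "\<And>y. y \<in> X \<Longrightarrow> h y \<noteq> 0 \<Longrightarrow> y \<in> U"
proof -
  have "generate_topology_on {{x \<in> X. f x \<noteq> 0} |f. f \<in> fun_algebra S} U"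
    using assms(1) by (simp add: zariski_def openin_topology_generated_by_iff)
  then have "\<forall>x\<in>U. \<exists>h \<in> fun_algebra S. h x \<noteq> 0 \<and> (\<forall>y\<in>X. h y \<noteq> 0 \<longrightarrow> y \<in> U)"
  proof induction
    case (Int a b)
    show ?case
    proof
      fix x assume "x \<in> a \<inter> b"
      then obtain h h' where "h \<in> fun_algebra S" "h x \<noteq> 0" "\<forall>y\<in>X. h y \<noteq> 0 \<longrightarrow> y \<in> a"
        "h' \<in> fun_algebra S" "h' x \<noteq> 0" "\<forall>y\<in>X. h' y \<noteq> 0 \<longrightarrow> y \<in> b"
        using Int.IH by blast
      then show "\<exists>h \<in> fun_algebra S. h x \<noteq> 0 \<and> (\<forall>y\<in>X. h y \<noteq> 0 \<longrightarrow> y \<in> a \<inter> b)"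
        by (intro bexI[of _ "\<lambda>x. h x * h' x"]) (auto intro: fun_algebra.mult)
    qed
  qed (blast+)
  then show ?thesis using assms(2) that by blast
qed

lemma top_of_affine_fspace [simp]: "top_of (affine_fspace X A) = zariski X A"
  by (simp add: affine_fspace_def)

lemma reg_affine_fspaceI:
  "(\<And>x. x \<in> U \<Longrightarrow> \<exists>a \<in> A. \<exists>b \<in> A. b x \<noteq> 0 \<and> (\<forall>y \<in> U. b y \<noteq> 0 \<longrightarrow> f y = a y / b y)) \<Longrightarrow>
    f \<in> reg_of (affine_fspace X A) U"
  by (simp add: affine_fspace_def)

lemma reg_affine_fspaceE:
  assumes "f \<in> reg_of (affine_fspace X A) U" "x \<in> U"
  obtains a b where "a \<in> A" "b \<in> A" "b x \<noteq> 0" "\<And>y. y \<in> U \<Longrightarrow> b y \<noteq> 0 \<Longrightarrow> f y = a y / b y"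
proof -
  have "\<exists>a \<in> A. \<exists>b \<in> A. b x \<noteq> 0 \<and> (\<forall>y \<in> U. b y \<noteq> 0 \<longrightarrow> f y = a y / b y)"
    using assms by (simp add: affine_fspace_def)
  then show ?thesis using that by blast
qed

lemma fun_algebra_reg_affine:
  fixes S :: "('a \<Rightarrow> 'k::field) set"
  assumes f: "f \<in> fun_algebra S"
  shows "f \<in> reg_of (affine_fspace X (fun_algebra S)) U"
proof (rule reg_affine_fspaceI)
  fix x assume "x \<in> U"
  show "\<exists>a\<in>fun_algebra S. \<exists>b\<in>fun_algebra S. b x \<noteq> 0 \<and> (\<forall>y\<in>U. b y \<noteq> 0 \<longrightarrow> f y = a y / b y)"
    using f fun_algebra.const[of 1 S] by (intro bexI[of _ f] bexI[of _ "\<lambda>_. 1"]) simp_all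
qed

lemma function_sheaf_affine_fspace:
  fixes S :: "('a \<Rightarrow> 'k::field) set"
  shows "function_sheaf (affine_fspace X (fun_algebra S))"
proof
  let ?A = "fun_algebra S"
  let ?X = "affine_fspace X ?A"
  fix U assume U: "openin (top_of ?X) U"
  then have UX: "U \<subseteq> X" using topspace_zariski openin_subset by fastforce
  show "(\<lambda>_. c) \<in> reg_of ?X U" for c
    by (intro fun_algebra_reg_affine fun_algebra.const)
  show "f \<in> reg_of ?X U'" if U': "U' \<subseteq> U" and f: "f \<in> reg_of ?X U" for f U'
  proof (rule reg_affine_fspaceI)
    fix x assume "x \<in> U'"
    with U' have x: "x \<in> U" by blast
    obtain a b where "a \<in> ?A" "b \<in> ?A" "b x \<noteq> 0"
      "\<And>y. y \<in> U \<Longrightarrow> b y \<noteq> 0 \<Longrightarrow> f y = a y / b y"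
      by (rule reg_affine_fspaceE[OF f x]) (rule that)
    then show "\<exists>a\<in>?A. \<exists>b\<in>?A. b x \<noteq> 0 \<and> (\<forall>y\<in>U'. b y \<noteq> 0 \<longrightarrow> f y = a y / b y)"
      using U' by blast
  qed
  fix f assume f: "f \<in> reg_of ?X U"
  show "openin (top_of ?X) {x \<in> U. f x \<noteq> 0}"
  proof (subst openin_subopen, safe)
    fix x assume x: "x \<in> U" "f x \<noteq> 0"
    obtain a b where ab: "a \<in> ?A" "b \<in> ?A" "b x \<noteq> 0"
      "\<And>y. y \<in> U \<Longrightarrow> b y \<noteq> 0 \<Longrightarrow> f y = a y / b y" by (rule reg_affine_fspaceE[OF f x(1)]) (rule that)
    let ?T = "U \<inter> {x \<in> X. a x \<noteq> 0} \<inter> {x \<in> X. b x \<noteq> 0}"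
    have "openin (top_of ?X) ?T" using ab(1,2) U
      by (intro openin_Int) (auto intro: openin_zariski_basic)
    moreover have "x \<in> ?T" using x ab(3) ab(4)[of x] UX by auto
    moreover have "?T \<subseteq> {x \<in> U. f x \<noteq> 0}" using ab(4) by auto
    ultimately show "\<exists>T. openin (top_of ?X) T \<and> x \<in> T \<and> T \<subseteq> {x \<in> U. f x \<noteq> 0}" by blast
  qed
  fix g assume g: "g \<in> reg_of ?X U"
  show "(\<lambda>x. f x + g x) \<in> reg_of ?X U"
  proof (rule reg_affine_fspaceI)
    fix x assume x: "x \<in> U"
    obtain a b where ab: "a \<in> ?A" "b \<in> ?A" "b x \<noteq> 0"
      "\<And>y. y \<in> U \<Longrightarrow> b y \<noteq> 0 \<Longrightarrow> f y = a y / b y" by (rule reg_affine_fspaceE[OF f x]) (rule that)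
    obtain a' b' where ab': "a' \<in> ?A" "b' \<in> ?A" "b' x \<noteq> 0"
      "\<And>y. y \<in> U \<Longrightarrow> b' y \<noteq> 0 \<Longrightarrow> g y = a' y / b' y" by (rule reg_affine_fspaceE[OF g x]) (rule that)
    show "\<exists>a\<in>?A. \<exists>b\<in>?A. b x \<noteq> 0 \<and> (\<forall>y\<in>U. b y \<noteq> 0 \<longrightarrow> f y + g y = a y / b y)"
      by (intro bexI[of _ "\<lambda>x. a x * b' x + a' x * b x"] bexI[of _ "\<lambda>x. b x * b' x"] conjI)
         (use ab ab' in \<open>auto intro!: fun_algebra.intros(3,4) simp: add_frac_eq\<close>)
  qed
  show "(\<lambda>x. f x * g x) \<in> reg_of ?X U"
  proof (rule reg_affine_fspaceI)
    fix x assume x: "x \<in> U"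
    obtain a b where ab: "a \<in> ?A" "b \<in> ?A" "b x \<noteq> 0"
      "\<And>y. y \<in> U \<Longrightarrow> b y \<noteq> 0 \<Longrightarrow> f y = a y / b y" by (rule reg_affine_fspaceE[OF f x]) (rule that)
    obtain a' b' where ab': "a' \<in> ?A" "b' \<in> ?A" "b' x \<noteq> 0"
      "\<And>y. y \<in> U \<Longrightarrow> b' y \<noteq> 0 \<Longrightarrow> g y = a' y / b' y" by (rule reg_affine_fspaceE[OF g x]) (rule that)
    show "\<exists>a\<in>?A. \<exists>b\<in>?A. b x \<noteq> 0 \<and> (\<forall>y\<in>U. b y \<noteq> 0 \<longrightarrow> f y * g y = a y / b y)"
      by (intro bexI[of _ "\<lambda>x. a x * a' x"] bexI[of _ "\<lambda>x. b x * b' x"] conjI)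
         (use ab ab' in \<open>auto intro!: fun_algebra.intros(3,4)\<close>)
  qed
  show "(\<lambda>x. f x / g x) \<in> reg_of ?X U" if g0: "\<And>x. x \<in> U \<Longrightarrow> g x \<noteq> 0"
  proof (rule reg_affine_fspaceI)
    fix x assume x: "x \<in> U"
    obtain a b where ab: "a \<in> ?A" "b \<in> ?A" "b x \<noteq> 0"
      "\<And>y. y \<in> U \<Longrightarrow> b y \<noteq> 0 \<Longrightarrow> f y = a y / b y" by (rule reg_affine_fspaceE[OF f x]) (rule that)
    obtain a' b' where ab': "a' \<in> ?A" "b' \<in> ?A" "b' x \<noteq> 0"
      "\<And>y. y \<in> U \<Longrightarrow> b' y \<noteq> 0 \<Longrightarrow> g y = a' y / b' y" by (rule reg_affine_fspaceE[OF g x]) (rule that)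
    have a': "a' x \<noteq> 0" using ab'(4)[OF x ab'(3)] g0[OF x] by auto
    show "\<exists>a\<in>?A. \<exists>b\<in>?A. b x \<noteq> 0 \<and> (\<forall>y\<in>U. b y \<noteq> 0 \<longrightarrow> f y / g y = a y / b y)"
      \<comment> \<open>The quotient of the fractions is \<open>a b' / (b a')\<close>. The extra
        factor \<open>b'\<close> on both sides forces \<open>b'\<close> to be nonzero wherever the
        new denominator is, so that the formula for \<open>g\<close> is available there.\<close>
      by (intro bexI[of _ "\<lambda>x. a x * b' x * b' x"] bexI[of _ "\<lambda>x. b x * a' x * b' x"] conjI)
         (use ab ab' a' in \<open>auto intro!: fun_algebra.intros(3,4)\<close>)
  qed
next
  let ?A = "fun_algebra S"
  let ?X = "affine_fspace X ?A"
  fix U f assume U: "openin (top_of ?X) U"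
    and loc: "\<And>x. x \<in> U \<Longrightarrow> \<exists>U' g. openin (top_of ?X) U' \<and> x \<in> U' \<and> g \<in> reg_of ?X U' \<and>
                            (\<forall>y \<in> U \<inter> U'. f y = g y)"
  then have UX: "U \<subseteq> X" using topspace_zariski openin_subset by fastforce
  show "f \<in> reg_of ?X U"
  proof (rule reg_affine_fspaceI)
    fix x assume x: "x \<in> U"
    obtain U' g where U': "openin (top_of ?X) U'" "x \<in> U'" and g: "g \<in> reg_of ?X U'"
      and fg: "\<And>y. y \<in> U \<Longrightarrow> y \<in> U' \<Longrightarrow> f y = g y" using loc[OF x] by blast
    obtain h where h: "h \<in> ?A" "h x \<noteq> 0" "\<And>y. y \<in> X \<Longrightarrow> h y \<noteq> 0 \<Longrightarrow> y \<in> U'"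
      using zariski_base U' by (metis top_of_affine_fspace)
    obtain a b where ab: "a \<in> ?A" "b \<in> ?A" "b x \<noteq> 0"
      "\<And>y. y \<in> U' \<Longrightarrow> b y \<noteq> 0 \<Longrightarrow> g y = a y / b y" by (rule reg_affine_fspaceE[OF g U'(2)]) (rule that)
    show "\<exists>a\<in>?A. \<exists>b\<in>?A. b x \<noteq> 0 \<and> (\<forall>y\<in>U. b y \<noteq> 0 \<longrightarrow> f y = a y / b y)"
      \<comment> \<open>Multiplying numerator and denominator by \<open>h\<close> confines the
        nonvanishing locus to \<open>U'\<close>, where the fraction represents \<open>g\<close> and
        hence \<open>f\<close>.\<close>
      by (intro bexI[of _ "\<lambda>x. a x * h x"] bexI[of _ "\<lambda>x. b x * h x"] conjI)
         (use ab h fg UX in \<open>auto intro!: fun_algebra.intros(3,4)\<close>)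
  qed
qed

section \<open>Quotient structures\<close>

lemma top_of_quotient_fspace:
  "openin (top_of (quotient_fspace X q)) U \<longleftrightarrow>
     U \<subseteq> q ` topspace (top_of X) \<and> openin (top_of X) {x \<in> topspace (top_of X). q x \<in> U}"
  unfolding quotient_fspace_def using istopology_quotient_fspace[of q "top_of X"]
  by (simp add: topology_inverse')

lemma topspace_quotient_fspace [simp]:
  "topspace (top_of (quotient_fspace X q)) = q ` topspace (top_of X)"
proof -
  have "openin (top_of (quotient_fspace X q)) (q ` topspace (top_of X))"
  proof -
    have "{x \<in> topspace (top_of X). q x \<in> q ` topspace (top_of X)} = topspace (top_of X)" by auto
    then show ?thesis unfolding top_of_quotient_fspace by simp
  qed
  then show ?thesis
    by (meson openin_subset openin_topspace subset_antisym top_of_quotient_fspace)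
qed

lemma reg_quotient_fspace:
  "f \<in> reg_of (quotient_fspace X q) U \<longleftrightarrow> f \<circ> q \<in> reg_of X {x \<in> topspace (top_of X). q x \<in> U}"
  by (simp add: quotient_fspace_def)

lemma function_sheaf_quotient_fspace:
  assumes "function_sheaf X"
  shows "function_sheaf (quotient_fspace X q)"
proof -
  interpret function_sheaf X by fact
  let ?P = "\<lambda>U. {x \<in> topspace (top_of X). q x \<in> U}"
  show ?thesis
  proof
    fix U assume U: "openin (top_of (quotient_fspace X q)) U"
    then have U1: "openin (top_of X) (?P U)" and U2: "U \<subseteq> q ` topspace (top_of X)"
      unfolding top_of_quotient_fspace by auto
    show "(\<lambda>_. c) \<in> reg_of (quotient_fspace X q) U" for c
      using const_reg[OF U1] by (simp add: reg_quotient_fspace comp_def)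
    show "f \<in> reg_of (quotient_fspace X q) U'"
      if "openin (top_of (quotient_fspace X q)) U'" "U' \<subseteq> U" "f \<in> reg_of (quotient_fspace X q) U"
      for f U'
      using that unfolding reg_quotient_fspace top_of_quotient_fspace
      by (auto intro: restrict_reg[OF U1])
    fix f assume f: "f \<in> reg_of (quotient_fspace X q) U"
    have "{x \<in> ?P U. (f \<circ> q) x \<noteq> 0} = ?P {x \<in> U. f x \<noteq> 0}" by auto
    then show "openin (top_of (quotient_fspace X q)) {x \<in> U. f x \<noteq> 0}"
      using openin_nonvanishing[OF U1, of "f \<circ> q"] f U2
      unfolding reg_quotient_fspace top_of_quotient_fspace by auto
    fix g assume g: "g \<in> reg_of (quotient_fspace X q) U"
    show "(\<lambda>x. f x + g x) \<in> reg_of (quotient_fspace X q) U"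
      "(\<lambda>x. f x * g x) \<in> reg_of (quotient_fspace X q) U"
      using f g add_reg[OF U1] mult_reg[OF U1] by (simp_all add: reg_quotient_fspace comp_def)
    show "(\<lambda>x. f x / g x) \<in> reg_of (quotient_fspace X q) U" if "\<And>x. x \<in> U \<Longrightarrow> g x \<noteq> 0"
      using f g divide_reg[OF U1] that by (simp add: reg_quotient_fspace comp_def)
  next
    fix U f assume U: "openin (top_of (quotient_fspace X q)) U"
      and loc: "\<And>x. x \<in> U \<Longrightarrow> \<exists>U' g. openin (top_of (quotient_fspace X q)) U' \<and> x \<in> U' \<and>
        g \<in> reg_of (quotient_fspace X q) U' \<and> (\<forall>y \<in> U \<inter> U'. f y = g y)"
    show "f \<in> reg_of (quotient_fspace X q) U"
      unfolding reg_quotient_fspace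
    proof (rule glue_reg)
      show "openin (top_of X) (?P U)" using U by (simp add: top_of_quotient_fspace)
      fix x assume x: "x \<in> ?P U"
      then obtain U' g where "openin (top_of (quotient_fspace X q)) U'" "q x \<in> U'"
        "g \<in> reg_of (quotient_fspace X q) U'" "\<forall>y \<in> U \<inter> U'. f y = g y" using loc[of "q x"] by blast
      then show "\<exists>U' g. openin (top_of X) U' \<and> x \<in> U' \<and> g \<in> reg_of X U' \<and>
          (\<forall>y\<in>?P U \<inter> U'. (f \<circ> q) y = g y)"
        using x unfolding reg_quotient_fspace top_of_quotient_fspace
        by (intro exI[of _ "?P U'"] exI[of _ "g \<circ> q"]) auto
    qed
  qed
qed

section \<open>Induced structures on subsets\<close>

lemma top_of_sub_fspace [simp]: "top_of (sub_fspace X S) = subtopology (top_of X) S"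
  by (simp add: sub_fspace_def)

lemma reg_sub_fspaceI:
  assumes "\<And>x. x \<in> U \<Longrightarrow> \<exists>U' g. openin (top_of X) U' \<and> x \<in> U' \<and> g \<in> reg_of X U' \<and>
                            (\<forall>y \<in> U \<inter> U'. f y = g y)"
  shows "f \<in> reg_of (sub_fspace X S) U"
proof -
  have "\<exists>U'. openin (top_of X) U' \<and> x \<in> U' \<and> (\<exists>g \<in> reg_of X U'. \<forall>y \<in> U \<inter> U'. f y = g y)"
    if "x \<in> U" for x using assms[OF that] by blast
  then show ?thesis by (simp add: sub_fspace_def)
qed

lemma reg_sub_fspaceE:
  assumes "f \<in> reg_of (sub_fspace X S) U" "x \<in> U"
  obtains U' g where "openin (top_of X) U'" "x \<in> U'" "g \<in> reg_of X U'"
    "\<And>y. y \<in> U \<Longrightarrow> y \<in> U' \<Longrightarrow> f y = g y"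
proof -
  have "\<exists>U'. openin (top_of X) U' \<and> x \<in> U' \<and> (\<exists>g \<in> reg_of X U'. \<forall>y \<in> U \<inter> U'. f y = g y)"
    using assms by (simp add: sub_fspace_def)
  then show ?thesis using that by blast
qed

lemma function_sheaf_sub_fspace:
  assumes "function_sheaf X"
  shows "function_sheaf (sub_fspace X S)"
proof -
  interpret function_sheaf X by fact
  let ?X = "sub_fspace X S"
  \<comment> \<open>Sums and products are formed from local extensions of the two functions on a
    common neighbourhood in the ambient space.\<close>
  have binop: "(\<lambda>x. p (f x) (g x)) \<in> reg_of ?X U"
    if p: "\<And>U f g. openin (top_of X) U \<Longrightarrow> f \<in> reg_of X U \<Longrightarrow> g \<in> reg_of X U \<Longrightarrow>
      (\<lambda>x. p (f x) (g x)) \<in> reg_of X U"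
      and f: "f \<in> reg_of ?X U" and g: "g \<in> reg_of ?X U" for p f g U
  proof (rule reg_sub_fspaceI)
    fix x assume x: "x \<in> U"
    obtain U1 f1 where 1: "openin (top_of X) U1" "x \<in> U1" "f1 \<in> reg_of X U1"
      "\<And>y. y \<in> U \<Longrightarrow> y \<in> U1 \<Longrightarrow> f y = f1 y" by (rule reg_sub_fspaceE[OF f x]) (rule that)
    obtain U2 g2 where 2: "openin (top_of X) U2" "x \<in> U2" "g2 \<in> reg_of X U2"
      "\<And>y. y \<in> U \<Longrightarrow> y \<in> U2 \<Longrightarrow> g y = g2 y" by (rule reg_sub_fspaceE[OF g x]) (rule that)
    have "openin (top_of X) (U1 \<inter> U2)" using 1 2 by blast
    moreover have "(\<lambda>x. p (f1 x) (g2 x)) \<in> reg_of X (U1 \<inter> U2)"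
      using 1 2 by (intro p) (auto intro: restrict_reg)
    ultimately show "\<exists>U' ga. openin (top_of X) U' \<and> x \<in> U' \<and> ga \<in> reg_of X U' \<and>
        (\<forall>y\<in>U \<inter> U'. p (f y) (g y) = ga y)"
      using 1 2 by (intro exI[of _ "U1 \<inter> U2"] exI[of _ "\<lambda>x. p (f1 x) (g2 x)"]) auto
  qed
  show ?thesis
  proof
    fix U assume U: "openin (top_of ?X) U"
    then obtain T where T: "openin (top_of X) T" "U = T \<inter> S"
      by (auto simp: openin_subtopology)
    show "(\<lambda>_. c) \<in> reg_of ?X U" for c
      by (rule reg_sub_fspaceI, intro exI[of _ T] exI[of _ "\<lambda>_. c"]) (use T const_reg in auto)
    show "f \<in> reg_of ?X U'" if U': "U' \<subseteq> U" and f: "f \<in> reg_of ?X U" for f U'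
    proof (rule reg_sub_fspaceI)
      fix x assume "x \<in> U'"
      with U' have x: "x \<in> U" by blast
      obtain T g where "openin (top_of X) T" "x \<in> T" "g \<in> reg_of X T"
        "\<And>y. y \<in> U \<Longrightarrow> y \<in> T \<Longrightarrow> f y = g y"
        by (rule reg_sub_fspaceE[OF f x]) (rule that)
      then show "\<exists>T g. openin (top_of X) T \<and> x \<in> T \<and> g \<in> reg_of X T \<and> (\<forall>y\<in>U' \<inter> T. f y = g y)"
        using U' by blast
    qed
    fix f assume f: "f \<in> reg_of ?X U"
    show "openin (top_of ?X) {x \<in> U. f x \<noteq> 0}"
    proof (subst openin_subopen, safe)
      fix x assume x: "x \<in> U" "f x \<noteq> 0"
      obtain U1 f1 where 1: "openin (top_of X) U1" "x \<in> U1" "f1 \<in> reg_of X U1"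
        "\<And>y. y \<in> U \<Longrightarrow> y \<in> U1 \<Longrightarrow> f y = f1 y" by (rule reg_sub_fspaceE[OF f x(1)]) (rule that)
      have "openin (top_of ?X) (T \<inter> {x \<in> U1. f1 x \<noteq> 0} \<inter> S)"
        using T(1) openin_nonvanishing[OF 1(1,3)] by (auto simp: openin_subtopology)
      then show "\<exists>V. openin (top_of ?X) V \<and> x \<in> V \<and> V \<subseteq> {x \<in> U. f x \<noteq> 0}"
        by (intro exI[of _ "T \<inter> {x \<in> U1. f1 x \<noteq> 0} \<inter> S"]) (use 1 x T(2) in auto)
    qed
    fix g assume g: "g \<in> reg_of ?X U"
    show "(\<lambda>x. f x + g x) \<in> reg_of ?X U" "(\<lambda>x. f x * g x) \<in> reg_of ?X U"
      using binop[OF add_reg f g] binop[OF mult_reg f g] by auto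
    show "(\<lambda>x. f x / g x) \<in> reg_of ?X U" if g0: "\<And>x. x \<in> U \<Longrightarrow> g x \<noteq> 0"
    proof -
      \<comment> \<open>A nowhere vanishing function on the subset may have local extensions with
        zeros off the subset. The neighbourhood is shrunk to the nonvanishing locus of the
        extension, and division is then multiplication by the inverse.\<close>
      have "(\<lambda>x. inverse (g x)) \<in> reg_of ?X U"
      proof (rule reg_sub_fspaceI)
        fix x assume x: "x \<in> U"
        obtain U1 g1 where 1: "openin (top_of X) U1" "x \<in> U1" "g1 \<in> reg_of X U1"
          "\<And>y. y \<in> U \<Longrightarrow> y \<in> U1 \<Longrightarrow> g y = g1 y" by (rule reg_sub_fspaceE[OF g x]) (rule that)
        have o: "openin (top_of X) {x \<in> U1. g1 x \<noteq> 0}" by (rule openin_nonvanishing) fact+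
        have "(\<lambda>x. 1 / g1 x) \<in> reg_of X {x \<in> U1. g1 x \<noteq> 0}"
          by (rule divide_reg[OF o const_reg[OF o] restrict_reg[OF 1(1) o _ 1(3)]]) auto
        moreover have "g1 x \<noteq> 0" using 1(4)[OF x 1(2)] g0[OF x] by simp
        ultimately show "\<exists>U' ga. openin (top_of X) U' \<and> x \<in> U' \<and> ga \<in> reg_of X U' \<and>
            (\<forall>y\<in>U \<inter> U'. inverse (g y) = ga y)"
          using o 1 g0 x
          by (intro exI[of _ "{x \<in> U1. g1 x \<noteq> 0}"] exI[of _ "\<lambda>x. 1 / g1 x"])
             (auto simp: inverse_eq_divide)
      qed
      from binop[OF mult_reg f this] show ?thesis by (simp add: divide_inverse)
    qed
  next
    fix U f assume U: "openin (top_of ?X) U"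
      and loc: "\<And>x. x \<in> U \<Longrightarrow> \<exists>U' g. openin (top_of ?X) U' \<and> x \<in> U' \<and> g \<in> reg_of ?X U' \<and>
                            (\<forall>y \<in> U \<inter> U'. f y = g y)"
    show "f \<in> reg_of ?X U"
    proof (rule reg_sub_fspaceI)
      fix x assume x: "x \<in> U"
      obtain U' g where U': "openin (top_of ?X) U'" "x \<in> U'" and g: "g \<in> reg_of ?X U'"
        and fg: "\<And>y. y \<in> U \<Longrightarrow> y \<in> U' \<Longrightarrow> f y = g y" using loc[OF x] by blast
      obtain T where T: "openin (top_of X) T" "U' = T \<inter> S"
        using U' by (auto simp: openin_subtopology)
      obtain U1 g1 where 1: "openin (top_of X) U1" "x \<in> U1" "g1 \<in> reg_of X U1"
        "\<And>y. y \<in> U' \<Longrightarrow> y \<in> U1 \<Longrightarrow> g y = g1 y" by (rule reg_sub_fspaceE[OF g U'(2)]) (rule that)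
      have o: "openin (top_of X) (U1 \<inter> T)" using 1 T by blast
      have "U \<subseteq> S" using U by (auto simp: openin_subtopology)
      then show "\<exists>U' g. openin (top_of X) U' \<and> x \<in> U' \<and> g \<in> reg_of X U' \<and>
          (\<forall>y\<in>U \<inter> U'. f y = g y)"
        using o U' fg T 1 restrict_reg[OF 1(1) o _ 1(3)]
        by (intro exI[of _ "U1 \<inter> T"] exI[of _ g1]) auto
    qed
  qed
qed

section \<open>Products\<close>

lemma tensor_funsI:
  fixes l :: nat
  assumes "\<And>i. i < l \<Longrightarrow> f i \<in> A" "\<And>i. i < l \<Longrightarrow> g i \<in> B"
    and "F = (\<lambda>z. \<Sum>i<l. f i (fst z) * g i (snd z))"
  shows "F \<in> tensor_funs A B"
  unfolding tensor_funs_def using assms by (auto simp: case_prod_beta' intro!: exI)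

lemma tensor_funsE:
  assumes "F \<in> tensor_funs A B"
  obtains l :: nat and f g where "\<And>i. i < l \<Longrightarrow> f i \<in> A" "\<And>i. i < l \<Longrightarrow> g i \<in> B"
    "F = (\<lambda>z. \<Sum>i<l. f i (fst z) * g i (snd z))"
  using assms unfolding tensor_funs_def by (auto simp: case_prod_beta')

text \<open>Concatenation of two families indexed by initial segments of the naturals, the indexing
  used both for tensors and for elements of ideals. It yields closure under addition in either
  case.\<close>

lemma sum_lessThan_append:
  fixes f g :: "nat \<Rightarrow> 'a::comm_monoid_add"
  shows "(\<Sum>i<l + l'. if i < l then f i else g (i - l)) = (\<Sum>i<l. f i) + (\<Sum>i<l'. g i)"
  by (induction l') (auto simp: add.assoc)

lemma tensor_funs_add:
  assumes "F \<in> tensor_funs A B" "F' \<in> tensor_funs A B"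
  shows "(\<lambda>z. F z + F' z) \<in> tensor_funs A B"
proof -
  obtain l :: nat and f g where 1: "\<And>i. i < l \<Longrightarrow> f i \<in> A" "\<And>i. i < l \<Longrightarrow> g i \<in> B"
    "F = (\<lambda>z. \<Sum>i<l. f i (fst z) * g i (snd z))" by (rule tensor_funsE[OF assms(1)]) (rule that)
  obtain l' :: nat and f' g' where 2: "\<And>i. i < l' \<Longrightarrow> f' i \<in> A" "\<And>i. i < l' \<Longrightarrow> g' i \<in> B"
    "F' = (\<lambda>z. \<Sum>i<l'. f' i (fst z) * g' i (snd z))" by (rule tensor_funsE[OF assms(2)]) (rule that)
  let ?c = "\<lambda>f f' i. if i < l then f i else f' (i - l)"
  have "(\<Sum>i<l + l'. ?c f f' i (fst z) * ?c g g' i (snd z)) = F z + F' z" for z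
    unfolding 1(3) 2(3) sum_lessThan_append[symmetric] by (rule sum.cong) auto
  then show ?thesis
    using 1(1,2) 2(1,2)
    by (intro tensor_funsI[of "l + l'" "?c f f'" _ "?c g g'"]) auto
qed

lemma tensor_funs_single: "f \<in> A \<Longrightarrow> g \<in> B \<Longrightarrow> (\<lambda>z. f (fst z) * g (snd z)) \<in> tensor_funs A B"
  by (rule tensor_funsI[of 1 "\<lambda>_. f" _ "\<lambda>_. g"]) auto

lemma tensor_funs_sum:
  fixes l :: nat
  assumes "\<And>i. i < l \<Longrightarrow> F i \<in> tensor_funs A B"
  shows "(\<lambda>z. \<Sum>i<l. F i z) \<in> tensor_funs A B"
  using assms
proof (induction l)
  case 0
  show ?case by (rule tensor_funsI[of 0]) auto
qed (auto intro: tensor_funs_add)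

lemma tensor_funs_mult:
  assumes F: "F \<in> tensor_funs A B" and F': "F' \<in> tensor_funs A B"
    and A: "\<And>f f'. f \<in> A \<Longrightarrow> f' \<in> A \<Longrightarrow> (\<lambda>x. f x * f' x) \<in> A"
    and B: "\<And>f f'. f \<in> B \<Longrightarrow> f' \<in> B \<Longrightarrow> (\<lambda>x. f x * f' x) \<in> B"
  shows "(\<lambda>z. F z * F' z) \<in> tensor_funs A B"
proof -
  obtain l :: nat and f g where 1: "\<And>i. i < l \<Longrightarrow> f i \<in> A" "\<And>i. i < l \<Longrightarrow> g i \<in> B"
    "F = (\<lambda>z. \<Sum>i<l. f i (fst z) * g i (snd z))" by (rule tensor_funsE[OF F]) (rule that)
  obtain l' :: nat and f' g' where 2: "\<And>i. i < l' \<Longrightarrow> f' i \<in> A" "\<And>i. i < l' \<Longrightarrow> g' i \<in> B"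
    "F' = (\<lambda>z. \<Sum>i<l'. f' i (fst z) * g' i (snd z))" by (rule tensor_funsE[OF F']) (rule that)
  have "(\<lambda>z. \<Sum>i<l. \<Sum>j<l'. (f i (fst z) * f' j (fst z)) * (g i (snd z) * g' j (snd z)))
      \<in> tensor_funs A B"
    using 1 2 by (intro tensor_funs_sum tensor_funs_single A B)
  moreover have "(\<Sum>i<l. \<Sum>j<l'. (f i (fst z) * f' j (fst z)) * (g i (snd z) * g' j (snd z))) = F z * F' z"
    for z
    unfolding 1(3) 2(3) sum_product by (intro sum.cong refl) (simp add: ac_simps)
  ultimately show ?thesis by simp
qed

lemma tensor_funs_mono: "A \<subseteq> A' \<Longrightarrow> B \<subseteq> B' \<Longrightarrow> tensor_funs A B \<subseteq> tensor_funs A' B'"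
  unfolding tensor_funs_def by blast

lemma reg_prod_fspaceI:
  assumes "\<And>z. z \<in> W \<Longrightarrow> \<exists>U U' a b. openin (top_of X) U \<and> openin (top_of Y) U' \<and> z \<in> U \<times> U' \<and>
    a \<in> tensor_funs (reg_of X U) (reg_of Y U') \<and> b \<in> tensor_funs (reg_of X U) (reg_of Y U') \<and>
    b z \<noteq> 0 \<and> (\<forall>w \<in> W \<inter> (U \<times> U'). b w \<noteq> 0 \<longrightarrow> f w = a w / b w)"
  shows "f \<in> reg_of (prod_fspace X Y) W"
proof -
  have "\<exists>U U'. openin (top_of X) U \<and> openin (top_of Y) U' \<and> z \<in> U \<times> U' \<and>
      (\<exists>a \<in> tensor_funs (reg_of X U) (reg_of Y U'). \<exists>b \<in> tensor_funs (reg_of X U) (reg_of Y U').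
        b z \<noteq> 0 \<and> (\<forall>w \<in> W \<inter> (U \<times> U'). b w \<noteq> 0 \<longrightarrow> f w = a w / b w))" if "z \<in> W" for z
    using assms[OF that] by blast
  then show ?thesis unfolding prod_fspace_def fspace.select_convs by blast
qed

lemma reg_prod_fspaceE:
  assumes "f \<in> reg_of (prod_fspace X Y) W" "z \<in> W"
  obtains U U' a b where "openin (top_of X) U" "openin (top_of Y) U'" "z \<in> U \<times> U'"
    "a \<in> tensor_funs (reg_of X U) (reg_of Y U')" "b \<in> tensor_funs (reg_of X U) (reg_of Y U')"
    "b z \<noteq> 0" "\<And>w. w \<in> W \<Longrightarrow> w \<in> U \<times> U' \<Longrightarrow> b w \<noteq> 0 \<Longrightarrow> f w = a w / b w"
proof -
  have "\<exists>U U'. openin (top_of X) U \<and> openin (top_of Y) U' \<and> z \<in> U \<times> U' \<and>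
      (\<exists>a \<in> tensor_funs (reg_of X U) (reg_of Y U'). \<exists>b \<in> tensor_funs (reg_of X U) (reg_of Y U').
        b z \<noteq> 0 \<and> (\<forall>w \<in> W \<inter> (U \<times> U'). b w \<noteq> 0 \<longrightarrow> f w = a w / b w))"
    using assms unfolding prod_fspace_def fspace.select_convs by blast
  then show ?thesis using that by blast
qed

locale function_sheaf_pair = X: function_sheaf X + Y: function_sheaf Y
  for X :: "('a, 'k::field) fspace" and Y :: "('b, 'k) fspace"
begin

abbreviation tensor where "tensor U U' \<equiv> tensor_funs (reg_of X U) (reg_of Y U')"

lemma tensor_restrict:
  assumes "openin (top_of X) U1" "openin (top_of Y) U1'" "openin (top_of X) U" "openin (top_of Y) U'"
    "U1 \<subseteq> U" "U1' \<subseteq> U'" "f \<in> tensor U U'"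
  shows "f \<in> tensor U1 U1'"
proof -
  have "tensor U U' \<subseteq> tensor U1 U1'"
    using assms by (intro tensor_funs_mono) (auto intro: X.restrict_reg Y.restrict_reg)
  then show ?thesis using assms by blast
qed

lemma tensor_mult:
  "openin (top_of X) U \<Longrightarrow> openin (top_of Y) U' \<Longrightarrow> f \<in> tensor U U' \<Longrightarrow> g \<in> tensor U U' \<Longrightarrow>
    (\<lambda>z. f z * g z) \<in> tensor U U'"
  by (rule tensor_funs_mult) (auto intro: X.mult_reg Y.mult_reg)

lemma tensor_const:
  "openin (top_of X) U \<Longrightarrow> openin (top_of Y) U' \<Longrightarrow> (\<lambda>_. c) \<in> tensor U U'"
  using tensor_funs_single[OF X.const_reg[of U c] Y.const_reg[of U' 1]] by simp

lemma openin_prod_basic: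
  "openin (top_of X) U \<Longrightarrow> openin (top_of Y) U' \<Longrightarrow> f \<in> tensor U U' \<Longrightarrow>
    openin (top_of (prod_fspace X Y)) {z \<in> U \<times> U'. f z \<noteq> 0}"
  unfolding prod_fspace_def by simp (rule topology_generated_by_Basis, blast)

lemma openin_prod_Times:
  assumes "openin (top_of X) U" "openin (top_of Y) U'"
  shows "openin (top_of (prod_fspace X Y)) (U \<times> U')"
proof -
  have "{z \<in> U \<times> U'. (1::'k) \<noteq> 0} = U \<times> U'" by auto
  then show ?thesis
    using openin_prod_basic[OF assms tensor_const[OF assms, of 1]] by simp
qed

lemma topspace_prod_fspace:
  "topspace (top_of (prod_fspace X Y)) = topspace (top_of X) \<times> topspace (top_of Y)"
proof
  show "topspace (top_of (prod_fspace X Y)) \<subseteq> topspace (top_of X) \<times> topspace (top_of Y)"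
  proof
    fix z assume "z \<in> topspace (top_of (prod_fspace X Y))"
    then obtain U U' where z: "z \<in> U \<times> U'" and "openin (top_of X) U" "openin (top_of Y) U'"
      unfolding prod_fspace_def fspace.select_convs topology_generated_by_topspace by blast
    then have "U \<subseteq> topspace (top_of X)" "U' \<subseteq> topspace (top_of Y)" by (simp_all add: openin_subset)
    with z show "z \<in> topspace (top_of X) \<times> topspace (top_of Y)" by auto
  qed
  show "topspace (top_of X) \<times> topspace (top_of Y) \<subseteq> topspace (top_of (prod_fspace X Y))"
    by (rule openin_subset[OF openin_prod_Times[OF openin_topspace openin_topspace]])
qed

text \<open>Two basic sets can be intersected within one rectangle: both tensors restrict to the
  intersection of the rectangles, and their product is again a tensor there.\<close>

lemma prod_base:
  assumes "openin (top_of (prod_fspace X Y)) W" "z \<in> W"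
  obtains U U' h where "openin (top_of X) U" "openin (top_of Y) U'" "z \<in> U \<times> U'" "h \<in> tensor U U'"
    "h z \<noteq> 0" "\<And>w. w \<in> U \<times> U' \<Longrightarrow> h w \<noteq> 0 \<Longrightarrow> w \<in> W"
proof -
  let ?P = "\<lambda>W z. \<exists>U U' h. openin (top_of X) U \<and> openin (top_of Y) U' \<and> z \<in> U \<times> U' \<and>
    h \<in> tensor U U' \<and> h z \<noteq> 0 \<and> (\<forall>w\<in>U \<times> U'. h w \<noteq> 0 \<longrightarrow> w \<in> W)"
  have "generate_topology_on {{z \<in> U \<times> U'. f z \<noteq> 0} | U U' f.
            openin (top_of X) U \<and> openin (top_of Y) U' \<and> f \<in> tensor U U'} W"
    using assms(1) by (simp add: prod_fspace_def openin_topology_generated_by_iff)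
  then have "\<forall>z\<in>W. ?P W z"
  proof induction
    case (Int a b)
    show ?case
    proof
      fix z assume z: "z \<in> a \<inter> b"
      obtain U1 U1' h1 where 1: "openin (top_of X) U1" "openin (top_of Y) U1'" "z \<in> U1 \<times> U1'"
        "h1 \<in> tensor U1 U1'" "h1 z \<noteq> 0" "\<forall>w\<in>U1 \<times> U1'. h1 w \<noteq> 0 \<longrightarrow> w \<in> a"
        using Int.IH(1)[rule_format, OF IntD1[OF z]] by (elim exE conjE) (rule that)
      obtain U2 U2' h2 where 2: "openin (top_of X) U2" "openin (top_of Y) U2'" "z \<in> U2 \<times> U2'"
        "h2 \<in> tensor U2 U2'" "h2 z \<noteq> 0" "\<forall>w\<in>U2 \<times> U2'. h2 w \<noteq> 0 \<longrightarrow> w \<in> b"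
        using Int.IH(2)[rule_format, OF IntD2[OF z]] by (elim exE conjE) (rule that)
      have o: "openin (top_of X) (U1 \<inter> U2)" "openin (top_of Y) (U1' \<inter> U2')" using 1 2 by auto
      have "h1 \<in> tensor (U1 \<inter> U2) (U1' \<inter> U2')"
        by (rule tensor_restrict[OF o 1(1,2) _ _ 1(4)]) auto
      moreover have "h2 \<in> tensor (U1 \<inter> U2) (U1' \<inter> U2')"
        by (rule tensor_restrict[OF o 2(1,2) _ _ 2(4)]) auto
      ultimately have "(\<lambda>z. h1 z * h2 z) \<in> tensor (U1 \<inter> U2) (U1' \<inter> U2')"
        by (rule tensor_mult[OF o])
      then show "?P (a \<inter> b) z"
        using o 1 2
        by (intro exI[of _ "U1 \<inter> U2"] exI[of _ "U1' \<inter> U2'"] exI[of _ "\<lambda>z. h1 z * h2 z"]) auto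
    qed
  next
    case (UN K)
    show ?case
    proof
      fix z assume "z \<in> \<Union> K"
      then obtain k where k: "k \<in> K" "z \<in> k" by blast
      obtain U U' h where "openin (top_of X) U" "openin (top_of Y) U'" "z \<in> U \<times> U'"
        "h \<in> tensor U U'" "h z \<noteq> 0" "\<forall>w\<in>U \<times> U'. h w \<noteq> 0 \<longrightarrow> w \<in> k"
        using UN.IH[OF k(1), rule_format, OF k(2)] by (elim exE conjE) (rule that)
      then show "?P (\<Union> K) z" using k(1)
        by (intro exI[of _ U] exI[of _ U'] exI[of _ h]) auto
    qed
  next
    case (Basis s)
    then obtain U U' f where "openin (top_of X) U" "openin (top_of Y) U'" "f \<in> tensor U U'"
      "s = {z \<in> U \<times> U'. f z \<noteq> 0}" by blast
    then show ?case
      by (intro ballI exI[of _ U] exI[of _ U'] exI[of _ f]) simp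
  next
    case Empty
    show ?case by simp
  qed
  then obtain U U' h where "openin (top_of X) U" "openin (top_of Y) U'" "z \<in> U \<times> U'"
    "h \<in> tensor U U'" "h z \<noteq> 0" "\<forall>w\<in>U \<times> U'. h w \<noteq> 0 \<longrightarrow> w \<in> W"
    using assms(2) by meson
  then show ?thesis by (intro that[of U U' h]) auto
qed

lemma reg_prod_restrict:
  assumes "f \<in> reg_of (prod_fspace X Y) W" "W' \<subseteq> W"
  shows "f \<in> reg_of (prod_fspace X Y) W'"
proof (rule reg_prod_fspaceI)
  fix z assume "z \<in> W'"
  with assms(2) have z: "z \<in> W" by blast
  obtain U U' a b where "openin (top_of X) U" "openin (top_of Y) U'" "z \<in> U \<times> U'"
    "a \<in> tensor U U'" "b \<in> tensor U U'"
    "b z \<noteq> 0" "\<And>w. w \<in> W \<Longrightarrow> w \<in> U \<times> U' \<Longrightarrow> b w \<noteq> 0 \<Longrightarrow> f w = a w / b w"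
    by (rule reg_prod_fspaceE[OF assms(1) z]) (rule that)
  then show "\<exists>U U' a b. openin (top_of X) U \<and> openin (top_of Y) U' \<and> z \<in> U \<times> U' \<and>
      a \<in> tensor U U' \<and> b \<in> tensor U U' \<and> b z \<noteq> 0 \<and>
      (\<forall>w\<in>W' \<inter> U \<times> U'. b w \<noteq> 0 \<longrightarrow> f w = a w / b w)"
    using assms(2) by blast
qed

text \<open>Two local fractions live on different rectangles at first; arithmetic with them needs a
  common one.\<close>

lemma reg_prod_common:
  assumes "f \<in> reg_of (prod_fspace X Y) W" "g \<in> reg_of (prod_fspace X Y) W" "z \<in> W"
  obtains U U' a b c d where "openin (top_of X) U" "openin (top_of Y) U'" "z \<in> U \<times> U'"
    "a \<in> tensor U U'" "b \<in> tensor U U'" "b z \<noteq> 0"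
    "\<And>w. w \<in> W \<Longrightarrow> w \<in> U \<times> U' \<Longrightarrow> b w \<noteq> 0 \<Longrightarrow> f w = a w / b w"
    "c \<in> tensor U U'" "d \<in> tensor U U'" "d z \<noteq> 0"
    "\<And>w. w \<in> W \<Longrightarrow> w \<in> U \<times> U' \<Longrightarrow> d w \<noteq> 0 \<Longrightarrow> g w = c w / d w"
proof -
  obtain U1 U1' a b where 1: "openin (top_of X) U1" "openin (top_of Y) U1'" "z \<in> U1 \<times> U1'"
    "a \<in> tensor U1 U1'" "b \<in> tensor U1 U1'"
    "b z \<noteq> 0" "\<And>w. w \<in> W \<Longrightarrow> w \<in> U1 \<times> U1' \<Longrightarrow> b w \<noteq> 0 \<Longrightarrow> f w = a w / b w"
    by (rule reg_prod_fspaceE[OF assms(1,3)]) (rule that)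
  obtain U2 U2' c d where 2: "openin (top_of X) U2" "openin (top_of Y) U2'" "z \<in> U2 \<times> U2'"
    "c \<in> tensor U2 U2'" "d \<in> tensor U2 U2'"
    "d z \<noteq> 0" "\<And>w. w \<in> W \<Longrightarrow> w \<in> U2 \<times> U2' \<Longrightarrow> d w \<noteq> 0 \<Longrightarrow> g w = c w / d w"
    by (rule reg_prod_fspaceE[OF assms(2,3)]) (rule that)
  have o: "openin (top_of X) (U1 \<inter> U2)" "openin (top_of Y) (U1' \<inter> U2')" using 1 2 by auto
  have "f' \<in> tensor (U1 \<inter> U2) (U1' \<inter> U2')" if "f' \<in> tensor U1 U1'" for f'
    by (rule tensor_restrict[OF o 1(1,2) _ _ that]) auto
  moreover have "f' \<in> tensor (U1 \<inter> U2) (U1' \<inter> U2')" if "f' \<in> tensor U2 U2'" for f'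
    by (rule tensor_restrict[OF o 2(1,2) _ _ that]) auto
  ultimately show ?thesis using o 1 2 by (intro that[of "U1 \<inter> U2" "U1' \<inter> U2'" a b c d]) auto
qed

lemma function_sheaf_prod_fspace: "function_sheaf (prod_fspace X Y)"
proof
  let ?X = "prod_fspace X Y"
  fix W assume W: "openin (top_of ?X) W"
  then have WX: "W \<subseteq> topspace (top_of X) \<times> topspace (top_of Y)"
    using openin_subset topspace_prod_fspace by fastforce
  show "(\<lambda>_. c) \<in> reg_of ?X W" for c
  proof (rule reg_prod_fspaceI)
    fix z assume "z \<in> W"
    then show "\<exists>U U' a b. openin (top_of X) U \<and> openin (top_of Y) U' \<and> z \<in> U \<times> U' \<and>
      a \<in> tensor U U' \<and> b \<in> tensor U U' \<and> b z \<noteq> 0 \<and>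
      (\<forall>w\<in>W \<inter> U \<times> U'. b w \<noteq> 0 \<longrightarrow> c = a w / b w)"
      using WX tensor_const[OF openin_topspace openin_topspace]
      by (intro exI[of _ "topspace (top_of X)"] exI[of _ "topspace (top_of Y)"]
          exI[of _ "\<lambda>_. c"] exI[of _ "\<lambda>_. 1"]) auto
  qed
  show "f \<in> reg_of ?X W'" if "W' \<subseteq> W" "f \<in> reg_of ?X W" for f W'
    using that reg_prod_restrict by blast
  fix f assume f: "f \<in> reg_of ?X W"
  show "openin (top_of ?X) {x \<in> W. f x \<noteq> 0}"
  proof (subst openin_subopen, safe)
    fix x y assume x: "(x, y) \<in> W" "f (x, y) \<noteq> 0"
    obtain U U' a b where *: "openin (top_of X) U" "openin (top_of Y) U'" "(x, y) \<in> U \<times> U'"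
      "a \<in> tensor U U'" "b \<in> tensor U U'"
      "b (x, y) \<noteq> 0" "\<And>w. w \<in> W \<Longrightarrow> w \<in> U \<times> U' \<Longrightarrow> b w \<noteq> 0 \<Longrightarrow> f w = a w / b w"
      by (rule reg_prod_fspaceE[OF f x(1)]) (rule that)
    let ?T = "W \<inter> {z \<in> U \<times> U'. a z \<noteq> 0} \<inter> {z \<in> U \<times> U'. b z \<noteq> 0}"
    have "openin (top_of ?X) ?T" using * W by (intro openin_Int openin_prod_basic)
    moreover have "(x, y) \<in> ?T" using x * *(7)[of "(x, y)"] by auto
    moreover have "?T \<subseteq> {x \<in> W. f x \<noteq> 0}" using *(7) by fastforce
    ultimately show "\<exists>T. openin (top_of ?X) T \<and> (x, y) \<in> T \<and> T \<subseteq> {x \<in> W. f x \<noteq> 0}" by blast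
  qed
  fix g assume g: "g \<in> reg_of ?X W"
  show "(\<lambda>x. f x + g x) \<in> reg_of ?X W"
  proof (rule reg_prod_fspaceI)
    fix z assume z: "z \<in> W"
    obtain U U' a b c d where *: "openin (top_of X) U" "openin (top_of Y) U'" "z \<in> U \<times> U'"
      "a \<in> tensor U U'" "b \<in> tensor U U'" "b z \<noteq> 0"
      "\<And>w. w \<in> W \<Longrightarrow> w \<in> U \<times> U' \<Longrightarrow> b w \<noteq> 0 \<Longrightarrow> f w = a w / b w"
      "c \<in> tensor U U'" "d \<in> tensor U U'" "d z \<noteq> 0"
      "\<And>w. w \<in> W \<Longrightarrow> w \<in> U \<times> U' \<Longrightarrow> d w \<noteq> 0 \<Longrightarrow> g w = c w / d w"
      by (rule reg_prod_common[OF f g z]) (rule that)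
    show "\<exists>U U' a b. openin (top_of X) U \<and> openin (top_of Y) U' \<and> z \<in> U \<times> U' \<and>
      a \<in> tensor U U' \<and> b \<in> tensor U U' \<and> b z \<noteq> 0 \<and>
      (\<forall>w\<in>W \<inter> U \<times> U'. b w \<noteq> 0 \<longrightarrow> f w + g w = a w / b w)"
      by (rule exI[of _ U], rule exI[of _ U'], rule exI[of _ "\<lambda>x. a x * d x + c x * b x"],
          rule exI[of _ "\<lambda>x. b x * d x"])
         (use * in \<open>auto intro!: tensor_funs_add tensor_mult simp: add_frac_eq\<close>)
  qed
  show "(\<lambda>x. f x * g x) \<in> reg_of ?X W"
  proof (rule reg_prod_fspaceI)
    fix z assume z: "z \<in> W"
    obtain U U' a b c d where *: "openin (top_of X) U" "openin (top_of Y) U'" "z \<in> U \<times> U'"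
      "a \<in> tensor U U'" "b \<in> tensor U U'" "b z \<noteq> 0"
      "\<And>w. w \<in> W \<Longrightarrow> w \<in> U \<times> U' \<Longrightarrow> b w \<noteq> 0 \<Longrightarrow> f w = a w / b w"
      "c \<in> tensor U U'" "d \<in> tensor U U'" "d z \<noteq> 0"
      "\<And>w. w \<in> W \<Longrightarrow> w \<in> U \<times> U' \<Longrightarrow> d w \<noteq> 0 \<Longrightarrow> g w = c w / d w"
      by (rule reg_prod_common[OF f g z]) (rule that)
    show "\<exists>U U' a b. openin (top_of X) U \<and> openin (top_of Y) U' \<and> z \<in> U \<times> U' \<and>
      a \<in> tensor U U' \<and> b \<in> tensor U U' \<and> b z \<noteq> 0 \<and>
      (\<forall>w\<in>W \<inter> U \<times> U'. b w \<noteq> 0 \<longrightarrow> f w * g w = a w / b w)"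
      by (rule exI[of _ U], rule exI[of _ U'], rule exI[of _ "\<lambda>x. a x * c x"],
          rule exI[of _ "\<lambda>x. b x * d x"])
         (use * in \<open>auto intro!: tensor_mult\<close>)
  qed
  show "(\<lambda>x. f x / g x) \<in> reg_of ?X W" if g0: "\<And>x. x \<in> W \<Longrightarrow> g x \<noteq> 0"
  proof (rule reg_prod_fspaceI)
    fix z assume z: "z \<in> W"
    obtain U U' a b c d where *: "openin (top_of X) U" "openin (top_of Y) U'" "z \<in> U \<times> U'"
      "a \<in> tensor U U'" "b \<in> tensor U U'" "b z \<noteq> 0"
      "\<And>w. w \<in> W \<Longrightarrow> w \<in> U \<times> U' \<Longrightarrow> b w \<noteq> 0 \<Longrightarrow> f w = a w / b w"
      "c \<in> tensor U U'" "d \<in> tensor U U'" "d z \<noteq> 0"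
      "\<And>w. w \<in> W \<Longrightarrow> w \<in> U \<times> U' \<Longrightarrow> d w \<noteq> 0 \<Longrightarrow> g w = c w / d w"
      by (rule reg_prod_common[OF f g z]) (rule that)
    have "c z \<noteq> 0" using *(11)[OF z *(3) *(10)] g0[OF z] by auto
    then show "\<exists>U U' a b. openin (top_of X) U \<and> openin (top_of Y) U' \<and> z \<in> U \<times> U' \<and>
      a \<in> tensor U U' \<and> b \<in> tensor U U' \<and> b z \<noteq> 0 \<and>
      (\<forall>w\<in>W \<inter> U \<times> U'. b w \<noteq> 0 \<longrightarrow> f w / g w = a w / b w)"
      by (intro exI[of _ U] exI[of _ U'] exI[of _ "\<lambda>x. a x * d x * d x"]
          exI[of _ "\<lambda>x. b x * c x * d x"])
         (use * in \<open>auto intro!: tensor_mult\<close>)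
  qed
next
  let ?X = "prod_fspace X Y"
  fix W f assume W: "openin (top_of ?X) W"
    and loc: "\<And>z. z \<in> W \<Longrightarrow> \<exists>W' g. openin (top_of ?X) W' \<and> z \<in> W' \<and> g \<in> reg_of ?X W' \<and>
                            (\<forall>y \<in> W \<inter> W'. f y = g y)"
  show "f \<in> reg_of ?X W"
  proof (rule reg_prod_fspaceI)
    fix z assume z: "z \<in> W"
    obtain W' g where W': "openin (top_of ?X) W'" "z \<in> W'" and g: "g \<in> reg_of ?X W'"
      and fg: "\<And>y. y \<in> W \<Longrightarrow> y \<in> W' \<Longrightarrow> f y = g y" using loc[OF z] by blast
    obtain U1 U1' h where 1: "openin (top_of X) U1" "openin (top_of Y) U1'" "z \<in> U1 \<times> U1'"
      "h \<in> tensor U1 U1'" "h z \<noteq> 0" "\<And>w. w \<in> U1 \<times> U1' \<Longrightarrow> h w \<noteq> 0 \<Longrightarrow> w \<in> W'"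
      by (rule prod_base[OF W']) (rule that)
    obtain U2 U2' a b where 2: "openin (top_of X) U2" "openin (top_of Y) U2'" "z \<in> U2 \<times> U2'"
      "a \<in> tensor U2 U2'" "b \<in> tensor U2 U2'"
      "b z \<noteq> 0" "\<And>w. w \<in> W' \<Longrightarrow> w \<in> U2 \<times> U2' \<Longrightarrow> b w \<noteq> 0 \<Longrightarrow> g w = a w / b w"
      by (rule reg_prod_fspaceE[OF g W'(2)]) (rule that)
    have o: "openin (top_of X) (U1 \<inter> U2)" "openin (top_of Y) (U1' \<inter> U2')" using 1 2 by auto
    have h: "h \<in> tensor (U1 \<inter> U2) (U1' \<inter> U2')"
      by (rule tensor_restrict[OF o 1(1,2) _ _ 1(4)]) auto
    have ab: "c \<in> tensor (U1 \<inter> U2) (U1' \<inter> U2')" if "c \<in> tensor U2 U2'" for c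
      by (rule tensor_restrict[OF o 2(1,2) _ _ that]) auto
    show "\<exists>U U' a b. openin (top_of X) U \<and> openin (top_of Y) U' \<and> z \<in> U \<times> U' \<and>
      a \<in> tensor U U' \<and> b \<in> tensor U U' \<and> b z \<noteq> 0 \<and>
      (\<forall>w\<in>W \<inter> U \<times> U'. b w \<noteq> 0 \<longrightarrow> f w = a w / b w)"
    proof (rule exI[of _ "U1 \<inter> U2"], rule exI[of _ "U1' \<inter> U2'"], rule exI[of _ "\<lambda>x. a x * h x"],
          rule exI[of _ "\<lambda>x. b x * h x"], intro conjI ballI impI)
      fix w assume w: "w \<in> W \<inter> (U1 \<inter> U2) \<times> (U1' \<inter> U2')" "b w * h w \<noteq> 0"
      then have "w \<in> W'" by (intro 1(6)) auto
      then have "f w = g w" "g w = a w / b w" using w fg 2(7)[of w] by auto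
      then show "f w = a w * h w / (b w * h w)" using w by auto
    qed (use o 1 2 tensor_mult[OF o ab[OF 2(4)] h] tensor_mult[OF o ab[OF 2(5)] h] in auto)
  qed
qed

lemma reg_prod_fst:
  assumes "f \<in> reg_of X (topspace (top_of X))"
  shows "(\<lambda>z. f (fst z)) \<in> reg_of (prod_fspace X Y) (topspace (top_of (prod_fspace X Y)))"
proof (rule reg_prod_fspaceI)
  let ?U = "topspace (top_of X)" and ?U' = "topspace (top_of Y)"
  fix z assume "z \<in> topspace (top_of (prod_fspace X Y))"
  then show "\<exists>U U' a b. openin (top_of X) U \<and> openin (top_of Y) U' \<and> z \<in> U \<times> U' \<and>
      a \<in> tensor U U' \<and> b \<in> tensor U U' \<and> b z \<noteq> 0 \<and>
      (\<forall>w\<in>topspace (top_of (prod_fspace X Y)) \<inter> U \<times> U'. b w \<noteq> 0 \<longrightarrow> f (fst w) = a w / b w)"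
    using tensor_funs_single[OF assms Y.const_reg[of ?U' 1]] tensor_const[of ?U ?U' 1]
    by (intro exI[of _ ?U] exI[of _ ?U'] exI[of _ "\<lambda>z. f (fst z)"] exI[of _ "\<lambda>_. 1"])
       (auto simp: topspace_prod_fspace)
qed

lemma reg_prod_snd:
  assumes "f \<in> reg_of Y (topspace (top_of Y))"
  shows "(\<lambda>z. f (snd z)) \<in> reg_of (prod_fspace X Y) (topspace (top_of (prod_fspace X Y)))"
proof (rule reg_prod_fspaceI)
  let ?U = "topspace (top_of X)" and ?U' = "topspace (top_of Y)"
  fix z assume "z \<in> topspace (top_of (prod_fspace X Y))"
  then show "\<exists>U U' a b. openin (top_of X) U \<and> openin (top_of Y) U' \<and> z \<in> U \<times> U' \<and>
      a \<in> tensor U U' \<and> b \<in> tensor U U' \<and> b z \<noteq> 0 \<and>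
      (\<forall>w\<in>topspace (top_of (prod_fspace X Y)) \<inter> U \<times> U'. b w \<noteq> 0 \<longrightarrow> f (snd w) = a w / b w)"
    using tensor_funs_single[OF X.const_reg[of ?U 1] assms] tensor_const[of ?U ?U' 1]
    by (intro exI[of _ ?U] exI[of _ ?U'] exI[of _ "\<lambda>z. f (snd z)"] exI[of _ "\<lambda>_. 1"])
       (auto simp: topspace_prod_fspace)
qed

end

section \<open>Criteria for morphisms\<close>

lemma fspace_morphismD:
  assumes "fspace_morphism X Y \<phi>"
  shows "\<And>x. x \<in> topspace (top_of X) \<Longrightarrow> \<phi> x \<in> topspace (top_of Y)"
    and "\<And>U. openin (top_of Y) U \<Longrightarrow> openin (top_of X) {x \<in> topspace (top_of X). \<phi> x \<in> U}"
    and "\<And>U f. openin (top_of Y) U \<Longrightarrow> f \<in> reg_of Y U \<Longrightarrow>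
      (\<lambda>x. f (\<phi> x)) \<in> reg_of X {x \<in> topspace (top_of X). \<phi> x \<in> U}"
  using assms unfolding fspace_morphism_def continuous_map_def comp_def by auto

text \<open>Used for maps into the Grassmannian: it is enough to lift such a map to the space of
  frames.\<close>

lemma fspace_morphism_quotient:
  assumes "fspace_morphism Z X s"
  shows "fspace_morphism Z (quotient_fspace X q) (q \<circ> s)"
proof -
  have eq: "{x \<in> topspace (top_of Z). s x \<in> {x \<in> topspace (top_of X). q x \<in> U}} =
      {x \<in> topspace (top_of Z). q (s x) \<in> U}" for U
    using fspace_morphismD(1)[OF assms] by auto
  have op: "openin (top_of Z) {x \<in> topspace (top_of Z). q (s x) \<in> U}"
    if "openin (top_of (quotient_fspace X q)) U" for U
    using fspace_morphismD(2)[OF assms, of "{x \<in> topspace (top_of X). q x \<in> U}"] that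
    unfolding eq top_of_quotient_fspace by blast
  have reg: "(\<lambda>x. f (q (s x))) \<in> reg_of Z {x \<in> topspace (top_of Z). q (s x) \<in> U}"
    if "openin (top_of (quotient_fspace X q)) U" "f \<in> reg_of (quotient_fspace X q) U" for U f
    using fspace_morphismD(3)[OF assms, of "{x \<in> topspace (top_of X). q x \<in> U}" "f \<circ> q"] that
    unfolding eq top_of_quotient_fspace reg_quotient_fspace by simp
  show ?thesis
    unfolding fspace_morphism_def continuous_map_def
    using fspace_morphismD(1)[OF assms] op reg by (auto simp: comp_def)
qed

text \<open>Continuity is not inherited from the components, as the topology of the product is finer
  than the product topology. A generating set pulls back to the nonvanishing locus of a sum of
  products of regular functions, and such loci are open in the source.\<close>

lemma fspace_morphism_pair:
  assumes "function_sheaf Z" "function_sheaf X" "function_sheaf Y"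
    and f: "fspace_morphism Z X f" and g: "fspace_morphism Z Y g"
  shows "fspace_morphism Z (prod_fspace X Y) (\<lambda>z. (f z, g z))"
proof -
  interpret Z: function_sheaf Z by fact
  interpret function_sheaf_pair X Y using assms by (simp add: function_sheaf_pair_def)
  let ?h = "\<lambda>z. (f z, g z)"
  let ?T = "topspace (top_of Z)"
  have op: "openin (top_of Z) {z \<in> ?T. f z \<in> U \<and> g z \<in> U'}"
    if "openin (top_of X) U" "openin (top_of Y) U'" for U U'
    using openin_Int[OF fspace_morphismD(2)[OF f that(1)] fspace_morphismD(2)[OF g that(2)]]
    by (rule back_subst) auto
  have reg: "(\<lambda>z. a (?h z)) \<in> reg_of Z {z \<in> ?T. f z \<in> U \<and> g z \<in> U'}"
    if U: "openin (top_of X) U" "openin (top_of Y) U'" and a: "a \<in> tensor U U'" for U U' a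
  proof -
    obtain l :: nat and u v where uv: "\<And>i. i < l \<Longrightarrow> u i \<in> reg_of X U"
      "\<And>i. i < l \<Longrightarrow> v i \<in> reg_of Y U'" "a = (\<lambda>z. \<Sum>i<l. u i (fst z) * v i (snd z))"
      by (rule tensor_funsE[OF a]) (rule that)
    have "(\<lambda>z. \<Sum>i<l. u i (f z) * v i (g z)) \<in> reg_of Z {z \<in> ?T. f z \<in> U \<and> g z \<in> U'}"
    proof (intro Z.sum_reg Z.mult_reg op U)
      fix i assume "i \<in> {..<l}"
      then have i: "i < l" by simp
      show "(\<lambda>z. u i (f z)) \<in> reg_of Z {z \<in> ?T. f z \<in> U \<and> g z \<in> U'}"
        by (rule Z.restrict_reg[OF _ op[OF U] _ fspace_morphismD(3)[OF f U(1) uv(1)[OF i]]])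
           (use fspace_morphismD(2)[OF f U(1)] in auto)
      show "(\<lambda>z. v i (g z)) \<in> reg_of Z {z \<in> ?T. f z \<in> U \<and> g z \<in> U'}"
        by (rule Z.restrict_reg[OF _ op[OF U] _ fspace_morphismD(3)[OF g U(2) uv(2)[OF i]]])
           (use fspace_morphismD(2)[OF g U(2)] in auto)
    qed
    then show ?thesis by (simp add: uv(3))
  qed
  have cont: "continuous_map (top_of Z) (top_of (prod_fspace X Y)) ?h"
  proof -
    have "continuous_map (top_of Z) (topology_generated_by {{z \<in> U \<times> U'. f z \<noteq> 0} | U U' f.
            openin (top_of X) U \<and> openin (top_of Y) U' \<and> f \<in> tensor U U'}) ?h"
    proof (rule continuous_on_generated_topo)
      fix B assume "B \<in> {{z \<in> U \<times> U'. f z \<noteq> 0} | U U' f.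
            openin (top_of X) U \<and> openin (top_of Y) U' \<and> f \<in> tensor U U'}"
      then obtain U U' a where B: "B = {z \<in> U \<times> U'. a z \<noteq> 0}" "openin (top_of X) U"
        "openin (top_of Y) U'" "a \<in> tensor U U'" by blast
      have "?h -` B \<inter> ?T = {z \<in> {z \<in> ?T. f z \<in> U \<and> g z \<in> U'}. a (?h z) \<noteq> 0}"
        unfolding B by auto
      then show "openin (top_of Z) (?h -` B \<inter> ?T)"
        using Z.openin_nonvanishing[OF op[OF B(2,3)] reg[OF B(2-4)]] by simp
    next
      show "?h ` ?T \<subseteq> \<Union> {{z \<in> U \<times> U'. f z \<noteq> 0} | U U' f.
            openin (top_of X) U \<and> openin (top_of Y) U' \<and> f \<in> tensor U U'}"
        using fspace_morphismD(1)[OF f] fspace_morphismD(1)[OF g] topspace_prod_fspace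
        by (auto simp: prod_fspace_def topology_generated_by_topspace)
    qed
    then show ?thesis by (simp add: prod_fspace_def)
  qed
  show ?thesis
    unfolding fspace_morphism_def
  proof (intro conjI allI impI ballI cont)
    fix W F assume W: "openin (top_of (prod_fspace X Y)) W" and F: "F \<in> reg_of (prod_fspace X Y) W"
    let ?D = "{x \<in> ?T. ?h x \<in> W}"
    have oW: "openin (top_of Z) ?D" using cont W by (simp add: continuous_map_def)
    show "F \<circ> ?h \<in> reg_of Z ?D"
    proof (rule Z.glue_reg[OF oW])
      fix z assume z: "z \<in> ?D"
      obtain U U' a b where *: "openin (top_of X) U" "openin (top_of Y) U'" "?h z \<in> U \<times> U'"
        "a \<in> tensor U U'" "b \<in> tensor U U'"
        "b (?h z) \<noteq> 0" "\<And>w. w \<in> W \<Longrightarrow> w \<in> U \<times> U' \<Longrightarrow> b w \<noteq> 0 \<Longrightarrow> F w = a w / b w"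
        by (rule reg_prod_fspaceE[OF F, of "?h z"]) (use z in \<open>blast\<close>, rule that)
      let ?E = "{z \<in> ?T. f z \<in> U \<and> g z \<in> U'}"
      let ?E' = "{z \<in> ?E. b (?h z) \<noteq> 0}"
      note o = op[OF *(1,2)]
      have o': "openin (top_of Z) ?E'"
        by (rule Z.openin_nonvanishing[OF o reg[OF *(1,2,5)]])
      have "(\<lambda>z. a (?h z) / b (?h z)) \<in> reg_of Z ?E'"
        by (rule Z.divide_reg[OF o' Z.restrict_reg[OF o o' _ reg[OF *(1,2,4)]]
            Z.restrict_reg[OF o o' _ reg[OF *(1,2,5)]]]) auto
      then show "\<exists>U' g. openin (top_of Z) U' \<and> z \<in> U' \<and> g \<in> reg_of Z U' \<and>
          (\<forall>y\<in>?D \<inter> U'. (F \<circ> ?h) y = g y)"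
        using o' z * by (intro exI[of _ ?E'] exI[of _ "\<lambda>z. a (?h z) / b (?h z)"]) auto
    qed
  qed
qed

lemma fspace_morphism_sub:
  assumes "function_sheaf Z" and f: "fspace_morphism Z X f"
    and S: "\<And>z. z \<in> topspace (top_of Z) \<Longrightarrow> f z \<in> S"
  shows "fspace_morphism Z (sub_fspace X S) f"
proof -
  interpret Z: function_sheaf Z by fact
  have cont: "continuous_map (top_of Z) (top_of (sub_fspace X S)) f"
    using f S by (auto simp: fspace_morphism_def continuous_map_in_subtopology)
  show ?thesis
    unfolding fspace_morphism_def
  proof (intro conjI allI impI ballI cont)
    fix U F assume U: "openin (top_of (sub_fspace X S)) U" and F: "F \<in> reg_of (sub_fspace X S) U"
    have oU: "openin (top_of Z) {x \<in> topspace (top_of Z). f x \<in> U}"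
      using cont U by (simp add: continuous_map_def)
    show "F \<circ> f \<in> reg_of Z {x \<in> topspace (top_of Z). f x \<in> U}"
    proof (rule Z.glue_reg[OF oU])
      fix z assume z: "z \<in> {x \<in> topspace (top_of Z). f x \<in> U}"
      obtain U' g where *: "openin (top_of X) U'" "f z \<in> U'" "g \<in> reg_of X U'"
        "\<And>y. y \<in> U \<Longrightarrow> y \<in> U' \<Longrightarrow> F y = g y"
        by (rule reg_sub_fspaceE[OF F, of "f z"]) (use z in \<open>blast\<close>, rule that)
      show "\<exists>U' g. openin (top_of Z) U' \<and> z \<in> U' \<and> g \<in> reg_of Z U' \<and>
          (\<forall>y\<in>{x \<in> topspace (top_of Z). f x \<in> U} \<inter> U'. (F \<circ> f) y = g y)"
        using fspace_morphismD(2,3)[OF f *(1)] * z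
        by (intro exI[of _ "{x \<in> topspace (top_of Z). f x \<in> U'}"] exI[of _ "\<lambda>x. g (f x)"]) auto
    qed
  qed
qed

text \<open>Polynomials in the generators pull back to regular functions as soon as the generators
  do, and a local fraction pulls back to a quotient of such functions over the nonvanishing locus of
  its denominator.\<close>

lemma fspace_morphism_affine:
  fixes S :: "('b \<Rightarrow> 'k::field) set"
  assumes "function_sheaf X"
    and Y: "\<And>x. x \<in> topspace (top_of X) \<Longrightarrow> \<phi> x \<in> Y"
    and reg: "\<And>f. f \<in> S \<Longrightarrow> (\<lambda>x. f (\<phi> x)) \<in> reg_of X (topspace (top_of X))"
  shows "fspace_morphism X (affine_fspace Y (fun_algebra S)) \<phi>"
proof -
  interpret function_sheaf X by fact
  let ?T = "topspace (top_of X)"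
  let ?Y = "affine_fspace Y (fun_algebra S)"
  note reg' = fun_algebra_reg[OF openin_topspace reg]
  have cont: "continuous_map (top_of X) (top_of ?Y) \<phi>"
    unfolding top_of_affine_fspace zariski_def
  proof (rule continuous_on_generated_topo)
    fix B assume "B \<in> {{x \<in> Y. f x \<noteq> 0} |f. f \<in> fun_algebra S}"
    then obtain a where a: "B = {x \<in> Y. a x \<noteq> 0}" "a \<in> fun_algebra S" by blast
    have "\<phi> -` B \<inter> ?T = {x \<in> ?T. a (\<phi> x) \<noteq> 0}" unfolding a using Y by auto
    then show "openin (top_of X) (\<phi> -` B \<inter> ?T)"
      using openin_nonvanishing[OF openin_topspace reg'[OF _ a(2)]] by simp
  next
    show "\<phi> ` ?T \<subseteq> \<Union> {{x \<in> Y. f x \<noteq> 0} |f. f \<in> fun_algebra S}"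
      using Y topspace_zariski[of Y S] by (auto simp: zariski_def topology_generated_by_topspace)
  qed
  show ?thesis
    unfolding fspace_morphism_def
  proof (intro conjI allI impI ballI cont)
    fix U F assume U: "openin (top_of ?Y) U" and F: "F \<in> reg_of ?Y U"
    let ?D = "{x \<in> ?T. \<phi> x \<in> U}"
    have oU: "openin (top_of X) ?D" using cont U by (simp add: continuous_map_def)
    show "F \<circ> \<phi> \<in> reg_of X ?D"
    proof (rule glue_reg[OF oU])
      fix z assume z: "z \<in> ?D"
      obtain a b where ab: "a \<in> fun_algebra S" "b \<in> fun_algebra S" "b (\<phi> z) \<noteq> 0"
        "\<And>y. y \<in> U \<Longrightarrow> b y \<noteq> 0 \<Longrightarrow> F y = a y / b y"
        by (rule reg_affine_fspaceE[OF F, of "\<phi> z"]) (use z in \<open>blast\<close>, rule that)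
      let ?E = "{x \<in> ?T. b (\<phi> x) \<noteq> 0}"
      have o: "openin (top_of X) ?E"
        by (rule openin_nonvanishing[OF openin_topspace reg'[OF _ ab(2)]])
      have "(\<lambda>x. a (\<phi> x) / b (\<phi> x)) \<in> reg_of X ?E"
        by (rule divide_reg[OF o restrict_reg[OF openin_topspace o _ reg'[OF _ ab(1)]]
            restrict_reg[OF openin_topspace o _ reg'[OF _ ab(2)]]]) auto
      then show "\<exists>U' g. openin (top_of X) U' \<and> z \<in> U' \<and> g \<in> reg_of X U' \<and>
          (\<forall>y\<in>?D \<inter> U'. (F \<circ> \<phi>) y = g y)"
        using o z ab by (intro exI[of _ ?E] exI[of _ "\<lambda>x. a (\<phi> x) / b (\<phi> x)"]) auto
    qed
  qed
qed

section \<open>Linear algebra\<close>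

lemma vector_space_field: "Vector_Spaces.vector_space ((*) :: 'k::field \<Rightarrow> 'k \<Rightarrow> 'k)"
  by unfold_locales (simp_all add: algebra_simps)

lemma linear_simps:
  assumes "Vector_Spaces.linear s1 s2 f"
  shows "f (x + y) = f x + f y" "f (s1 c x) = s2 c (f x)" "f 0 = 0" "f (x - y) = f x - f y"
    "f (- x) = - f x" "f (sum g A) = (\<Sum>a\<in>A. f (g a))"
proof -
  interpret Vector_Spaces.linear s1 s2 f by fact
  show "f (x + y) = f x + f y" "f (s1 c x) = s2 c (f x)" "f 0 = 0" "f (x - y) = f x - f y"
    "f (- x) = - f x" "f (sum g A) = (\<Sum>a\<in>A. f (g a))"
    by (fact add scale zero diff neg sum)+
qed

text \<open>Actions, conjugates and inverses are linear on V only, whereas the definitions ask for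
  linear maps and linear forms on the ambient space. Extending from a basis bridges the gap; the
  values off the subspace are left open.\<close>

lemma (in vector_space_pair) linear_extension:
  assumes V: "vs1.subspace V"
    and add: "\<And>x y. x \<in> V \<Longrightarrow> y \<in> V \<Longrightarrow> f (x + y) = f x + f y"
    and scale: "\<And>c x. x \<in> V \<Longrightarrow> f (s1 c x) = s2 c (f x)"
  obtains F where "Vector_Spaces.linear s1 s2 F" "\<And>x. x \<in> V \<Longrightarrow> F x = f x"
proof -
  obtain B where B: "B \<subseteq> V" "vs1.independent B" "V \<subseteq> vs1.span B"
    using vs1.maximal_independent_subset by blast
  obtain F where F: "Vector_Spaces.linear s1 s2 F" "\<forall>x\<in>B. F x = f x"
    using linear_independent_extend[OF B(2)] by blast
  have "f 0 = 0" using add[of 0 0] vs1.subspace_0[OF V] by simp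
  then have "vs1.subspace {x \<in> V. F x = f x}"
    by (intro vs1.subspaceI)
       (auto simp: linear_simps[OF F(1)] add scale vs1.subspace_0[OF V] vs1.subspace_add[OF V]
          vs1.subspace_scale[OF V])
  then have "vs1.span B \<subseteq> {x \<in> V. F x = f x}"
    using B F by (intro vs1.span_minimal) auto
  then show ?thesis using F(1) B(3) that by blast
qed

locale ambient_space = Vector_Spaces.vector_space scale
  for scale :: "'k::field \<Rightarrow> 'v::ab_group_add \<Rightarrow> 'v"
begin

sublocale endo: vector_space_pair scale scale ..

lemma functional_pair: "vector_space_pair scale ((*) :: 'k \<Rightarrow> 'k \<Rightarrow> 'k)"
  by (intro vector_space_pair.intro vector_space_axioms vector_space_field)

abbreviation lin :: "('v \<Rightarrow> 'v) \<Rightarrow> bool" where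
  "lin \<equiv> Vector_Spaces.linear scale scale"

lemma linI: "(\<And>x y. f (x + y) = f x + f y) \<Longrightarrow> (\<And>c x. f (scale c x) = scale c (f x)) \<Longrightarrow> lin f"
  by (simp add: Vector_Spaces.linear_iff vector_space_axioms)

lemma functionalI:
  "(\<And>x y. \<xi> (x + y) = \<xi> x + \<xi> y) \<Longrightarrow> (\<And>c x. \<xi> (scale c x) = c * \<xi> x) \<Longrightarrow> functional scale \<xi>"
  by (simp add: Vector_Spaces.linear_iff vector_space_axioms vector_space_field)

lemma lin_ident: "lin (\<lambda>x. x)"
  by (rule linI) auto

lemma lin_compose: "lin f \<Longrightarrow> lin g \<Longrightarrow> lin (\<lambda>x. g (f x))"
  by (rule linI) (auto simp: linear_simps)

lemma lin_add: "lin f \<Longrightarrow> lin g \<Longrightarrow> lin (\<lambda>x. f x + g x)"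
  by (rule linI) (auto simp: linear_simps scale_right_distrib)

lemma lin_scale: "lin f \<Longrightarrow> lin (\<lambda>x. scale c (f x))"
  by (rule linI) (auto simp: linear_simps scale_right_distrib scale_left_commute)

lemma functional_compose: "lin f \<Longrightarrow> functional scale \<xi> \<Longrightarrow> functional scale (\<lambda>x. \<xi> (f x))"
  by (rule functionalI) (auto simp: linear_simps)

lemma functional_diff:
  "functional scale \<xi> \<Longrightarrow> functional scale \<eta> \<Longrightarrow> functional scale (\<lambda>x. \<xi> x - \<eta> x)"
  by (rule functionalI) (auto simp: linear_simps algebra_simps)

text \<open>Submodules of schemes are defined by matrix coefficients against forms killing them. A
  separating form turns vanishing of such coefficients back into membership of vectors.\<close>

lemma separating_functional:
  assumes "subspace W" "v \<notin> W"
  obtains \<xi> where "functional scale \<xi>" "\<And>u. u \<in> W \<Longrightarrow> \<xi> u = 0" "\<xi> v = 1"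
proof -
  interpret fn: vector_space_pair scale "(*) :: 'k \<Rightarrow> 'k \<Rightarrow> 'k" by (rule functional_pair)
  obtain B where B: "B \<subseteq> W" "independent B" "W \<subseteq> span B"
    using maximal_independent_subset by blast
  then have WB: "W = span B" using assms(1) span_minimal by blast
  with assms B have "independent (insert v B)" by (intro independent_insertI) auto
  then obtain \<xi> where \<xi>: "functional scale \<xi>" "\<forall>x\<in>insert v B. \<xi> x = (if x = v then 1 else 0)"
    using fn.linear_independent_extend[of "insert v B" "\<lambda>x. if x = v then 1 else 0"] by blast
  have "subspace {x. \<xi> x = 0}"
    by (rule subspaceI) (auto simp: linear_simps[OF \<xi>(1)])
  moreover have "B \<subseteq> {x. \<xi> x = 0}" using \<xi>(2) B(1) assms(2) by auto
  ultimately have "W \<subseteq> {x. \<xi> x = 0}" unfolding WB by (intro span_minimal)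
  then show ?thesis using \<xi> that by auto
qed

lemma direct_decompD:
  assumes "direct_decomp V M N" "v \<in> V"
  obtains x y where "x \<in> M" "y \<in> N" "v = x + y"
proof -
  have "v \<in> {x + y |x y. x \<in> M \<and> y \<in> N}" using assms unfolding direct_decomp_def by simp
  then show ?thesis using that by blast
qed

lemma direct_decomp_commute:
  fixes V M N :: "'v set"
  assumes D: "direct_decomp V M N"
  shows "direct_decomp V N M"
proof -
  have sub: "{x + y |x y. x \<in> A \<and> y \<in> B} \<subseteq> {x + y |x y. x \<in> B \<and> y \<in> A}" for A B :: "'v set"
  proof
    fix v assume "v \<in> {x + y |x y. x \<in> A \<and> y \<in> B}"
    then obtain x y where "x \<in> A" "y \<in> B" "v = y + x" by (auto simp: add.commute)
    then show "v \<in> {x + y |x y. x \<in> B \<and> y \<in> A}" by blast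
  qed
  have "{x + y |x y. x \<in> M \<and> y \<in> N} = {x + y |x y. x \<in> N \<and> y \<in> M}"
    by (intro equalityI sub)
  then show "direct_decomp V N M" using D unfolding direct_decomp_def by (simp add: Int_commute)
qed

text \<open>The trivial intersection makes the component in M unique, hence additive and homogeneous
  on V; the resulting map is then extended to the ambient space.\<close>

lemma direct_decomp_projection:
  assumes M: "subspace M" and N: "subspace N" and D: "direct_decomp V M N"
  obtains e where "lin e" "\<And>x. x \<in> M \<Longrightarrow> e x = x" "\<And>y. y \<in> N \<Longrightarrow> e y = 0"
proof -
  have V: "V = {x + y |x y. x \<in> M \<and> y \<in> N}" and MN: "M \<inter> N = {0}"
    using D by (auto simp: direct_decomp_def)
  define f where "f v = (THE m. m \<in> M \<and> v - m \<in> N)" for v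
  have f: "f v = m" if "m \<in> M" "v - m \<in> N" for v m
    unfolding f_def
  proof (rule the_equality)
    fix m' assume m': "m' \<in> M \<and> v - m' \<in> N"
    have "m' - m \<in> M" using m' that subspace_diff[OF M] by auto
    moreover have "m' - m \<in> N" using subspace_diff[OF N that(2), of "v - m'"] m' by auto
    ultimately have "m' - m \<in> {0}" unfolding MN[symmetric] by blast
    then show "m' = m" by simp
  qed (use that in auto)
  have f': "f v \<in> M \<and> v - f v \<in> N" if v: "v \<in> V" for v
  proof -
    obtain m y where "v = m + y" "m \<in> M" "y \<in> N" using direct_decompD[OF D v] by blast
    then show ?thesis using f[of m v] by auto
  qed
  have sV: "subspace V" unfolding V by (rule subspace_sums[OF M N])
  obtain e where e: "lin e" "\<And>x. x \<in> V \<Longrightarrow> e x = f x"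
  proof (rule endo.linear_extension[OF sV, of f])
    show "f (x + y) = f x + f y" if "x \<in> V" "y \<in> V" for x y
    proof (rule f)
      have "x + y - (f x + f y) = (x - f x) + (y - f y)" by simp
      then show "x + y - (f x + f y) \<in> N"
        using f'[OF that(1)] f'[OF that(2)] subspace_add[OF N] by metis
    qed (use f'[OF that(1)] f'[OF that(2)] subspace_add[OF M] in auto)
    show "f (scale c x) = scale c (f x)" if "x \<in> V" for c x
      using f'[OF that] subspace_scale[OF M] subspace_scale[OF N, of "x - f x" c]
      by (intro f) (auto simp: scale_right_diff_distrib)
  qed blast
  have MV: "x \<in> V" if "x \<in> M" for x
    unfolding V using that subspace_0[OF N] by (intro CollectI exI[of _ x] exI[of _ 0]) simp
  have NV: "x \<in> V" if "x \<in> N" for x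
    unfolding V
    by (rule CollectI, rule exI[of _ "0::'v"], rule exI[of _ x]) (use that subspace_0[OF M] in simp)
  show ?thesis
  proof (rule that[OF e(1)])
    fix x assume "x \<in> M"
    then show "e x = x" using e(2)[OF MV] f[of x x] subspace_0[OF N] by simp
  next
    fix x assume "x \<in> N"
    then show "e x = 0" using e(2)[OF NV] f[of 0 x] subspace_0[OF M] by simp
  qed
qed

lemma finite_basis:
  assumes "subspace M" "M \<subseteq> span B" "finite B"
  obtains C where "finite C" "independent C" "M = span C" "card C = dim M"
proof -
  obtain C where C: "C \<subseteq> M" "independent C" "M \<subseteq> span C" "card C = dim M"
    using basis_exists by blast
  have fin: "finite C" using independent_span_bound[OF assms(3) C(2)] C(1) assms(2) by blast
  show ?thesis
    by (rule that[OF fin C(2) span_subspace[OF C(1,3) assms(1), symmetric] C(4)])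
qed

lemma injective_endo_surj:
  assumes V: "V = span B" "finite B" and f: "lin f" "\<And>v. v \<in> V \<Longrightarrow> f v \<in> V"
    and inj: "\<And>v. v \<in> V \<Longrightarrow> f v = 0 \<Longrightarrow> v = 0"
  shows "f ` V = V"
proof -
  obtain C where C: "finite C" "independent C" "V = span C"
    by (rule finite_basis[of V B]) (use V in simp_all)
  have inj': "inj_on f (span C)"
  proof (rule inj_onI)
    fix x y assume "x \<in> span C" "y \<in> span C" "f x = f y"
    then have "f (x - y) = 0" "x - y \<in> V" using C span_diff by (auto simp: linear_simps[OF f(1)])
    then show "x = y" using inj by force
  qed
  interpret Vector_Spaces.linear scale scale f by fact
  have ind: "independent (f ` C)" by (rule independent_injective_image[OF C(2) inj'])
  have "f c \<in> span C" if "c \<in> C" for c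
    using f(2)[of c] span_base[OF that] by (simp add: C(3))
  then have sub: "f ` C \<subseteq> span C" by blast
  have card: "card (f ` C) = card C"
    using inj' span_superset by (intro card_image) (auto intro: inj_on_subset)
  have "c \<in> span (f ` C)" if c: "c \<in> span C" for c
  proof (rule ccontr)
    assume n: "c \<notin> span (f ` C)"
    have "independent (insert c (f ` C))" by (rule independent_insertI[OF n ind])
    then have "card (insert c (f ` C)) \<le> card C"
      using independent_span_bound[OF C(1)] sub c by simp
    moreover have "c \<notin> f ` C" using n span_base by blast
    ultimately show False using card C(1) by simp
  qed
  then have "V \<subseteq> f ` V" using span_image[of C] by (auto simp: C(3))
  then show ?thesis using f(2) by auto
qed

text \<open>The coordinates are linear forms on the whole ambient space, which is the shape of the
  generators of functions on frames and of matrix coefficients.\<close>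

lemma dual_basis:
  assumes "subspace M" "M \<subseteq> span B" "finite B"
  obtains u x where "\<And>i. i < dim M \<Longrightarrow> u i \<in> M" "\<And>i. functional scale (x i)"
    "\<And>i j. i < dim M \<Longrightarrow> j < dim M \<Longrightarrow> x i (u j) = (if i = j then 1 else 0)"
    "\<And>v. v \<in> M \<Longrightarrow> v = (\<Sum>i<dim M. scale (x i v) (u i))"
proof -
  interpret fn: vector_space_pair scale "(*) :: 'k \<Rightarrow> 'k \<Rightarrow> 'k" by (rule functional_pair)
  obtain C where C: "finite C" "independent C" "M = span C" "card C = dim M"
    by (rule finite_basis[OF assms]) (rule that)
  obtain u where u: "bij_betw u {..<dim M} C"
    using ex_bij_betw_nat_finite[OF C(1)] C(4) by (auto simp: atLeast0LessThan)
  have uC: "u i \<in> C" if "i < dim M" for i using u that by (auto simp: bij_betw_def)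
  have "\<exists>\<xi>. functional scale \<xi> \<and> (\<forall>c\<in>C. \<xi> c = (if c = u i then 1 else 0))" for i
    using fn.linear_independent_extend[OF C(2), of "\<lambda>c. if c = u i then 1 else 0"] by blast
  then obtain x where x: "\<And>i. functional scale (x i)"
    "\<And>i c. c \<in> C \<Longrightarrow> x i c = (if c = u i then 1 else 0)" by metis
  have xu: "x i (u j) = (if i = j then 1 else 0)" if "i < dim M" "j < dim M" for i j
    using x(2)[OF uC[OF that(2)], of i] u that by (auto simp: bij_betw_def inj_on_def)
  have "(\<Sum>i<dim M. scale (x i (scale c v)) (u i)) = scale c (\<Sum>i<dim M. scale (x i v) (u i))" for c v
    by (simp add: linear_simps[OF x(1)] scale_sum_right)
  then have "subspace {v. v = (\<Sum>i<dim M. scale (x i v) (u i))}"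
    by (intro subspaceI) (auto simp: linear_simps[OF x(1)] scale_left_distrib sum.distrib)
  moreover have "C \<subseteq> {v. v = (\<Sum>i<dim M. scale (x i v) (u i))}"
  proof
    fix c assume "c \<in> C"
    then obtain j where j: "j < dim M" "c = u j" using u by (auto simp: bij_betw_def)
    have "(\<Sum>i<dim M. scale (x i c) (u i)) = (\<Sum>i<dim M. if i = j then u i else 0)"
      by (rule sum.cong) (use j xu in auto)
    then show "c \<in> {v. v = (\<Sum>i<dim M. scale (x i v) (u i))}" using j by simp
  qed
  ultimately have "M \<subseteq> {v. v = (\<Sum>i<dim M. scale (x i v) (u i))}"
    unfolding C(3) by (intro span_minimal)
  then show ?thesis
  proof (intro that[of u x])
    show "u i \<in> M" if "i < dim M" for i unfolding C(3) by (rule span_base[OF uC[OF that]])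
  qed (use x(1) xu in auto)
qed

section \<open>Frames as linearly independent lists\<close>

lemma sum_set_frame:
  assumes "ws \<in> frames scale V m"
  shows "(\<Sum>w\<in>set ws. scale (c w) w) = (\<Sum>l<m. scale (c (ws ! l)) (ws ! l))"
proof -
  have "bij_betw ((!) ws) {..<m} (set ws)"
    using assms by (intro bij_betw_nth) (auto simp: frames_def)
  then show ?thesis by (rule sum.reindex_bij_betw[symmetric])
qed

lemma frame_independent:
  assumes ws: "ws \<in> frames scale V m" and 0: "(\<Sum>l<m. scale (c l) (ws ! l)) = 0" and l: "l < m"
  shows "c l = 0"
proof -
  have bij: "bij_betw ((!) ws) {..<m} (set ws)"
    using assms by (intro bij_betw_nth) (auto simp: frames_def)
  let ?d = "\<lambda>w. c (the_inv_into {..<m} ((!) ws) w)"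
  have d: "?d (ws ! l) = c l" if "l < m" for l
    using bij that by (simp add: bij_betw_def the_inv_into_f_f)
  have "(\<Sum>w\<in>set ws. scale (?d w) w) = 0"
    unfolding sum_set_frame[OF ws] using 0 d by simp
  moreover have "ws ! l \<in> set ws" using bij l by (auto simp: bij_betw_def)
  ultimately have "?d (ws ! l) = 0"
    using ws by (intro independentD[of "set ws" "set ws" ?d]) (auto simp: frames_def)
  then show ?thesis using d l by simp
qed

lemma span_frame:
  assumes ws: "ws \<in> frames scale V m" and v: "v \<in> span (set ws)"
  obtains c where "v = (\<Sum>l<m. scale (c l) (ws ! l))"
proof -
  obtain d where "v = (\<Sum>w\<in>set ws. scale (d w) w)" using v by (auto simp: span_finite)
  then show ?thesis using that[of "\<lambda>l. d (ws ! l)"] sum_set_frame[OF ws] by simp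
qed

lemma frameI:
  assumes "length ws = m" "set ws \<subseteq> V"
    and ind: "\<And>c l. (\<Sum>l<m. scale (c l) (ws ! l)) = 0 \<Longrightarrow> l < m \<Longrightarrow> c l = 0"
  shows "ws \<in> frames scale V m"
proof -
  have dist: "distinct ws"
    unfolding distinct_conv_nth
  proof (intro allI impI notI)
    fix i j assume ij: "i < length ws" "j < length ws" "i \<noteq> j" "ws ! i = ws ! j"
    \<comment> \<open>Two equal entries satisfy the relation with coefficients 1 and -1, so
      independence of the list as a family already implies distinctness.\<close>
    let ?c = "\<lambda>l. if l = i then 1 else if l = j then -1 else (0::'k)"
    have "(\<Sum>l<m. scale (?c l) (ws ! l)) = (\<Sum>l\<in>{i, j}. scale (?c l) (ws ! l))"
      by (rule sum.mono_neutral_right) (use ij assms(1) in auto)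
    also have "\<dots> = 0" using ij by simp
    finally have "?c i = 0" using ij(1) assms(1) by (intro ind) auto
    then show False by simp
  qed
  have bij: "bij_betw ((!) ws) {..<m} (set ws)"
    using assms(1) dist by (intro bij_betw_nth) auto
  have "independent (set ws)"
  proof (rule independent_if_scalars_zero)
    fix f w assume 0: "(\<Sum>w\<in>set ws. scale (f w) w) = 0" and w: "w \<in> set ws"
    obtain l where l: "l < m" "w = ws ! l" using w assms(1) by (auto simp: in_set_conv_nth)
    have "(\<Sum>l<m. scale (f (ws ! l)) (ws ! l)) = 0"
      using 0 sum.reindex_bij_betw[OF bij, of "\<lambda>w. scale (f w) w"] by simp
    from ind[OF this l(1)] show "f w = 0" using l by simp
  qed simp
  then show ?thesis using assms dist by (simp add: frames_def)
qed

end

section \<open>Coordinate rings\<close>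

abbreviation matrix_coordinates :: "nat \<Rightarrow> ('k::field mat \<Rightarrow> 'k) set" where
  "matrix_coordinates n \<equiv>
    insert (\<lambda>A. inverse (det A)) {\<lambda>A. A $$ (i, j) | i j. i < n \<and> j < n}"

lemma coord_ring_cong:
  "f \<in> coord_ring n G \<Longrightarrow> (\<And>g. g \<in> G \<Longrightarrow> f' g = f g) \<Longrightarrow> f' \<in> coord_ring n G"
  unfolding coord_ring_def by fastforce

lemma fun_algebra_coord_ring: "F \<in> fun_algebra (matrix_coordinates n) \<Longrightarrow> F \<in> coord_ring n G"
  unfolding coord_ring_def by blast

lemma coord_ring_const: "(\<lambda>_. c) \<in> coord_ring n G"
  by (intro fun_algebra_coord_ring fun_algebra.const)

lemma coord_ring_entry: "i < n \<Longrightarrow> j < n \<Longrightarrow> (\<lambda>A. A $$ (i, j)) \<in> coord_ring n G"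
  by (intro fun_algebra_coord_ring fun_algebra.gen) auto

lemma coord_ring_inverse_det: "(\<lambda>A. inverse (det A)) \<in> coord_ring n G"
  by (intro fun_algebra_coord_ring fun_algebra.gen) auto

lemma coord_ring_add:
  assumes "f \<in> coord_ring n G" "f' \<in> coord_ring n G"
  shows "(\<lambda>x. f x + f' x) \<in> coord_ring n G"
proof -
  obtain F F' where "F \<in> fun_algebra (matrix_coordinates n)" "\<forall>g\<in>G. f g = F g"
    "F' \<in> fun_algebra (matrix_coordinates n)" "\<forall>g\<in>G. f' g = F' g"
    using assms unfolding coord_ring_def by blast
  then show ?thesis
    unfolding coord_ring_def by (auto intro!: bexI[of _ "\<lambda>x. F x + F' x"] fun_algebra.add)
qed

lemma coord_ring_mult:
  assumes "f \<in> coord_ring n G" "f' \<in> coord_ring n G"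
  shows "(\<lambda>x. f x * f' x) \<in> coord_ring n G"
proof -
  obtain F F' where "F \<in> fun_algebra (matrix_coordinates n)" "\<forall>g\<in>G. f g = F g"
    "F' \<in> fun_algebra (matrix_coordinates n)" "\<forall>g\<in>G. f' g = F' g"
    using assms unfolding coord_ring_def by blast
  then show ?thesis
    unfolding coord_ring_def by (auto intro!: bexI[of _ "\<lambda>x. F x * F' x"] fun_algebra.mult)
qed

lemma coord_ring_sum:
  assumes "\<And>i. i \<in> I \<Longrightarrow> f i \<in> coord_ring n G"
  shows "(\<lambda>x. \<Sum>i\<in>I. f i x) \<in> coord_ring n G"
  using assms
  by (induction I rule: infinite_finite_induct) (auto intro: coord_ring_const coord_ring_add)

lemma coord_ring_fun_algebra:
  assumes "\<And>s. s \<in> S \<Longrightarrow> (\<lambda>g. s (\<phi> g)) \<in> coord_ring n G" "F \<in> fun_algebra S"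
  shows "(\<lambda>g. F (\<phi> g)) \<in> coord_ring n G"
  using assms(2)
  by induction (auto intro: assms coord_ring_const coord_ring_add coord_ring_mult)

lemma coord_ring_det:
  assumes "\<And>x. A x \<in> carrier_mat m m"
    and "\<And>i j. i < m \<Longrightarrow> j < m \<Longrightarrow> (\<lambda>x. A x $$ (i, j)) \<in> coord_ring n G"
  shows "(\<lambda>x. det (A x)) \<in> coord_ring n G"
proof -
  let ?S = "{\<lambda>x. A x $$ (i, j) | i j. i < m \<and> j < m}"
  have "(\<lambda>x. det (A x)) \<in> fun_algebra ?S"
    by (rule fun_algebra_det[OF assms(1)]) (auto intro!: fun_algebra.gen)
  then show ?thesis
    by (rule coord_ring_fun_algebra[rotated]) (use assms(2) in auto)
qed

text \<open>The entries and the inverse determinant generate the coordinate ring, so a map into a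
  matrix group is regular once these pull back to regular functions.\<close>

lemma coord_ring_compose:
  assumes "\<And>g. g \<in> G \<Longrightarrow> \<phi> g \<in> G'" "\<And>g. g \<in> G \<Longrightarrow> \<phi> g \<in> carrier_mat n n"
    and "\<And>i j. i < n \<Longrightarrow> j < n \<Longrightarrow> (\<lambda>g. \<phi> g $$ (i, j)) \<in> coord_ring n G"
    and "(\<lambda>g. inverse (det (\<phi> g))) \<in> coord_ring n G"
    and f: "f \<in> coord_ring n G'"
  shows "(\<lambda>g. f (\<phi> g)) \<in> coord_ring n G"
proof -
  obtain F where F: "F \<in> fun_algebra (matrix_coordinates n)" "\<forall>g\<in>G'. f g = F g"
    using f unfolding coord_ring_def by blast
  have "(\<lambda>g. F (\<phi> g)) \<in> coord_ring n G"
    by (rule coord_ring_fun_algebra[OF _ F(1)]) (use assms(3,4) in auto)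
  then show ?thesis by (rule coord_ring_cong) (use F assms in auto)
qed

section \<open>Matrix groups and their regular maps\<close>

lemma GL_carrierD: "A \<in> carrier (GL n) \<Longrightarrow> A \<in> carrier_mat n n" "A \<in> carrier (GL n) \<Longrightarrow> det A \<noteq> 0"
  by (auto simp: GL_def)

lemma GL_simps [simp]: "A \<otimes>\<^bsub>GL n\<^esub> B = A * B" "\<one>\<^bsub>GL n\<^esub> = 1\<^sub>m n"
  by (auto simp: GL_def)

lemma group_GL: "group (GL n :: 'k::field mat monoid)"
proof (rule groupI)
  fix A :: "'k mat" assume A: "A \<in> carrier (GL n)"
  then obtain B where B: "B \<in> carrier_mat n n" "B * A = 1\<^sub>m n"
    using det_non_zero_imp_unit[of A n] by (auto simp: GL_def Units_def ring_mat_def)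
  then have "det B * det A = 1" using A det_mult[of B n A] by (simp add: GL_def)
  then have "det B \<noteq> 0" by auto
  then show "\<exists>y\<in>carrier (GL n). y \<otimes>\<^bsub>GL n\<^esub> A = \<one>\<^bsub>GL n\<^esub>" using B by (auto simp: GL_def)
qed (auto simp: GL_def det_mult)

locale matrix_group =
  fixes n :: nat and G :: "'k::field mat set"
  assumes subgroup_GL: "subgroup G (GL n)"
begin

abbreviation gi :: "'k mat \<Rightarrow> 'k mat" where "gi g \<equiv> inv\<^bsub>GL n\<^esub> g"

lemma in_GL: "g \<in> G \<Longrightarrow> g \<in> carrier (GL n)"
  using subgroup.mem_carrier[OF subgroup_GL] .

lemma in_mat: "g \<in> G \<Longrightarrow> g \<in> carrier_mat n n" and det_nz: "g \<in> G \<Longrightarrow> det g \<noteq> 0"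
  by (rule GL_carrierD[OF in_GL], assumption)+

lemma one_G: "1\<^sub>m n \<in> G"
  using subgroup.one_closed[OF subgroup_GL] by simp

lemma mult_G: "g \<in> G \<Longrightarrow> h \<in> G \<Longrightarrow> g * h \<in> G"
  using subgroup.m_closed[OF subgroup_GL] by simp

lemma inv_G: "g \<in> G \<Longrightarrow> gi g \<in> G"
  using subgroup.m_inv_closed[OF subgroup_GL] .

lemma inv_mult: "g \<in> G \<Longrightarrow> gi g * g = 1\<^sub>m n" "g \<in> G \<Longrightarrow> g * gi g = 1\<^sub>m n"
  using group.l_inv[OF group_GL in_GL] group.r_inv[OF group_GL in_GL] by simp_all

lemma inv_inv: "g \<in> G \<Longrightarrow> gi (gi g) = g"
  using group.inv_inv[OF group_GL in_GL] .

lemma assoc: "a \<in> G \<Longrightarrow> b \<in> G \<Longrightarrow> c \<in> G \<Longrightarrow> a * b * c = a * (b * c)"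
  using assoc_mult_mat[OF in_mat in_mat in_mat] .

lemma one_mult: "g \<in> G \<Longrightarrow> 1\<^sub>m n * g = g" "g \<in> G \<Longrightarrow> g * 1\<^sub>m n = g"
  by (simp_all add: left_mult_one_mat[OF in_mat] right_mult_one_mat[OF in_mat])

lemma coord_ring_right:
  assumes h: "h \<in> G" and f: "f \<in> coord_ring n G"
  shows "(\<lambda>g. f (g * h)) \<in> coord_ring n G"
proof (rule coord_ring_compose[OF _ _ _ _ f])
  fix i j assume ij: "i < n" "j < n"
  have "(\<lambda>g. \<Sum>k<n. g $$ (i, k) * h $$ (k, j)) \<in> coord_ring n G"
    using ij by (intro coord_ring_sum coord_ring_mult coord_ring_const coord_ring_entry) auto
  then show "(\<lambda>g. (g * h) $$ (i, j)) \<in> coord_ring n G"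
  proof (rule coord_ring_cong)
    fix g assume "g \<in> G"
    then show "(g * h) $$ (i, j) = (\<Sum>k<n. g $$ (i, k) * h $$ (k, j))"
      using in_mat[OF h] in_mat[of g] ij by (auto simp: scalar_prod_def atLeast0LessThan)
  qed
next
  have "(\<lambda>g. inverse (det g) * inverse (det h)) \<in> coord_ring n G"
    by (intro coord_ring_mult coord_ring_const coord_ring_inverse_det)
  then show "(\<lambda>g. inverse (det (g * h))) \<in> coord_ring n G"
    by (rule coord_ring_cong) (simp add: det_mult[OF in_mat in_mat] h inverse_mult_distrib)
qed (use h mult_G in_mat in blast)+

lemma coord_ring_left:
  assumes h: "h \<in> G" and f: "f \<in> coord_ring n G"
  shows "(\<lambda>g. f (h * g)) \<in> coord_ring n G"
proof (rule coord_ring_compose[OF _ _ _ _ f])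
  fix i j assume ij: "i < n" "j < n"
  have "(\<lambda>g. \<Sum>k<n. h $$ (i, k) * g $$ (k, j)) \<in> coord_ring n G"
    using ij by (intro coord_ring_sum coord_ring_mult coord_ring_const coord_ring_entry) auto
  then show "(\<lambda>g. (h * g) $$ (i, j)) \<in> coord_ring n G"
  proof (rule coord_ring_cong)
    fix g assume "g \<in> G"
    then show "(h * g) $$ (i, j) = (\<Sum>k<n. h $$ (i, k) * g $$ (k, j))"
      using in_mat[OF h] in_mat[of g] ij by (auto simp: scalar_prod_def atLeast0LessThan)
  qed
next
  have "(\<lambda>g. inverse (det h) * inverse (det g)) \<in> coord_ring n G"
    by (intro coord_ring_mult coord_ring_const coord_ring_inverse_det)
  then show "(\<lambda>g. inverse (det (h * g))) \<in> coord_ring n G"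
    by (rule coord_ring_cong) (simp add: det_mult[OF in_mat in_mat] h inverse_mult_distrib)
qed (use h mult_G in_mat in blast)+

lemma coord_ring_conj:
  assumes h: "h \<in> G" and f: "f \<in> coord_ring n G"
  shows "(\<lambda>g. f (gi h * g * h)) \<in> coord_ring n G"
  using coord_ring_left[OF inv_G[OF h] coord_ring_right[OF h f]] .

text \<open>Needed for rationality of the conjugation action, whose coefficients involve both
  \<open>h\<close> and its inverse. Cramer's rule exhibits the entries of the inverse as polynomials
  in the entries divided by the determinant.\<close>

lemma coord_ring_inv:
  assumes f: "f \<in> coord_ring n G"
  shows "(\<lambda>g. f (gi g)) \<in> coord_ring n G"
proof (rule coord_ring_compose[OF _ _ _ _ f])
  fix i j assume ij: "i < n" "j < n"
  \<comment> \<open>This is \<open>g\<close> with column \<open>i\<close> replaced by the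
    \<open>j\<close>-th unit vector. Column \<open>j\<close> of the inverse solves the linear system
    with that right-hand side, and its entry \<open>i\<close> is the quotient of the two
    determinants.\<close>
  let ?A = "\<lambda>g :: 'k mat. mat n n (\<lambda>(k, l). if l = i then unit_vec n j $ k else g $$ (k, l))"
  have "(\<lambda>g. det (?A g)) \<in> coord_ring n G"
  proof (rule coord_ring_det)
    show "?A g \<in> carrier_mat n n" for g by simp
    fix k l assume kl: "k < n" "l < n"
    then have eq: "(\<lambda>g. ?A g $$ (k, l)) = (if l = i then (\<lambda>_. unit_vec n j $ k) else (\<lambda>g. g $$ (k, l)))"
      by auto
    show "(\<lambda>g. ?A g $$ (k, l)) \<in> coord_ring n G"
      unfolding eq by (simp add: coord_ring_const coord_ring_entry[OF kl])
  qed
  then have "(\<lambda>g. det (?A g) * inverse (det g)) \<in> coord_ring n G"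
    by (rule coord_ring_mult[OF _ coord_ring_inverse_det])
  then show "(\<lambda>g. gi g $$ (i, j)) \<in> coord_ring n G"
  proof (rule coord_ring_cong)
    fix g assume g: "g \<in> G"
    note gm = in_mat[OF g] and im = in_mat[OF inv_G[OF g]]
    have c: "col (gi g) j \<in> carrier_vec n" using im ij by auto
    have "g *\<^sub>v col (gi g) j = col (g * gi g) j"
      using gm im ij by auto
    also have "\<dots> = unit_vec n j" using inv_mult(2)[OF g] ij by simp
    finally have "det (replace_col g (unit_vec n j) i) = col (gi g) j $ i * det g"
      using cramer_lemma_mat[OF gm c ij(1)] by simp
    moreover have "replace_col g (unit_vec n j) i = ?A g"
      using gm by (auto simp: replace_col_def)
    moreover have "col (gi g) j $ i = gi g $$ (i, j)" using im ij by auto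
    ultimately show "gi g $$ (i, j) = det (?A g) * inverse (det g)"
      using det_nz[OF g] by simp
  qed
next
  \<comment> \<open>A copy of \<open>g\<close> that has the right dimensions for every argument, as
    \<open>coord_ring_det\<close> requires; it equals \<open>g\<close> on G.\<close>
  let ?B = "\<lambda>g :: 'k mat. mat n n (\<lambda>(k, l). g $$ (k, l))"
  have "(\<lambda>g. ?B g $$ (i, j)) = (\<lambda>g. g $$ (i, j))" if "i < n" "j < n" for i j
    using that by auto
  then have "(\<lambda>g. det (?B g)) \<in> coord_ring n G"
    by (intro coord_ring_det[of ?B n]) (simp_all add: coord_ring_entry)
  then show "(\<lambda>g. inverse (det (gi g))) \<in> coord_ring n G"
  proof (rule coord_ring_cong)
    fix g assume g: "g \<in> G"
    have "?B g = g" using in_mat[OF g] by auto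
    moreover have "det (gi g) * det g = 1"
      using det_mult[OF in_mat[OF inv_G[OF g]] in_mat[OF g]] inv_mult(1)[OF g] by simp
    ultimately show "inverse (det (gi g)) = det (?B g)"
      by (metis inverse_unique)
  qed
qed (use inv_G in_mat in blast)+

text \<open>
  The cosets of \<open>S\<close> are unions of translates of the open set \<open>D \<noteq> 0\<close>, hence \<open>S\<close> is open and closed.
\<close>

lemma connected_generated:
  assumes conn: "connectedin (GL_zariski n) G"
    and D: "D \<in> coord_ring n G" "D (1\<^sub>m n) \<noteq> 0"
    and S: "S \<subseteq> G" "1\<^sub>m n \<in> S" "\<And>g h. g \<in> S \<Longrightarrow> h \<in> S \<Longrightarrow> g * h \<in> S" "\<And>g. g \<in> S \<Longrightarrow> gi g \<in> S"
      "\<And>g. g \<in> G \<Longrightarrow> D g \<noteq> 0 \<Longrightarrow> g \<in> S"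
  shows "S = G"
proof (rule ccontr)
  assume "S \<noteq> G"
  then obtain t where t: "t \<in> G" "t \<notin> S" using S(1) by blast
  \<comment> \<open>The topology lives on all of \<open>GL n\<close>, so the translate of
    \<open>D\<close>, which is controlled on G only, is replaced by a regular function on
    \<open>GL n\<close> with the same values on G.\<close>
  have "\<exists>F. F \<in> coord_ring n (carrier (GL n)) \<and> (\<forall>g\<in>G. F g = D (gi s * g))" if s: "s \<in> G" for s
  proof -
    obtain F where "F \<in> fun_algebra (matrix_coordinates n)" "\<forall>g\<in>G. D (gi s * g) = F g"
      using coord_ring_left[OF inv_G[OF s] D(1)] unfolding coord_ring_def by blast
    then show ?thesis by (intro exI[of _ F]) (simp add: fun_algebra_coord_ring)
  qed
  then obtain F where F: "\<And>s. s \<in> G \<Longrightarrow> F s \<in> coord_ring n (carrier (GL n))"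
    "\<And>s g. s \<in> G \<Longrightarrow> g \<in> G \<Longrightarrow> F s g = D (gi s * g)" by metis
  define U where "U s = {g \<in> carrier (GL n). F s g \<noteq> 0}" for s
  have oU: "openin (GL_zariski n) (U s)" if "s \<in> G" for s
    unfolding U_def GL_zariski_def by (rule openin_zariski_basic[OF F(1)[OF that]])
  have U: "g \<in> U s \<longleftrightarrow> D (gi s * g) \<noteq> 0" if "s \<in> G" "g \<in> G" for s g
    unfolding U_def using in_GL[OF that(2)] F(2)[OF that] by simp
  have self: "s \<in> U s" if "s \<in> G" for s using U[OF that that] inv_mult(1)[OF that] D(2) by simp
  have US: "gi s * g \<in> S" if "s \<in> G" "g \<in> G" "g \<in> U s" for s g
    using S(5)[OF mult_G[OF inv_G[OF that(1)] that(2)]] U that by blast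
  let ?E1 = "\<Union>s\<in>S. U s" and ?E2 = "\<Union>s\<in>G - S. U s"
  have inS: "g \<in> S" if "s \<in> S" "g \<in> G" "g \<in> U s" for s g
  proof -
    have s: "s \<in> G" using that S by blast
    have "s * (gi s * g) = g"
      using assoc[OF s inv_G[OF s] that(2)] inv_mult(2)[OF s] one_mult(1)[OF that(2)] by simp
    then show ?thesis using S(3)[OF that(1) US[OF s that(2,3)]] by simp
  qed
  have notS: "g \<notin> S" if "s \<in> G - S" "g \<in> G" "g \<in> U s" for s g
  proof
    assume gS: "g \<in> S"
    have s: "s \<in> G" using that by blast
    let ?u = "gi s * g"
    have u: "?u \<in> S" "?u \<in> G" using US[OF s that(2,3)] S(1) by auto
    have "s * ?u = g"
      using assoc[OF s inv_G[OF s] that(2)] inv_mult(2)[OF s] one_mult(1)[OF that(2)] by simp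
    then have "g * gi ?u = s"
      using assoc[OF s u(2) inv_G[OF u(2)]] inv_mult(2)[OF u(2)] one_mult(2)[OF s] by simp
    then have "s \<in> S" using S(3)[OF gS S(4)[OF u(1)]] by simp
    then show False using that by blast
  qed
  have o: "openin (GL_zariski n) ?E1" "openin (GL_zariski n) ?E2"
    using oU S(1) by (auto intro!: openin_Union)
  have "G \<subseteq> ?E1 \<union> ?E2" using self by blast
  moreover have "?E1 \<inter> ?E2 \<inter> G = {}" using inS notS by blast
  moreover have "?E1 \<inter> G \<noteq> {}" using self S(1,2) one_G by blast
  moreover have "?E2 \<inter> G \<noteq> {}" using self t by blast
  ultimately show False using conn o unfolding connectedin by blast
qed

end

section \<open>Frobenius kernels\<close>

lemma fun_idealI:
  fixes l :: nat
  assumes "\<And>i. i < l \<Longrightarrow> a i \<in> A" "\<And>i. i < l \<Longrightarrow> s i \<in> S"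
    "\<And>g. g \<in> G \<Longrightarrow> f g = (\<Sum>i<l. a i g * s i g)"
  shows "f \<in> fun_ideal G A S"
  unfolding fun_ideal_def
  by (rule CollectI, rule exI[of _ l], rule exI[of _ a], rule exI[of _ s]) (use assms in simp)

lemma fun_idealE:
  assumes "f \<in> fun_ideal G A S"
  obtains l :: nat and a s where "\<And>i. i < l \<Longrightarrow> a i \<in> A" "\<And>i. i < l \<Longrightarrow> s i \<in> S"
    "\<And>g. g \<in> G \<Longrightarrow> f g = (\<Sum>i<l. a i g * s i g)"
proof -
  obtain l :: nat and a s where "(\<forall>i<l. a i \<in> A \<and> s i \<in> S) \<and> (\<forall>g\<in>G. f g = (\<Sum>i<l. a i g * s i g))"
    using assms unfolding fun_ideal_def mem_Collect_eq by (elim exE) (rule that)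
  then show ?thesis by (intro that[of l a s]) simp_all
qed

lemma fun_ideal_cong: "f \<in> fun_ideal G A S \<Longrightarrow> (\<And>g. g \<in> G \<Longrightarrow> f' g = f g) \<Longrightarrow> f' \<in> fun_ideal G A S"
  unfolding fun_ideal_def by simp

lemma fun_ideal_add:
  assumes "f \<in> fun_ideal G A S" "f' \<in> fun_ideal G A S"
  shows "(\<lambda>g. f g + f' g) \<in> fun_ideal G A S"
proof -
  obtain l :: nat and a s where 1: "\<And>i. i < l \<Longrightarrow> a i \<in> A" "\<And>i. i < l \<Longrightarrow> s i \<in> S"
    "\<And>g. g \<in> G \<Longrightarrow> f g = (\<Sum>i<l. a i g * s i g)" by (rule fun_idealE[OF assms(1)]) (rule that)
  obtain l' :: nat and a' s' where 2: "\<And>i. i < l' \<Longrightarrow> a' i \<in> A" "\<And>i. i < l' \<Longrightarrow> s' i \<in> S"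
    "\<And>g. g \<in> G \<Longrightarrow> f' g = (\<Sum>i<l'. a' i g * s' i g)" by (rule fun_idealE[OF assms(2)]) (rule that)
  let ?c = "\<lambda>f f' i. if i < l then f i else f' (i - l)"
  show ?thesis
  proof (rule fun_idealI[of "l + l'" "?c a a'" _ "?c s s'"])
    fix g assume "g \<in> G"
    then show "f g + f' g = (\<Sum>i<l + l'. ?c a a' i g * ?c s s' i g)"
      unfolding 1(3)[OF \<open>g \<in> G\<close>] 2(3)[OF \<open>g \<in> G\<close>] sum_lessThan_append[symmetric]
      by (intro sum.cong) auto
  qed (use 1 2 in auto)
qed

lemma fun_ideal_mult:
  assumes f: "f \<in> fun_ideal G A S" and b: "\<And>a. a \<in> A \<Longrightarrow> (\<lambda>g. b g * a g) \<in> A"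
  shows "(\<lambda>g. b g * f g) \<in> fun_ideal G A S"
proof -
  obtain l :: nat and a s where 1: "\<And>i. i < l \<Longrightarrow> a i \<in> A" "\<And>i. i < l \<Longrightarrow> s i \<in> S"
    "\<And>g. g \<in> G \<Longrightarrow> f g = (\<Sum>i<l. a i g * s i g)" by (rule fun_idealE[OF f]) (rule that)
  show ?thesis
  proof (rule fun_idealI[of l "\<lambda>i g. b g * a i g" _ s])
    show "(\<lambda>g. b g * a i g) \<in> A" if "i < l" for i by (rule b[OF 1(1)[OF that]])
  qed (use 1 in \<open>auto simp: sum_distrib_left mult.assoc\<close>)
qed

context matrix_group
begin

lemma frobenius_kernel_ideal_scale:
  "f \<in> frobenius_kernel_ideal n G r \<Longrightarrow> (\<lambda>g. c * f g) \<in> frobenius_kernel_ideal n G r"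
  unfolding frobenius_kernel_ideal_def
  by (erule fun_ideal_mult) (intro coord_ring_mult coord_ring_const)

text \<open>Positive characteristic makes the exponent nonzero, so the powers of functions vanishing
  at the identity vanish there too. Geometrically, the identity is a point of the Frobenius kernel;
  later this allows stability under H to be read off by evaluation at the identity.\<close>

lemma frobenius_kernel_ideal_one:
  assumes "f \<in> frobenius_kernel_ideal n G r" "CHAR('k) > 0"
  shows "f (1\<^sub>m n) = 0"
proof -
  let ?S = "{\<lambda>g. f g ^ (CHAR('k) ^ r) | f. f \<in> augmentation_ideal n G}"
  obtain l :: nat and a s where *: "\<And>i. i < l \<Longrightarrow> a i \<in> coord_ring n G" "\<And>i. i < l \<Longrightarrow> s i \<in> ?S"
    "\<And>g. g \<in> G \<Longrightarrow> f g = (\<Sum>i<l. a i g * s i g)"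
    using assms(1) unfolding frobenius_kernel_ideal_def by (rule fun_idealE) (rule that)
  have "s i (1\<^sub>m n) = 0" if i: "i < l" for i
  proof -
    obtain u where "s i = (\<lambda>g. u g ^ (CHAR('k) ^ r))" "u \<in> augmentation_ideal n G"
      using *(2)[OF i] by blast
    then show ?thesis using assms(2) by (simp add: augmentation_ideal_def)
  qed
  then show ?thesis using *(3)[OF one_G] by simp
qed

text \<open>Conjugation fixes the identity and commutes with taking powers, so it sends generators
  to generators. This is normality of the Frobenius kernel with respect to the points of G.\<close>

lemma frobenius_kernel_ideal_conj:
  assumes h: "h \<in> G" and f: "f \<in> frobenius_kernel_ideal n G r"
  shows "(\<lambda>g. f (gi h * g * h)) \<in> frobenius_kernel_ideal n G r"
proof -
  let ?S = "{\<lambda>g. f g ^ (CHAR('k) ^ r) | f. f \<in> augmentation_ideal n G}"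
  obtain l :: nat and a s where *: "\<And>i. i < l \<Longrightarrow> a i \<in> coord_ring n G" "\<And>i. i < l \<Longrightarrow> s i \<in> ?S"
    "\<And>g. g \<in> G \<Longrightarrow> f g = (\<Sum>i<l. a i g * s i g)"
    using f unfolding frobenius_kernel_ideal_def by (rule fun_idealE) (rule that)
  have S: "(\<lambda>g. t (gi h * g * h)) \<in> ?S" if t: "t \<in> ?S" for t
  proof -
    obtain u where u: "t = (\<lambda>g. u g ^ (CHAR('k) ^ r))" "u \<in> augmentation_ideal n G"
      using t by blast
    have "(\<lambda>g. u (gi h * g * h)) \<in> augmentation_ideal n G"
      using u(2) coord_ring_conj[OF h, of u] one_mult(2)[OF inv_G[OF h]] inv_mult(1)[OF h]
      by (simp add: augmentation_ideal_def)
    then show ?thesis unfolding u(1)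
      by (intro CollectI exI[of _ "\<lambda>g. u (gi h * g * h)"]) simp
  qed
  show ?thesis
    unfolding frobenius_kernel_ideal_def
  proof (rule fun_idealI[of l "\<lambda>i g. a i (gi h * g * h)" _ "\<lambda>i g. s i (gi h * g * h)"])
    fix i assume i: "i < l"
    show "(\<lambda>g. a i (gi h * g * h)) \<in> coord_ring n G" by (rule coord_ring_conj[OF h *(1)[OF i]])
    show "(\<lambda>g. s i (gi h * g * h)) \<in> ?S" by (rule S[OF *(2)[OF i]])
  next
    fix g assume g: "g \<in> G"
    show "f (gi h * g * h) = (\<Sum>i<l. a i (gi h * g * h) * s i (gi h * g * h))"
      by (rule *(3)[OF mult_G[OF mult_G[OF inv_G[OF h] g] h]])
  qed
qed

end

section \<open>Modules over a normal closed subgroup scheme\<close>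

text \<open>The subgroup scheme is represented by \<open>I\<close>, a linear space of functions
  compared on G only. Stability under conjugation expresses normality and is what allows the points
  of G to permute submodules and endomorphisms.\<close>

locale scheme_module = ambient_space scale + matrix_group n G
  for scale :: "'k::field \<Rightarrow> 'v::ab_group_add \<Rightarrow> 'v" and n :: nat and G :: "'k mat set" +
  fixes V :: "'v set" and \<rho> :: "'k mat \<Rightarrow> 'v \<Rightarrow> 'v" and I :: "('k mat \<Rightarrow> 'k) set"
  assumes rational: "rational_module n G scale V \<rho>"
    and I_cong: "f \<in> I \<Longrightarrow> (\<And>g. g \<in> G \<Longrightarrow> f' g = f g) \<Longrightarrow> f' \<in> I"
    and I_zero: "(\<lambda>_. 0) \<in> I"
    and I_add: "f \<in> I \<Longrightarrow> f' \<in> I \<Longrightarrow> (\<lambda>g. f g + f' g) \<in> I"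
    and I_scale: "f \<in> I \<Longrightarrow> (\<lambda>g. c * f g) \<in> I"
    and I_conj: "h \<in> G \<Longrightarrow> f \<in> I \<Longrightarrow> (\<lambda>g. f (inv\<^bsub>GL n\<^esub> h * g * h)) \<in> I"
begin

abbreviation submodule where "submodule \<equiv> scheme_submodule I scale V \<rho>"
abbreviation summand where "summand \<equiv> scheme_summand I scale V \<rho>"
abbreviation iso where "iso \<equiv> scheme_iso I scale \<rho>"

lemma I_diff: "f \<in> I \<Longrightarrow> f' \<in> I \<Longrightarrow> (\<lambda>g. f g - f' g) \<in> I"
  using I_add[OF _ I_scale[of f' "-1"]] by simp

lemma V_span: obtains B where "finite B" "V = span B"
  using rational unfolding rational_module_def fin_dim_subspace_def by blast

lemma subspace_V: "subspace V"
  by (rule V_span) simp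

lemma act_V: "g \<in> G \<Longrightarrow> v \<in> V \<Longrightarrow> \<rho> g v \<in> V"
  and act_add: "g \<in> G \<Longrightarrow> u \<in> V \<Longrightarrow> v \<in> V \<Longrightarrow> \<rho> g (u + v) = \<rho> g u + \<rho> g v"
  and act_scale: "g \<in> G \<Longrightarrow> v \<in> V \<Longrightarrow> \<rho> g (scale c v) = scale c (\<rho> g v)"
  and act_one: "v \<in> V \<Longrightarrow> \<rho> (1\<^sub>m n) v = v"
  and act_mult: "g \<in> G \<Longrightarrow> h \<in> G \<Longrightarrow> v \<in> V \<Longrightarrow> \<rho> (g * h) v = \<rho> g (\<rho> h v)"
  and act_coeff: "functional scale \<xi> \<Longrightarrow> v \<in> V \<Longrightarrow> (\<lambda>g. \<xi> (\<rho> g v)) \<in> coord_ring n G"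
  using rational unfolding rational_module_def by blast+

lemma act_inv: "g \<in> G \<Longrightarrow> v \<in> V \<Longrightarrow> \<rho> (gi g) (\<rho> g v) = v" "g \<in> G \<Longrightarrow> v \<in> V \<Longrightarrow> \<rho> g (\<rho> (gi g) v) = v"
  using act_mult[of "gi g" g v] act_mult[of g "gi g" v] inv_mult inv_G act_one by auto

lemma act_conj: "h \<in> G \<Longrightarrow> g \<in> G \<Longrightarrow> v \<in> V \<Longrightarrow> \<rho> (gi h * g * h) v = \<rho> (gi h) (\<rho> g (\<rho> h v))"
  using act_mult inv_G mult_G act_V by metis

lemma submoduleD:
  assumes "submodule W"
  shows "subspace W" "W \<subseteq> V" "\<And>w. w \<in> W \<Longrightarrow> w \<in> V"
    "\<And>w \<xi>. w \<in> W \<Longrightarrow> functional scale \<xi> \<Longrightarrow> (\<And>u. u \<in> W \<Longrightarrow> \<xi> u = 0) \<Longrightarrow> (\<lambda>g. \<xi> (\<rho> g w)) \<in> I"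
  using assms unfolding scheme_submodule_def by auto

lemma submoduleI:
  assumes "subspace W" "W \<subseteq> V"
    "\<And>w \<xi>. w \<in> W \<Longrightarrow> functional scale \<xi> \<Longrightarrow> (\<And>u. u \<in> W \<Longrightarrow> \<xi> u = 0) \<Longrightarrow> (\<lambda>g. \<xi> (\<rho> g w)) \<in> I"
  shows "submodule W"
  using assms unfolding scheme_submodule_def by blast

definition intertwines :: "('v \<Rightarrow> 'v) \<Rightarrow> 'v set \<Rightarrow> bool" where
  "intertwines \<phi> W \<longleftrightarrow>
    (\<forall>v \<in> W. \<forall>\<xi>. functional scale \<xi> \<longrightarrow> (\<lambda>g. \<xi> (\<rho> g (\<phi> v)) - \<xi> (\<phi> (\<rho> g v))) \<in> I)"

lemma intertwinesD:
  "intertwines \<phi> W \<Longrightarrow> v \<in> W \<Longrightarrow> functional scale \<xi> \<Longrightarrow>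
    (\<lambda>g. \<xi> (\<rho> g (\<phi> v)) - \<xi> (\<phi> (\<rho> g v))) \<in> I"
  unfolding intertwines_def by blast

lemma iso_alt: "iso P Q \<longleftrightarrow> (\<exists>\<phi>. lin \<phi> \<and> bij_betw \<phi> P Q \<and> intertwines \<phi> P)"
  unfolding scheme_iso_def intertwines_def by blast

text \<open>Stands for the endomorphism algebra of V over the subgroup scheme. Members are maps of
  the ambient space, so one endomorphism of V has many representatives; \<open>endos_cong\<close>
  moves between them.\<close>

definition endos :: "('v \<Rightarrow> 'v) set" where
  "endos = {\<phi>. lin \<phi> \<and> (\<forall>v \<in> V. \<phi> v \<in> V) \<and> intertwines \<phi> V}"

lemma endosD:
  assumes "\<phi> \<in> endos"
  shows "lin \<phi>" "\<And>v. v \<in> V \<Longrightarrow> \<phi> v \<in> V"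
    "\<And>v \<xi>. v \<in> V \<Longrightarrow> functional scale \<xi> \<Longrightarrow> (\<lambda>g. \<xi> (\<rho> g (\<phi> v)) - \<xi> (\<phi> (\<rho> g v))) \<in> I"
  using assms unfolding endos_def intertwines_def by auto

lemma endosI:
  assumes "lin \<phi>" "\<And>v. v \<in> V \<Longrightarrow> \<phi> v \<in> V"
    "\<And>v \<xi>. v \<in> V \<Longrightarrow> functional scale \<xi> \<Longrightarrow> (\<lambda>g. \<xi> (\<rho> g (\<phi> v)) - \<xi> (\<phi> (\<rho> g v))) \<in> I"
  shows "\<phi> \<in> endos"
  using assms unfolding endos_def intertwines_def by auto

lemma endos_cong:
  assumes \<phi>: "\<phi> \<in> endos" and "lin \<psi>" and eq: "\<And>v. v \<in> V \<Longrightarrow> \<psi> v = \<phi> v"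
  shows "\<psi> \<in> endos"
proof (rule endosI)
  fix v \<xi> assume v: "v \<in> V" and \<xi>: "functional scale \<xi>"
  show "(\<lambda>g. \<xi> (\<rho> g (\<psi> v)) - \<xi> (\<psi> (\<rho> g v))) \<in> I"
    by (rule I_cong[OF endosD(3)[OF \<phi> v \<xi>]]) (use v act_V eq in simp)
qed (use assms endosD in auto)

lemma endos_ident: "(\<lambda>v. v) \<in> endos"
  by (rule endosI) (use I_zero lin_ident in auto)

lemma endos_add:
  assumes "\<phi> \<in> endos" "\<psi> \<in> endos"
  shows "(\<lambda>v. \<phi> v + \<psi> v) \<in> endos"
proof (rule endosI)
  fix v \<xi> assume v: "v \<in> V" and \<xi>: "functional scale \<xi>"
  show "(\<lambda>g. \<xi> (\<rho> g (\<phi> v + \<psi> v)) - \<xi> (\<phi> (\<rho> g v) + \<psi> (\<rho> g v))) \<in> I"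
    by (rule I_cong[OF I_add[OF endosD(3)[OF assms(1) v \<xi>] endosD(3)[OF assms(2) v \<xi>]]])
       (use v endosD(2)[OF assms(1)] endosD(2)[OF assms(2)] in \<open>simp add: linear_simps[OF \<xi>] act_add\<close>)
qed (use assms endosD in \<open>auto intro: lin_add subspace_add[OF subspace_V]\<close>)

lemma endos_scale:
  assumes "\<phi> \<in> endos"
  shows "(\<lambda>v. scale c (\<phi> v)) \<in> endos"
proof (rule endosI)
  fix v \<xi> assume v: "v \<in> V" and \<xi>: "functional scale \<xi>"
  show "(\<lambda>g. \<xi> (\<rho> g (scale c (\<phi> v))) - \<xi> (scale c (\<phi> (\<rho> g v)))) \<in> I"
    by (rule I_cong[OF I_scale[OF endosD(3)[OF assms(1) v \<xi>], of c]])
       (use v endosD(2)[OF assms(1)] in \<open>simp add: linear_simps[OF \<xi>] act_scale algebra_simps\<close>)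
qed (use assms endosD in \<open>auto intro: lin_scale subspace_scale[OF subspace_V]\<close>)

lemma endos_diff:
  assumes "\<phi> \<in> endos" "\<psi> \<in> endos"
  shows "(\<lambda>v. \<phi> v - \<psi> v) \<in> endos"
  using endos_add[OF assms(1) endos_scale[OF assms(2), of "-1"]] by simp

text \<open>The failure of a composite to commute with the action splits into that of
  \<open>\<phi>\<close> at \<open>\<psi> v\<close> and that of \<open>\<psi>\<close> at
  \<open>v\<close>, the latter tested against the form composed with \<open>\<phi>\<close>.\<close>

lemma endos_compose:
  assumes \<phi>: "\<phi> \<in> endos" and \<psi>: "\<psi> \<in> endos"
  shows "(\<lambda>v. \<phi> (\<psi> v)) \<in> endos"
proof (rule endosI)
  fix v \<xi> assume v: "v \<in> V" and \<xi>: "functional scale \<xi>"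
  have \<xi>': "functional scale (\<lambda>x. \<xi> (\<phi> x))" by (rule functional_compose[OF endosD(1)[OF \<phi>] \<xi>])
  show "(\<lambda>g. \<xi> (\<rho> g (\<phi> (\<psi> v))) - \<xi> (\<phi> (\<psi> (\<rho> g v)))) \<in> I"
    by (rule I_cong[OF I_add[OF endosD(3)[OF \<phi> endosD(2)[OF \<psi> v] \<xi>] endosD(3)[OF \<psi> v \<xi>']]]) simp
qed (use assms endosD in \<open>auto intro: lin_compose\<close>)

lemma endos_inverse:
  assumes u: "u \<in> endos" and surj: "u ` V = V" and inj: "\<And>v. v \<in> V \<Longrightarrow> u v = 0 \<Longrightarrow> v = 0"
  obtains w where "w \<in> endos" "\<And>v. v \<in> V \<Longrightarrow> w (u v) = v" "\<And>v. v \<in> V \<Longrightarrow> u (w v) = v"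
proof -
  have inj': "inj_on u V"
  proof (rule inj_onI)
    fix x y assume "x \<in> V" "y \<in> V" "u x = u y"
    then have "u (x - y) = 0" "x - y \<in> V"
      using subspace_diff[OF subspace_V] by (auto simp: linear_simps[OF endosD(1)[OF u]])
    then show "x = y" using inj by force
  qed
  define f where "f = the_inv_into V u"
  have f: "f v \<in> V" "u (f v) = v" if "v \<in> V" for v
    using that surj inj' unfolding f_def by (auto intro: the_inv_into_into f_the_inv_into_f)
  have fu: "f x = y" if "y \<in> V" "u y = x" for x y
    using that inj' unfolding f_def by (auto simp: the_inv_into_f_f)
  obtain w where w: "lin w" "\<And>v. v \<in> V \<Longrightarrow> w v = f v"
  proof (rule endo.linear_extension[OF subspace_V, of f])
    show "f (x + y) = f x + f y" if "x \<in> V" "y \<in> V" for x y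
      using that f by (intro fu) (auto simp: linear_simps[OF endosD(1)[OF u]] subspace_add[OF subspace_V])
    show "f (scale c x) = scale c (f x)" if "x \<in> V" for c x
      using that f by (intro fu) (auto simp: linear_simps[OF endosD(1)[OF u]] subspace_scale[OF subspace_V])
  qed blast
  have wu: "w (u v) = v" if "v \<in> V" for v
    using w(2)[OF endosD(2)[OF u that]] fu[OF that refl] by simp
  have "w \<in> endos"
  proof (rule endosI[OF w(1)])
    show "w v \<in> V" if "v \<in> V" for v using w(2) f that by simp
    fix v \<xi> assume v: "v \<in> V" and \<xi>: "functional scale \<xi>"
    have y: "w v \<in> V" "u (w v) = v" using w(2) f v by auto
    have \<xi>': "functional scale (\<lambda>x. \<xi> (w x))" by (rule functional_compose[OF w(1) \<xi>])
    show "(\<lambda>g. \<xi> (\<rho> g (w v)) - \<xi> (w (\<rho> g v))) \<in> I"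
      \<comment> \<open>The defect of the inverse at \<open>v\<close> is minus the defect of
        \<open>u\<close> at \<open>w v\<close>, tested against the form composed with
        \<open>w\<close>.\<close>
      by (rule I_cong[OF I_scale[OF endosD(3)[OF u y(1) \<xi>'], of "-1"]])
         (use y act_V[OF _ y(1)] wu in simp)
  qed
  then show ?thesis using that wu f w(2) by auto
qed

text \<open>Here normality enters: the defect of the conjugate at \<open>v\<close> is the defect of
  \<open>\<phi>\<close> at \<open>\<rho> (gi h) v\<close> with \<open>g\<close> replaced by
  \<open>gi h * g * h\<close>, tested against the form composed with \<open>\<rho> h\<close>. That
  composite is linear on V only and is therefore extended to \<open>\<eta>\<close>.\<close>

lemma endos_conj:
  assumes \<phi>: "\<phi> \<in> endos" and h: "h \<in> G"
  obtains \<psi> where "\<psi> \<in> endos" "\<And>v. v \<in> V \<Longrightarrow> \<psi> v = \<rho> h (\<phi> (\<rho> (gi h) v))"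
proof -
  interpret fn: vector_space_pair scale "(*) :: 'k \<Rightarrow> 'k \<Rightarrow> 'k" by (rule functional_pair)
  note hi = inv_G[OF h] and lin = linear_simps[OF endosD(1)[OF \<phi>]]
  let ?f = "\<lambda>v. \<rho> h (\<phi> (\<rho> (gi h) v))"
  obtain \<psi> where \<psi>: "lin \<psi>" "\<And>v. v \<in> V \<Longrightarrow> \<psi> v = ?f v"
    by (rule endo.linear_extension[OF subspace_V, of ?f])
       (auto simp: act_add act_scale h hi lin act_V endosD(2)[OF \<phi>])
  have "\<psi> \<in> endos"
  proof (rule endosI[OF \<psi>(1)])
    show "\<psi> v \<in> V" if "v \<in> V" for v
      using that \<psi>(2) h hi act_V endosD(2)[OF \<phi>] by simp
    fix v \<xi> assume v: "v \<in> V" and \<xi>: "functional scale \<xi>"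
    let ?v = "\<rho> (gi h) v"
    have v': "?v \<in> V" "\<phi> ?v \<in> V" using v hi act_V endosD(2)[OF \<phi>] by auto
    obtain \<eta> where \<eta>: "functional scale \<eta>" "\<And>v. v \<in> V \<Longrightarrow> \<eta> v = \<xi> (\<rho> h v)"
      by (rule fn.linear_extension[OF subspace_V, of "\<lambda>v. \<xi> (\<rho> h v)"])
         (auto simp: act_add act_scale h linear_simps[OF \<xi>])
    show "(\<lambda>g. \<xi> (\<rho> g (\<psi> v)) - \<xi> (\<psi> (\<rho> g v))) \<in> I"
    proof (rule I_cong[OF I_conj[OF h endosD(3)[OF \<phi> v'(1) \<eta>(1)]]])
      fix g assume g: "g \<in> G"
      have "\<eta> (\<rho> (gi h * g * h) (\<phi> ?v)) = \<xi> (\<rho> g (\<psi> v))"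
        using act_conj[OF h g v'(2)] \<eta>(2) act_V act_inv(2) h hi g v v' \<psi>(2) by simp
      moreover have "\<eta> (\<phi> (\<rho> (gi h * g * h) ?v)) = \<xi> (\<psi> (\<rho> g v))"
        using act_conj[OF h g v'(1)] \<eta>(2) act_V act_inv(2) h hi g v v' \<psi>(2) endosD(2)[OF \<phi>]
        by simp
      ultimately show "\<xi> (\<rho> g (\<psi> v)) - \<xi> (\<psi> (\<rho> g v)) =
          \<eta> (\<rho> (gi h * g * h) (\<phi> ?v)) - \<eta> (\<phi> (\<rho> (gi h * g * h) ?v))" by simp
    qed
  qed
  then show ?thesis using that \<psi>(2) by blast
qed

lemma endos_surj:
  assumes u: "u \<in> endos" and inj: "\<And>v. v \<in> V \<Longrightarrow> u v = 0 \<Longrightarrow> v = 0"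
  shows "u ` V = V"
proof -
  obtain B where B: "finite B" "V = span B" by (rule V_span)
  show ?thesis by (rule injective_endo_surj[OF B(2,1) endosD(1,2)[OF u] inj])
qed

section \<open>Submodules and projections\<close>

lemma submodule_V: "submodule V"
proof (rule submoduleI[OF subspace_V subset_refl])
  fix w and \<xi> :: "'v \<Rightarrow> 'k" assume "w \<in> V" "\<And>u. u \<in> V \<Longrightarrow> \<xi> u = 0"
  then show "(\<lambda>g. \<xi> (\<rho> g w)) \<in> I" by (intro I_cong[OF I_zero]) (auto intro: act_V)
qed

lemma endos_projection:
  assumes M: "submodule M" and N: "submodule N" and D: "direct_decomp V M N"
  obtains e where "e \<in> endos" "\<And>x. x \<in> M \<Longrightarrow> e x = x" "\<And>y. y \<in> N \<Longrightarrow> e y = 0"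
    "\<And>v. v \<in> V \<Longrightarrow> e v \<in> M" "\<And>v. v \<in> V \<Longrightarrow> v - e v \<in> N"
proof -
  obtain e where e: "lin e" "\<And>x. x \<in> M \<Longrightarrow> e x = x" "\<And>y. y \<in> N \<Longrightarrow> e y = 0"
    by (rule direct_decomp_projection[OF submoduleD(1)[OF M] submoduleD(1)[OF N] D]) (rule that)
  have eM: "e v \<in> M \<and> v - e v \<in> N" if v: "v \<in> V" for v
  proof -
    obtain x y where "x \<in> M" "y \<in> N" "v = x + y" by (rule direct_decompD[OF D v]) (rule that)
    then show ?thesis using e by (auto simp: linear_simps[OF e(1)])
  qed
  have "e \<in> endos"
  proof (rule endosI[OF e(1)])
    show "e v \<in> V" if "v \<in> V" for v using eM[OF that] submoduleD(2)[OF M] by blast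
    fix v \<xi> assume v: "v \<in> V" and \<xi>: "functional scale \<xi>"
    have \<xi>': "functional scale (\<lambda>x. \<xi> (e x))" by (rule functional_compose[OF e(1) \<xi>])
    \<comment> \<open>The form \<open>\<xi> - \<xi> \<circ> e\<close> kills M and
      \<open>\<xi> \<circ> e\<close> kills N, so the submodule conditions apply to the two
      components of \<open>v\<close>.\<close>
    have "(\<lambda>g. \<xi> (\<rho> g (e v)) - \<xi> (e (\<rho> g (e v)))) \<in> I"
      using submoduleD(4)[OF M _ functional_diff[OF \<xi> \<xi>'], of "e v"] eM[OF v] e(2) by simp
    moreover have "(\<lambda>g. \<xi> (e (\<rho> g (v - e v)))) \<in> I"
      using submoduleD(4)[OF N _ \<xi>', of "v - e v"] eM[OF v] e(3) linear_simps(3)[OF \<xi>] by simp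
    ultimately show "(\<lambda>g. \<xi> (\<rho> g (e v)) - \<xi> (e (\<rho> g v))) \<in> I"
    proof (rule I_cong[OF I_diff])
      fix g assume g: "g \<in> G"
      have "\<rho> g v = \<rho> g (e v) + \<rho> g (v - e v)"
        using act_add[OF g, of "e v" "v - e v"] eM[OF v] submoduleD(3)[OF M] submoduleD(3)[OF N]
        by simp
      then show "\<xi> (\<rho> g (e v)) - \<xi> (e (\<rho> g v)) =
          \<xi> (\<rho> g (e v)) - \<xi> (e (\<rho> g (e v))) - \<xi> (e (\<rho> g (v - e v)))"
        by (simp add: linear_simps[OF \<xi>] linear_simps[OF e(1)])
    qed
  qed
  then show ?thesis using that e eM by blast
qed

lemma submodule_image:
  assumes W: "submodule W" and \<phi>: "\<phi> \<in> endos"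
  shows "submodule (\<phi> ` W)"
proof (rule submoduleI)
  interpret Vector_Spaces.linear scale scale \<phi> by (rule endosD(1)[OF \<phi>])
  show "subspace (\<phi> ` W)" by (rule subspace_image[OF submoduleD(1)[OF W]])
  show "\<phi> ` W \<subseteq> V" using submoduleD(3)[OF W] endosD(2)[OF \<phi>] by blast
  fix w \<xi> assume w: "w \<in> \<phi> ` W" and \<xi>: "functional scale \<xi>" and 0: "\<And>u. u \<in> \<phi> ` W \<Longrightarrow> \<xi> u = 0"
  obtain v where v: "v \<in> W" "w = \<phi> v" using w by blast
  have \<xi>': "functional scale (\<lambda>x. \<xi> (\<phi> x))" by (rule functional_compose[OF endosD(1)[OF \<phi>] \<xi>])
  have "(\<lambda>g. \<xi> (\<phi> (\<rho> g v))) \<in> I" by (rule submoduleD(4)[OF W v(1) \<xi>']) (use 0 in blast)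
  with endosD(3)[OF \<phi> submoduleD(3)[OF W v(1)] \<xi>]
  show "(\<lambda>g. \<xi> (\<rho> g w)) \<in> I" unfolding v(2) by (rule I_cong[OF I_add]) simp
qed

section \<open>Summands and their isomorphisms\<close>

lemma summandE:
  assumes "summand M"
  obtains e N where "submodule M" "submodule N" "direct_decomp V M N" "e \<in> endos"
    "\<And>x. x \<in> M \<Longrightarrow> e x = x" "\<And>y. y \<in> N \<Longrightarrow> e y = 0"
    "\<And>v. v \<in> V \<Longrightarrow> e v \<in> M" "\<And>v. v \<in> V \<Longrightarrow> v - e v \<in> N"
proof -
  obtain N where N: "submodule M" "submodule N" "direct_decomp V M N"
    using assms unfolding scheme_summand_def by blast
  show ?thesis by (rule endos_projection[OF N]) (rule that[OF N])
qed

lemma summand_submodule: "summand M \<Longrightarrow> submodule M"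
  unfolding scheme_summand_def by simp

lemma summandI: "submodule M \<Longrightarrow> submodule N \<Longrightarrow> direct_decomp V M N \<Longrightarrow> summand M"
  unfolding scheme_summand_def by blast

lemma summand_idempotent:
  assumes e: "e \<in> endos" and id: "\<And>v. v \<in> V \<Longrightarrow> e (e v) = e v"
  shows "summand (e ` V)"
proof (rule summandI)
  let ?f = "\<lambda>v. v - e v"
  note lin = linear_simps[OF endosD(1)[OF e]]
  have f: "?f \<in> endos" by (intro endos_diff endos_ident e)
  show "submodule (e ` V)" "submodule (?f ` V)"
    using submodule_image[OF submodule_V] e f by auto
  show "direct_decomp V (e ` V) (?f ` V)"
    unfolding direct_decomp_def
  proof (intro conjI equalityI subsetI)
    fix v assume v: "v \<in> V"
    then show "v \<in> {x + y |x y. x \<in> e ` V \<and> y \<in> ?f ` V}"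
      by (intro CollectI exI[of _ "e v"] exI[of _ "v - e v"]) auto
  next
    fix v assume "v \<in> {x + y |x y. x \<in> e ` V \<and> y \<in> ?f ` V}"
    then show "v \<in> V"
      using endosD(2)[OF e] endosD(2)[OF f] subspace_add[OF subspace_V] by blast
  next
    fix v assume v: "v \<in> e ` V \<inter> ?f ` V"
    then obtain x y where xy: "x \<in> V" "v = e x" "y \<in> V" "v = y - e y" by blast
    have "e v = v" using id[OF xy(1)] xy(2) by simp
    moreover have "e v = e y - e (e y)" by (simp only: xy(4) lin(4))
    ultimately show "v \<in> {0}" using id[OF xy(3)] by simp
  next
    fix v assume "v \<in> {0 :: 'v}"
    then show "v \<in> e ` V \<inter> ?f ` V"
      using subspace_0[OF subspace_V] by (auto simp: lin image_iff intro!: bexI[of _ 0])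
  qed
qed

text \<open>Precomposition with a projection onto the source turns an isomorphism of summands into
  an endomorphism of V. Composition, conjugation and inversion can then be carried out among
  endomorphisms of V.\<close>

lemma iso_endos:
  assumes "summand P" "iso P Q" "Q \<subseteq> V"
  obtains \<psi> where "\<psi> \<in> endos" "bij_betw \<psi> P Q" "\<And>v. v \<in> V \<Longrightarrow> \<psi> v \<in> Q"
proof -
  obtain e N where e: "submodule P" "e \<in> endos" "\<And>x. x \<in> P \<Longrightarrow> e x = x" "\<And>v. v \<in> V \<Longrightarrow> e v \<in> P"
    by (rule summandE[OF assms(1)]) (rule that)
  obtain \<phi> where \<phi>: "lin \<phi>" "bij_betw \<phi> P Q" "intertwines \<phi> P"
    using assms(2) iso_alt by blast
  have Q: "\<phi> (e v) \<in> Q" if "v \<in> V" for v using \<phi>(2) e(4)[OF that] by (auto simp: bij_betw_def)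
  have "(\<lambda>v. \<phi> (e v)) \<in> endos"
  proof (rule endosI)
    show "lin (\<lambda>v. \<phi> (e v))" by (rule lin_compose[OF endosD(1)[OF e(2)] \<phi>(1)])
    show "\<phi> (e v) \<in> V" if "v \<in> V" for v using Q[OF that] assms(3) by blast
    fix v \<xi> assume v: "v \<in> V" and \<xi>: "functional scale \<xi>"
    have \<xi>': "functional scale (\<lambda>x. \<xi> (\<phi> x))" by (rule functional_compose[OF \<phi>(1) \<xi>])
    show "(\<lambda>g. \<xi> (\<rho> g (\<phi> (e v))) - \<xi> (\<phi> (e (\<rho> g v)))) \<in> I"
      by (rule I_cong[OF I_add[OF intertwinesD[OF \<phi>(3) e(4)[OF v] \<xi>] endosD(3)[OF e(2) v \<xi>']]])
         simp
  qed
  moreover have "bij_betw (\<lambda>v. \<phi> (e v)) P Q"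
    using \<phi>(2) e(3) by (simp cong: bij_betw_cong)
  ultimately show ?thesis using that Q by blast
qed

lemma endos_iso: "\<psi> \<in> endos \<Longrightarrow> P \<subseteq> V \<Longrightarrow> bij_betw \<psi> P Q \<Longrightarrow> iso P Q"
  unfolding iso_alt using endosD[of \<psi>] by (auto simp: intertwines_def intro!: exI[of _ \<psi>])

lemma summand_subset: "summand P \<Longrightarrow> P \<subseteq> V"
  by (rule submoduleD(2)[OF summand_submodule])

lemma iso_trans:
  assumes "summand P" "summand Q" "R \<subseteq> V" "iso P Q" "iso Q R"
  shows "iso P R"
proof -
  obtain \<phi> where \<phi>: "\<phi> \<in> endos" "bij_betw \<phi> P Q"
    by (rule iso_endos[OF assms(1,4) summand_subset[OF assms(2)]]) (rule that)
  obtain \<psi> where \<psi>: "\<psi> \<in> endos" "bij_betw \<psi> Q R"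
    by (rule iso_endos[OF assms(2,5,3)]) (rule that)
  show ?thesis
    using endos_iso[OF endos_compose[OF \<psi>(1) \<phi>(1)] summand_subset[OF assms(1)]]
      bij_betw_trans[OF \<phi>(2) \<psi>(2)] by (simp add: comp_def)
qed

lemma iso_refl: "P \<subseteq> V \<Longrightarrow> iso P P"
  using endos_iso[OF endos_ident, of P P] by (simp add: bij_betw_def)

lemma iso_sym:
  assumes P: "summand P" and Q: "summand Q" and iso: "iso P Q"
  shows "iso Q P"
proof -
  obtain \<phi> where \<phi>: "\<phi> \<in> endos" "bij_betw \<phi> P Q"
    by (rule iso_endos[OF P iso summand_subset[OF Q]]) (rule that)
  note lin = linear_simps[OF endosD(1)[OF \<phi>(1)]]
  have sP: "submodule P" and sQ: "submodule Q" by (rule summand_submodule[OF P] summand_submodule[OF Q])+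
  define f where "f = the_inv_into P \<phi>"
  have f: "f v \<in> P" "\<phi> (f v) = v" if "v \<in> Q" for v
    using that \<phi>(2) unfolding f_def bij_betw_def by (auto intro: the_inv_into_into f_the_inv_into_f)
  have fu: "f x = y" if "y \<in> P" "\<phi> y = x" for x y
    using that \<phi>(2) unfolding f_def bij_betw_def by (auto simp: the_inv_into_f_f)
  obtain w where w: "lin w" "\<And>v. v \<in> Q \<Longrightarrow> w v = f v"
  proof (rule endo.linear_extension[OF submoduleD(1)[OF sQ], of f])
    show "f (x + y) = f x + f y" if "x \<in> Q" "y \<in> Q" for x y
      using that f by (intro fu) (auto simp: lin subspace_add[OF submoduleD(1)[OF sP]])
    show "f (scale c x) = scale c (f x)" if "x \<in> Q" for c x
      using that f by (intro fu) (auto simp: lin subspace_scale[OF submoduleD(1)[OF sP]])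
  qed blast
  have "intertwines w Q"
    unfolding intertwines_def
  proof (intro ballI allI impI)
    fix v \<xi> assume v: "v \<in> Q" and \<xi>: "functional scale \<xi>"
    have y: "w v \<in> P" "\<phi> (w v) = v" using w(2)[OF v] f[OF v] by auto
    have \<xi>1: "functional scale (\<lambda>x. \<xi> (w x))" by (rule functional_compose[OF w(1) \<xi>])
    have \<xi>2: "functional scale (\<lambda>x. \<xi> (w (\<phi> x)))"
      by (rule functional_compose[OF endosD(1)[OF \<phi>(1)] \<xi>1])
    have wu: "w (\<phi> u) = u" if "u \<in> P" for u
      using w(2)[of "\<phi> u"] fu[OF that refl] \<phi>(2) that by (auto simp: bij_betw_def)
    \<comment> \<open>\<open>\<rho> g (w v)\<close> need not lie in P, so
      \<open>w \<circ> \<phi>\<close> cannot be cancelled pointwise. The difference is instead a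
      coefficient against a form that vanishes on P, hence lies in \<open>I\<close>.\<close>
    have "(\<lambda>g. \<xi> (\<rho> g (w v)) - \<xi> (w (\<phi> (\<rho> g (w v))))) \<in> I"
      by (rule submoduleD(4)[OF sP y(1) functional_diff[OF \<xi> \<xi>2]]) (simp add: wu)
    from I_diff[OF this endosD(3)[OF \<phi>(1) submoduleD(3)[OF sP y(1)] \<xi>1]]
    show "(\<lambda>g. \<xi> (\<rho> g (w v)) - \<xi> (w (\<rho> g v))) \<in> I"
      by (rule I_cong) (simp add: y(2))
  qed
  moreover have "bij_betw w Q P"
  proof -
    have "bij_betw f Q P" unfolding f_def by (rule bij_betw_the_inv_into[OF \<phi>(2)])
    then show ?thesis using w(2) by (simp cong: bij_betw_cong)
  qed
  ultimately show ?thesis using w(1) iso_alt by blast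
qed

lemma iso_dim:
  assumes P: "summand P" and Q: "summand Q" and "iso P Q"
  shows "dim Q = dim P"
proof -
  obtain \<phi> where \<phi>: "\<phi> \<in> endos" "bij_betw \<phi> P Q"
    by (rule iso_endos[OF P assms(3) summand_subset[OF Q]]) (rule that)
  interpret Vector_Spaces.linear scale scale \<phi> by (rule endosD(1)[OF \<phi>(1)])
  have sP: "submodule P" by (rule summand_submodule[OF P])
  obtain B where B: "finite B" "V = span B" by (rule V_span)
  obtain C where C: "finite C" "independent C" "P = span C" "card C = dim P"
    by (rule finite_basis[of P B]) (use submoduleD(1,2)[OF sP] B in simp, use submoduleD(1,2)[OF sP] B in simp, use B in simp, rule that)
  have inj: "inj_on \<phi> (span C)" using \<phi>(2) C(3) by (simp add: bij_betw_def)
  have "Q = span (\<phi> ` C)" using \<phi>(2) C(3) span_image by (simp add: bij_betw_def)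
  then have "dim Q = card (\<phi> ` C)"
    using dim_span_eq_card_independent[OF independent_injective_image[OF C(2) inj]] by (simp only:)
  also have "\<dots> = card C"
    using inj span_superset by (intro card_image) (auto intro: inj_on_subset)
  finally show ?thesis using C(4) by simp
qed

section \<open>Images under automorphisms and under group elements\<close>

lemma automorphism_direct_decomp:
  assumes u: "u \<in> endos" "\<And>v. v \<in> V \<Longrightarrow> u v = 0 \<Longrightarrow> v = 0"
    and D: "direct_decomp V A B" "A \<subseteq> V" "B \<subseteq> V"
  shows "direct_decomp V (u ` A) (u ` B)"
  unfolding direct_decomp_def
proof (intro conjI)
  note lin = linear_simps[OF endosD(1)[OF u(1)]]
  have VAB: "V = {x + y |x y. x \<in> A \<and> y \<in> B}" and AB: "A \<inter> B = {0}"
    using D(1) by (auto simp: direct_decomp_def)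
  have "V = u ` {x + y |x y. x \<in> A \<and> y \<in> B}" using endos_surj[OF u] VAB by simp
  also have "\<dots> = {x + y |x y. x \<in> u ` A \<and> y \<in> u ` B}"
  proof (intro equalityI subsetI)
    fix v assume "v \<in> u ` {x + y |x y. x \<in> A \<and> y \<in> B}"
    then obtain x y where "x \<in> A" "y \<in> B" "v = u x + u y" by (auto simp: lin)
    then show "v \<in> {x + y |x y. x \<in> u ` A \<and> y \<in> u ` B}" by blast
  next
    fix v assume "v \<in> {x + y |x y. x \<in> u ` A \<and> y \<in> u ` B}"
    then obtain x y where "x \<in> A" "y \<in> B" "v = u (x + y)" by (auto simp: lin)
    then show "v \<in> u ` {x + y |x y. x \<in> A \<and> y \<in> B}" by blast
  qed
  finally show "V = {x + y |x y. x \<in> u ` A \<and> y \<in> u ` B}" .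
  have "v = 0" if v: "v \<in> u ` A" "v \<in> u ` B" for v
  proof -
    obtain a b where ab: "a \<in> A" "b \<in> B" "v = u a" "v = u b" using v by blast
    then have "u (a - b) = 0" by (simp add: lin)
    then have "a - b = 0" using u(2)[of "a - b"] ab D subspace_diff[OF subspace_V] by blast
    then have "a = 0" using ab AB by auto
    then show ?thesis using ab lin by simp
  qed
  moreover have "0 \<in> A" "0 \<in> B" using AB by auto
  then have "0 \<in> u ` A" "0 \<in> u ` B" using lin(3) by (auto intro: rev_image_eqI)
  ultimately show "u ` A \<inter> u ` B = {0}" by blast
qed

lemma automorphism_summand:
  assumes u: "u \<in> endos" "\<And>v. v \<in> V \<Longrightarrow> u v = 0 \<Longrightarrow> v = 0" and M: "summand M"
  shows "summand (u ` M)" "iso M (u ` M)"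
proof -
  note lin = linear_simps[OF endosD(1)[OF u(1)]]
  obtain N where N: "submodule M" "submodule N" "direct_decomp V M N"
    using M unfolding scheme_summand_def by blast
  show "summand (u ` M)"
    using submodule_image[OF N(1) u(1)] submodule_image[OF N(2) u(1)]
      automorphism_direct_decomp[OF u N(3) submoduleD(2)[OF N(1)] submoduleD(2)[OF N(2)]]
    by (rule summandI)
  have "inj_on u M"
  proof (rule inj_onI)
    fix x y assume "x \<in> M" "y \<in> M" "u x = u y"
    then have "u (x - y) = 0" "x - y \<in> V"
      using submoduleD(3)[OF N(1)] subspace_diff[OF subspace_V] by (auto simp: lin)
    then show "x = y" using u(2) by force
  qed
  then show "iso M (u ` M)"
    using submoduleD(2)[OF N(1)] by (intro endos_iso[OF u(1)]) (auto simp: bij_betw_def)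
qed

text \<open>The translate is the image of the conjugate of an idempotent with image M, and
  conjugates of endomorphisms are endomorphisms.\<close>

lemma twist_summand:
  assumes "summand M" and g: "g \<in> G"
  shows "summand (\<rho> g ` M)"
proof -
  obtain e N where e: "submodule M" "e \<in> endos" "\<And>x. x \<in> M \<Longrightarrow> e x = x" "\<And>v. v \<in> V \<Longrightarrow> e v \<in> M"
    by (rule summandE[OF assms(1)]) (rule that)
  obtain f where f: "f \<in> endos" "\<And>v. v \<in> V \<Longrightarrow> f v = \<rho> g (e (\<rho> (gi g) v))"
    by (rule endos_conj[OF e(2) g]) (rule that)
  note MV = submoduleD(3)[OF e(1)]
  have "f ` V = \<rho> g ` M"
  proof (intro equalityI subsetI)
    fix x assume "x \<in> f ` V"
    then show "x \<in> \<rho> g ` M" using f(2) e(4) act_V inv_G[OF g] by auto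
  next
    fix x assume "x \<in> \<rho> g ` M"
    then obtain m where m: "m \<in> M" "x = \<rho> g m" by blast
    then have "f x = x" using f(2)[of x] act_V[OF g] MV act_inv(1)[OF g] e(3) by simp
    moreover have "x \<in> V" using m act_V[OF g] MV by blast
    ultimately show "x \<in> f ` V" by (metis imageI)
  qed
  moreover have "summand (f ` V)"
  proof (rule summand_idempotent[OF f(1)])
    fix v assume v: "v \<in> V"
    have *: "e (\<rho> (gi g) v) \<in> M" using e(4) act_V[OF inv_G[OF g]] v by blast
    then show "f (f v) = f v"
      using f(2)[OF v] f(2)[OF endosD(2)[OF f(1) v]] MV[OF *] act_inv(1)[OF g] e(3) by simp
  qed
  ultimately show ?thesis by simp
qed

lemma twist_iso:
  assumes P: "summand P" and Q: "Q \<subseteq> V" and "iso P Q" and g: "g \<in> G"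
  shows "iso (\<rho> g ` P) (\<rho> g ` Q)"
proof -
  obtain \<phi> where \<phi>: "\<phi> \<in> endos" "bij_betw \<phi> P Q" by (rule iso_endos[OF P assms(3) Q]) (rule that)
  obtain \<psi> where \<psi>: "\<psi> \<in> endos" "\<And>v. v \<in> V \<Longrightarrow> \<psi> v = \<rho> g (\<phi> (\<rho> (gi g) v))"
    by (rule endos_conj[OF \<phi>(1) g]) (rule that)
  have PV: "P \<subseteq> V" by (rule summand_subset[OF P])
  have gP: "\<rho> g ` P \<subseteq> V" using PV act_V[OF g] by blast
  have \<psi>P: "\<psi> (\<rho> g p) = \<rho> g (\<phi> p)" if "p \<in> P" for p
    using \<psi>(2)[of "\<rho> g p"] act_V[OF g] act_inv(1)[OF g] that PV by auto
  have "bij_betw \<psi> (\<rho> g ` P) (\<rho> g ` Q)"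
    unfolding bij_betw_def
  proof
    show "\<psi> ` \<rho> g ` P = \<rho> g ` Q"
      using \<psi>P \<phi>(2) by (force simp: bij_betw_def image_iff)
    show "inj_on \<psi> (\<rho> g ` P)"
    proof (rule inj_onI, clarify)
      fix p q assume pq: "p \<in> P" "q \<in> P" "\<psi> (\<rho> g p) = \<psi> (\<rho> g q)"
      have "\<phi> p \<in> V" "\<phi> q \<in> V" using pq \<phi>(2) Q by (auto simp: bij_betw_def)
      then have "\<phi> p = \<phi> q" using pq \<psi>P act_inv(1)[OF g] by metis
      then show "\<rho> g p = \<rho> g q" using pq \<phi>(2) by (auto simp: bij_betw_def inj_on_def)
    qed
  qed
  then show ?thesis by (rule endos_iso[OF \<psi>(1) gP])
qed

text \<open>
  Near the identity the idempotents of \<open>M\<close> and of its translate are close, hence conjugate;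
  a connected group is generated by such elements.
\<close>

lemma connected_iso:
  assumes conn: "connectedin (GL_zariski n) G" and M: "summand M" and "g \<in> G"
  shows "iso M (\<rho> g ` M)"
proof -
  obtain e N where e: "submodule M" "e \<in> endos" "\<And>x. x \<in> M \<Longrightarrow> e x = x" "\<And>v. v \<in> V \<Longrightarrow> e v \<in> M"
    by (rule summandE[OF M]) (rule that)
  note MV = submoduleD(3)[OF e(1)] and sM = submoduleD(1)[OF e(1)]
  obtain B where B: "finite B" "V = span B" by (rule V_span)
  obtain u x where u: "\<And>i. i < dim M \<Longrightarrow> u i \<in> M" "\<And>i. functional scale (x i)"
    "\<And>i j. i < dim M \<Longrightarrow> j < dim M \<Longrightarrow> x i (u j) = (if i = j then 1 else 0)"
    "\<And>v. v \<in> M \<Longrightarrow> v = (\<Sum>i<dim M. scale (x i v) (u i))"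
    by (rule dual_basis[of M B]) (use submoduleD(1,2)[OF e(1)] B in simp, use submoduleD(1,2)[OF e(1)] B in simp, use B in simp, rule that)
  let ?m = "dim M"
  \<comment> \<open>The matrix of \<open>e \<circ> \<rho> g\<close> on M in the basis
    \<open>u\<close>. Its determinant is a regular function of \<open>g\<close> and equals 1 at the
    identity, so its nonvanishing locus is a neighbourhood of the identity in G.\<close>
  let ?A = "\<lambda>g. mat ?m ?m (\<lambda>(i, j). x i (e (\<rho> g (u j))))"
  let ?D = "\<lambda>g. det (?A g)"
  let ?S = "{g \<in> G. iso M (\<rho> g ` M)}"
  have D: "?D \<in> coord_ring n G"
    by (rule coord_ring_det[where m = ?m])
       (auto intro!: act_coeff functional_compose[OF endosD(1)[OF e(2)] u(2)] MV u(1))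
  have "?A (1\<^sub>m n) = 1\<^sub>m ?m"
    using u(1,3) e(3) act_one MV by auto
  then have D1: "?D (1\<^sub>m n) \<noteq> 0" by simp
  \<comment> \<open>Where the determinant is nonzero, \<open>e \<circ> \<rho> g\<close> is bijective
    on M. Following it by the inverse of \<open>g\<close> gives the conjugate idempotent, which thus
    maps M isomorphically onto the translate by \<open>gi g\<close>; closure of \<open>?S\<close>
    under inverses then brings in \<open>g\<close> itself.\<close>
  have nbhd: "gi g \<in> ?S" if g: "g \<in> G" and Dg: "?D g \<noteq> 0" for g
  proof -
    obtain F where F: "lin F" "\<And>v. v \<in> V \<Longrightarrow> F v = e (\<rho> g v)"
      by (rule endo.linear_extension[OF subspace_V, of "\<lambda>v. e (\<rho> g v)"])
         (auto simp: act_add act_scale g linear_simps[OF endosD(1)[OF e(2)]])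
    have inj: "v = 0" if v: "v \<in> M" "F v = 0" for v
    proof -
      let ?c = "vec ?m (\<lambda>j. x j v)"
      have "?A g *\<^sub>v ?c = 0\<^sub>v ?m"
      proof (rule eq_vecI)
        fix i assume i: "i < dim_vec (0\<^sub>v ?m)"
        have "F v = (\<Sum>j<?m. scale (x j v) (F (u j)))"
          using arg_cong[OF u(4)[OF v(1)], of F] by (simp add: linear_simps[OF F(1)])
        then have "x i (F v) = (\<Sum>j<?m. x j v * x i (F (u j)))"
          by (simp add: linear_simps[OF u(2)])
        then show "(?A g *\<^sub>v ?c) $ i = 0\<^sub>v ?m $ i"
          using i v(2) F(2)[OF MV[OF u(1)]]
          by (simp add: scalar_prod_def atLeast0LessThan linear_simps[OF u(2)] mult.commute)
      qed auto
      moreover have "?c \<in> carrier_vec ?m" "?A g \<in> carrier_mat ?m ?m" by simp_all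
      ultimately have c0: "?c = 0\<^sub>v ?m"
        using Dg det_0_iff_vec_prod_zero[of "?A g" ?m] by metis
      have "x j v = 0" if "j < ?m" for j
        using arg_cong[OF c0, of "\<lambda>c. c $ j"] that by simp
      then show "v = 0" using u(4)[OF v(1)] by simp
    qed
    obtain C where C: "finite C" "M = span C"
    proof (rule finite_basis[of M B])
      show "subspace M" "M \<subseteq> span B" "finite B" using sM submoduleD(2)[OF e(1)] B by simp_all
    qed (rule that)
    have FM: "F v \<in> M" if "v \<in> M" for v using F(2)[OF MV[OF that]] e(4)[OF act_V[OF g MV[OF that]]] by simp
    have surj: "F ` M = M" by (rule injective_endo_surj[OF C(2,1) F(1) FM inj])
    have injF: "inj_on F M"
    proof (rule inj_onI)
      fix a b assume ab: "a \<in> M" "b \<in> M" "F a = F b"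
      have "a - b = 0"
        by (rule inj[OF subspace_diff[OF sM ab(1,2)]]) (simp add: linear_simps[OF F(1)] ab(3))
      then show "a = b" by simp
    qed
    note h = inv_G[OF g]
    obtain f where f: "f \<in> endos" "\<And>v. v \<in> V \<Longrightarrow> f v = \<rho> (gi g) (e (\<rho> g v))"
      by (rule endos_conj[OF e(2) h, unfolded inv_inv[OF g]]) (rule that)
    have fF: "f v = \<rho> (gi g) (F v)" if "v \<in> M" for v using f(2)[OF MV[OF that]] F(2)[OF MV[OF that]] by simp
    have "bij_betw f M (\<rho> (gi g) ` M)"
      unfolding bij_betw_def
    proof
      show "inj_on f M"
      proof (rule inj_onI)
        fix a b assume ab: "a \<in> M" "b \<in> M" "f a = f b"
        then have "F a = F b" using fF FM MV act_inv(2)[OF g] by metis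
        then show "a = b" using injF ab by (simp add: inj_on_def)
      qed
      have "f ` M = \<rho> (gi g) ` F ` M" unfolding image_image by (rule image_cong[OF refl fF])
      then show "f ` M = \<rho> (gi g) ` M" by (simp only: surj)
    qed
    then have "iso M (\<rho> (gi g) ` M)" by (rule endos_iso[OF f(1) submoduleD(2)[OF e(1)]])
    then show ?thesis using h by simp
  qed
  have twV: "\<rho> h ` M \<subseteq> V" if "h \<in> G" for h using act_V[OF that] MV by blast
  have inv: "gi g \<in> ?S" if "g \<in> ?S" for g
  proof -
    have g: "g \<in> G" "iso M (\<rho> g ` M)" using that by auto
    have "\<rho> (gi g) ` \<rho> g ` M = M" using act_inv(1)[OF g(1)] MV by (auto simp: image_image)
    then have "iso (\<rho> (gi g) ` M) M"
      using twist_iso[OF M twV[OF g(1)] g(2) inv_G[OF g(1)]] by simp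
    then show ?thesis
      using iso_sym[OF twist_summand[OF M inv_G[OF g(1)]] M] inv_G[OF g(1)] by simp
  qed
  have mult: "g * h \<in> ?S" if "g \<in> ?S" "h \<in> ?S" for g h
  proof -
    have g: "g \<in> G" "iso M (\<rho> g ` M)" and h: "h \<in> G" "iso M (\<rho> h ` M)" using that by auto
    have eq: "\<rho> g ` \<rho> h ` M = \<rho> (g * h) ` M"
      using act_mult[OF g(1) h(1)] MV by (auto simp: image_image)
    have "iso M (\<rho> (g * h) ` M)"
      using iso_trans[OF M twist_summand[OF M g(1)] _ g(2)]
        twist_iso[OF M twV[OF h(1)] h(2) g(1)] twV[OF mult_G[OF g(1) h(1)]] eq by simp
    then show ?thesis using mult_G g h by simp
  qed
  have one: "1\<^sub>m n \<in> ?S"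
  proof -
    have "\<rho> (1\<^sub>m n) ` M = M" using act_one MV by auto
    then show ?thesis using iso_refl[OF submoduleD(2)[OF e(1)]] one_G by simp
  qed
  have nbhd': "g \<in> ?S" if "g \<in> G" "?D g \<noteq> 0" for g
    using inv[OF nbhd[OF that]] unfolding inv_inv[OF that(1)] .
  have "?S = G"
    by (rule connected_generated[OF conn D D1 _ one mult inv nbhd']) (rule Collect_restrict)
  then show ?thesis using assms(3) by blast
qed

section \<open>Tight decompositions\<close>

lemma direct_decomp_disjoint:
  assumes "direct_decomp A B C" "x \<in> B" "x \<in> C"
  shows "x = 0"
proof -
  have "B \<inter> C = {0}" using assms(1) unfolding direct_decomp_def by (rule conjunct2)
  then show ?thesis using assms(2,3) by blast
qed

text \<open>One endomorphism carries a pair in Hom(M,N) x Hom(N,M) as its two blocks. Its values on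
  M and on N parametrize the two factors of the product variety.\<close>

definition offdiag :: "'v set \<Rightarrow> 'v set \<Rightarrow> ('v \<Rightarrow> 'v) set" where
  "offdiag M N = {T \<in> endos. T ` M \<subseteq> N \<and> T ` N \<subseteq> M}"

definition graph :: "('v \<Rightarrow> 'v) \<Rightarrow> 'v set \<Rightarrow> 'v set" where
  "graph T M = (\<lambda>m. m + T m) ` M"

lemma offdiag_commute: "offdiag N M = offdiag M N"
  unfolding offdiag_def by auto

lemma offdiagD:
  assumes "T \<in> offdiag M N"
  shows "T \<in> endos" "\<And>x. x \<in> M \<Longrightarrow> T x \<in> N" "\<And>y. y \<in> N \<Longrightarrow> T y \<in> M"
  using assms unfolding offdiag_def by auto

lemma offdiagI:
  "T \<in> endos \<Longrightarrow> (\<And>x. x \<in> M \<Longrightarrow> T x \<in> N) \<Longrightarrow> (\<And>y. y \<in> N \<Longrightarrow> T y \<in> M) \<Longrightarrow> T \<in> offdiag M N"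
  unfolding offdiag_def by auto

end

locale decomposition = scheme_module scale n G V \<rho> I
  for scale :: "'k::field \<Rightarrow> 'v::ab_group_add \<Rightarrow> 'v" and n G V \<rho> I +
  fixes M N :: "'v set"
  assumes submodule_M: "submodule M" and submodule_N: "submodule N"
    and decomp: "direct_decomp V M N"
begin

lemma subspaces: "subspace M" "subspace N"
  by (rule submoduleD(1)[OF submodule_M], rule submoduleD(1)[OF submodule_N])

lemma in_V: "x \<in> M \<Longrightarrow> x \<in> V" "y \<in> N \<Longrightarrow> y \<in> V"
  by (erule submoduleD(3)[OF submodule_M], erule submoduleD(3)[OF submodule_N])

lemmas disjoint = direct_decomp_disjoint[OF decomp]

text \<open>Interpreting the locale with M and N exchanged gives every result about M for N as
  well.\<close>

lemma swapped: "decomposition scale n G V \<rho> I N M"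
  by (intro decomposition.intro scheme_module_axioms decomposition_axioms.intro
      submodule_M submodule_N direct_decomp_commute[OF decomp])

text \<open>One projection onto M along N is fixed once and for all. Only its values on V are
  determined by M and N.\<close>

definition proj :: "'v \<Rightarrow> 'v" where
  "proj = (SOME e. e \<in> endos \<and> (\<forall>x\<in>M. e x = x) \<and> (\<forall>y\<in>N. e y = 0) \<and>
     (\<forall>v\<in>V. e v \<in> M \<and> v - e v \<in> N))"

lemma proj: "proj \<in> endos" "x \<in> M \<Longrightarrow> proj x = x" "y \<in> N \<Longrightarrow> proj y = 0"
    "v \<in> V \<Longrightarrow> proj v \<in> M" "v \<in> V \<Longrightarrow> v - proj v \<in> N"
proof -
  have "\<exists>e. e \<in> endos \<and> (\<forall>x\<in>M. e x = x) \<and> (\<forall>y\<in>N. e y = 0) \<and> (\<forall>v\<in>V. e v \<in> M \<and> v - e v \<in> N)"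
    by (rule endos_projection[OF submodule_M submodule_N decomp]) (intro exI conjI ballI, assumption+)
  from someI_ex[OF this, folded proj_def]
  show "proj \<in> endos" "x \<in> M \<Longrightarrow> proj x = x" "y \<in> N \<Longrightarrow> proj y = 0"
    "v \<in> V \<Longrightarrow> proj v \<in> M" "v \<in> V \<Longrightarrow> v - proj v \<in> N" by auto
qed

lemmas proj_simps = linear_simps[OF endosD(1)[OF proj(1)]]

lemma summand_M: "summand M"
  using submodule_M submodule_N decomp by (rule summandI)

text \<open>The two blocks can be prescribed independently, so a graph over M and a graph over N
  always come from a single off-diagonal endomorphism.\<close>

lemma offdiag_block:
  assumes S: "S \<in> offdiag M N" and T: "T \<in> offdiag M N"
  obtains R where "R \<in> offdiag M N" "\<And>x. x \<in> M \<Longrightarrow> R x = T x" "\<And>y. y \<in> N \<Longrightarrow> R y = S y"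
proof (rule that[of "\<lambda>v. T (proj v) + S (v - proj v)"])
  note linS = linear_simps[OF endosD(1)[OF offdiagD(1)[OF S]]]
    and linT = linear_simps[OF endosD(1)[OF offdiagD(1)[OF T]]]
  show M: "T (proj x) + S (x - proj x) = T x" if "x \<in> M" for x
    using that by (simp add: proj linS)
  show N: "T (proj y) + S (y - proj y) = S y" if "y \<in> N" for y
    using that by (simp add: proj linT)
  show "(\<lambda>v. T (proj v) + S (v - proj v)) \<in> offdiag M N"
    by (rule offdiagI)
       (auto intro!: endos_add endos_compose[OF offdiagD(1)[OF S]] endos_compose[OF offdiagD(1)[OF T]]
          endos_diff endos_ident proj(1) simp: M N offdiagD[OF S] offdiagD[OF T])
qed

end

text \<open>The last assumption says that \<open>1 + S T\<close> is invertible on \<open>M\<close>.\<close>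

locale tight_decomposition = decomposition scale n G V \<rho> I M N
  for scale :: "'k::field \<Rightarrow> 'v::ab_group_add \<Rightarrow> 'v" and n G V \<rho> I M N +
  assumes tight: "S \<in> offdiag M N \<Longrightarrow> T \<in> offdiag M N \<Longrightarrow> m \<in> M \<Longrightarrow> m + S (T m) = 0 \<Longrightarrow> m = 0"
begin

text \<open>T carries the kernel of \<open>1 + S T\<close> on N into the kernel of
  \<open>1 + T S\<close> on M. The latter is zero by tightness, so \<open>T y = 0\<close> and then
  \<open>y = 0\<close>.\<close>

lemma tight_swapped: "tight_decomposition scale n G V \<rho> I N M"
proof (intro tight_decomposition.intro swapped tight_decomposition_axioms.intro)
  fix S T y assume S: "S \<in> offdiag N M" and T: "T \<in> offdiag N M" and y: "y \<in> N" "y + S (T y) = 0"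
  note S' = S[unfolded offdiag_commute[of N]] and T' = T[unfolded offdiag_commute[of N]]
  note linT = linear_simps[OF endosD(1)[OF offdiagD(1)[OF T]]]
    and linS = linear_simps[OF endosD(1)[OF offdiagD(1)[OF S]]]
  have "T y + T (S (T y)) = 0" using arg_cong[OF y(2), of T] by (simp add: linT)
  then have "T y = 0" using tight[OF T' S' offdiagD(2)[OF T y(1)]] by blast
  then show "y = 0" using y(2) by (simp add: linS)
qed

text \<open>The automorphism is \<open>1 + R\<close> with R composed of the two blocks. If it kills
  \<open>x + y\<close>, comparing components gives \<open>x = - R y\<close> and
  \<open>y = - R x\<close>, and tightness forces both to vanish.\<close>

lemma graph_pair:
  assumes S: "S \<in> offdiag M N" and T: "T \<in> offdiag M N"
  obtains u where "u \<in> endos" "\<And>v. v \<in> V \<Longrightarrow> u v = 0 \<Longrightarrow> v = 0"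
    "u ` M = graph T M" "u ` N = graph S N"
proof -
  obtain R where R: "R \<in> offdiag M N" "\<And>x. x \<in> M \<Longrightarrow> R x = T x" "\<And>y. y \<in> N \<Longrightarrow> R y = S y"
    by (rule offdiag_block[OF S T]) (rule that)
  note linR = linear_simps[OF endosD(1)[OF offdiagD(1)[OF R(1)]]]
  \<comment> \<open>The sign brings \<open>x - R (R x) = 0\<close> into the form
    \<open>x + R (R' x) = 0\<close> that tightness speaks about.\<close>
  define R' where "R' v = - R v" for v
  have R': "R' \<in> offdiag M N"
    using endos_scale[OF offdiagD(1)[OF R(1)], of "-1"] offdiagD(2,3)[OF R(1)]
    by (intro offdiagI) (auto simp: R'_def[abs_def] subspace_neg subspaces)
  let ?u = "\<lambda>v. v + R v"
  have "?u \<in> endos" by (intro endos_add endos_ident offdiagD(1)[OF R(1)])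
  moreover have "v = 0" if v: "v \<in> V" "?u v = 0" for v
  proof -
    obtain x y where xy: "x \<in> M" "y \<in> N" "v = x + y" by (rule direct_decompD[OF decomp v(1)]) (rule that)
    have "(x + R y) + (y + R x) = 0" using v(2) xy(3) by (simp add: linR ac_simps)
    then have eq: "x + R y = - (y + R x)" by (simp only: eq_neg_iff_add_eq_0)
    have "x + R y \<in> M" by (rule subspace_add[OF subspaces(1) xy(1) offdiagD(3)[OF R(1) xy(2)]])
    moreover have "x + R y \<in> N" unfolding eq
      by (rule subspace_neg[OF subspaces(2) subspace_add[OF subspaces(2) xy(2) offdiagD(2)[OF R(1) xy(1)]]])
    ultimately have x0: "x + R y = 0" by (rule disjoint)
    then have "y + R x = 0" using eq by (metis neg_equal_0_iff_equal)
    note 0 = x0 this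
    then have y: "y = R' x" by (simp add: R'_def eq_neg_iff_add_eq_0)
    then have "x + R (R' x) = 0" using 0 by simp
    then have "x = 0" using tight[OF R(1) R' xy(1)] by blast
    then show "v = 0" using xy(3) y by (simp add: R'_def linR)
  qed
  moreover have "?u ` M = graph T M" "?u ` N = graph S N"
    unfolding graph_def using R(2,3) by auto
  ultimately show ?thesis by (rule that)
qed

lemma graphs_complementary:
  assumes S: "S \<in> offdiag M N" and T: "T \<in> offdiag M N"
  shows "direct_decomp V (graph T M) (graph S N)"
proof -
  obtain u where u: "u \<in> endos" "\<And>v. v \<in> V \<Longrightarrow> u v = 0 \<Longrightarrow> v = 0"
    "u ` M = graph T M" "u ` N = graph S N" by (rule graph_pair[OF S T]) (rule that)
  show ?thesis
    using automorphism_direct_decomp[OF u(1,2) decomp submoduleD(2)[OF submodule_M]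
        submoduleD(2)[OF submodule_N]] u(3,4) by simp
qed

lemma graph_summand:
  assumes T: "T \<in> offdiag M N"
  shows "summand (graph T M)" "iso M (graph T M)"
proof -
  obtain u where u: "u \<in> endos" "\<And>v. v \<in> V \<Longrightarrow> u v = 0 \<Longrightarrow> v = 0"
    "u ` M = graph T M" by (rule graph_pair[OF T T]) (rule that)
  show "summand (graph T M)" "iso M (graph T M)"
    using automorphism_summand[OF u(1,2) summand_M] u(3) by auto
qed

text \<open>
  If \<open>i = (x, a)\<close> embeds \<open>M\<close> as a summand with retraction \<open>(z, b)\<close>, then \<open>z x = 1 - b a\<close> is
  invertible, hence so is \<open>x\<close>, and the image of \<open>i\<close> is the graph of \<open>a x\<^sup>-\<^sup>1\<close>.
\<close>

lemma summand_is_graph: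
  assumes M': "summand M'" and iso: "iso M M'"
  obtains T where "T \<in> offdiag M N" "M' = graph T M"
proof -
  obtain \<phi> where \<phi>: "\<phi> \<in> endos" "bij_betw \<phi> M M'"
    by (rule iso_endos[OF summand_M iso summand_subset[OF M']]) (rule that)
  note lin\<phi> = linear_simps[OF endosD(1)[OF \<phi>(1)]]
  obtain \<psi> where \<psi>: "\<psi> \<in> endos" "bij_betw \<psi> M' M" "\<And>v. v \<in> V \<Longrightarrow> \<psi> v \<in> M"
    using iso_endos[OF M' iso_sym[OF summand_M M' iso]] in_V by blast
  let ?\<theta> = "\<lambda>v. \<psi> (\<phi> v)"
  have \<theta>: "bij_betw ?\<theta> M M" using bij_betw_trans[OF \<phi>(2) \<psi>(2)] by (simp add: comp_def)
  \<comment> \<open>The automorphism of M is extended by the identity on N, so that inversion can be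
    carried out on V.\<close>
  let ?u0 = "\<lambda>v. ?\<theta> (proj v) + (v - proj v)"
  have u0: "?u0 \<in> endos"
    by (intro endos_add endos_compose[OF \<psi>(1)] endos_compose[OF \<phi>(1)] endos_diff endos_ident proj(1))
  have \<theta>M: "?\<theta> x \<in> M" if "x \<in> M" for x using \<theta> that by (auto simp: bij_betw_def)
  have u0_inj: "v = 0" if v: "v \<in> V" "?u0 v = 0" for v
  proof -
    have "?\<theta> (proj v) = - (v - proj v)" using v(2) by (simp only: eq_neg_iff_add_eq_0)
    moreover have "- (v - proj v) \<in> N" by (rule subspace_neg[OF subspaces(2) proj(5)[OF v(1)]])
    ultimately have 1: "?\<theta> (proj v) = 0" "v - proj v = 0"
      using disjoint[OF \<theta>M[OF proj(4)[OF v(1)]]] by (metis neg_equal_0_iff_equal)+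
    have "?\<theta> 0 = 0" by (simp add: lin\<phi> linear_simps[OF endosD(1)[OF \<psi>(1)]])
    then have "proj v = 0"
      using 1(1) \<theta> proj(4)[OF v(1)] subspace_0[OF subspaces(1)]
      unfolding bij_betw_def inj_on_def by metis
    then show "v = 0" using 1(2) by simp
  qed
  have u0_surj: "?u0 ` V = V" by (rule endos_surj[OF u0 u0_inj])
  obtain w0 where w0: "w0 \<in> endos" "\<And>v. v \<in> V \<Longrightarrow> w0 (?u0 v) = v"
    by (rule endos_inverse[OF u0 u0_surj], erule (1) u0_inj, rule that)
  have w0\<theta>: "w0 (?\<theta> x) = x" if "x \<in> M" for x
    using w0(2)[OF in_V(1)[OF that]] proj(2)[OF that] by simp
  have w0M: "w0 m \<in> M" if m: "m \<in> M" for m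
  proof -
    have "m \<in> ?\<theta> ` M" using bij_betw_imp_surj_on[OF \<theta>] m by simp
    then obtain x where "x \<in> M" "m = ?\<theta> x" by (rule imageE)
    then show ?thesis using w0\<theta> by simp
  qed
  \<comment> \<open>A retraction of \<open>\<phi>\<close> on M, since \<open>w0\<close> inverts the
    composite of \<open>\<phi>\<close> and \<open>\<psi>\<close> there.\<close>
  define r where "r v = w0 (\<psi> v)" for v
  have r: "r \<in> endos" unfolding r_def[abs_def] by (rule endos_compose[OF w0(1) \<psi>(1)])
  have rM: "r v \<in> M" if "v \<in> V" for v using w0M[OF \<psi>(3)[OF that]] by (simp add: r_def)
  have r\<phi>: "r (\<phi> x) = x" if "x \<in> M" for x using w0\<theta>[OF that] by (simp add: r_def)
  note linr = linear_simps[OF endosD(1)[OF r]]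
  \<comment> \<open>In the block notation of the comment on this lemma, \<open>T\<close> is
    \<open>a\<close> and \<open>S\<close> is \<open>- b\<close>, so that \<open>1 + S T\<close> is
    \<open>1 - b a\<close>.\<close>
  define S where "S v = - r (v - proj v)" for v
  define T where "T v = \<phi> (proj v) - proj (\<phi> (proj v))" for v
  have "(\<lambda>v. scale (-1) (r (v - proj v))) \<in> endos"
    by (intro endos_scale endos_compose[OF r] endos_diff endos_ident proj)
  then have S_endo: "S \<in> endos" by (simp add: S_def[abs_def])
  have T_endo: "T \<in> endos"
    unfolding T_def[abs_def]
    by (intro endos_diff endos_compose[OF \<phi>(1)] endos_compose[OF proj(1)] proj(1))
  have "r (v - proj v) \<in> M" if "v \<in> V" for v
    by (rule rM[OF in_V(2)[OF proj(5)[OF that]]])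
  then have SM: "S v \<in> M" if "v \<in> V" for v
    using that subspace_neg[OF subspaces(1)] by (simp add: S_def)
  have S: "S \<in> offdiag M N"
    by (rule offdiagI[OF S_endo])
       (use SM in_V proj(2) linr subspace_0[OF subspaces(2)] in \<open>auto simp: S_def\<close>)
  have TN: "T v \<in> N" if "v \<in> V" for v
    using proj(5)[OF endosD(2)[OF \<phi>(1) endosD(2)[OF proj(1) that]]] by (simp add: T_def)
  have T: "T \<in> offdiag M N"
    by (rule offdiagI[OF T_endo])
       (use TN in_V proj(3) subspace_0[OF subspaces(1)] in \<open>auto simp: T_def lin\<phi> proj_simps\<close>)
  have inj: "x = 0" if x: "x \<in> M" "proj (\<phi> x) = 0" for x
  proof (rule tight[OF S T x(1)])
    have "T x = \<phi> x" using proj(2)[OF x(1)] x(2) by (simp add: T_def)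
    then have "S (T x) = - x" using x r\<phi> by (simp add: S_def)
    then show "x + S (T x) = 0" by simp
  qed
  let ?u = "\<lambda>v. proj (\<phi> (proj v)) + (v - proj v)"
  have u: "?u \<in> endos"
    by (intro endos_add endos_compose[OF \<phi>(1)] endos_compose[OF proj(1)] endos_diff endos_ident proj(1))
  have u_inj: "v = 0" if v: "v \<in> V" "?u v = 0" for v
  proof -
    have "proj (\<phi> (proj v)) = - (v - proj v)" using v(2) by (simp only: eq_neg_iff_add_eq_0)
    moreover have "- (v - proj v) \<in> N" by (rule subspace_neg[OF subspaces(2) proj(5)[OF v(1)]])
    moreover have "proj (\<phi> (proj v)) \<in> M"
      by (rule proj(4)[OF endosD(2)[OF \<phi>(1) in_V(1)[OF proj(4)[OF v(1)]]]])
    ultimately have 1: "proj (\<phi> (proj v)) = 0" "v - proj v = 0"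
      using disjoint[of "proj (\<phi> (proj v))"] by (metis neg_equal_0_iff_equal)+
    then have "proj v = 0" using inj[OF proj(4)[OF v(1)]] by blast
    then show "v = 0" using 1(2) by simp
  qed
  have u_surj: "?u ` V = V" by (rule endos_surj[OF u u_inj])
  obtain w where w: "w \<in> endos" "\<And>v. v \<in> V \<Longrightarrow> w (?u v) = v" "\<And>v. v \<in> V \<Longrightarrow> ?u (w v) = v"
    by (rule endos_inverse[OF u u_surj], erule (1) u_inj, rule that)
  have wx: "w (proj (\<phi> x)) = x" if "x \<in> M" for x
    using w(2)[OF in_V(1)[OF that]] proj(2)[OF that] by simp
  have wM: "w m \<in> M \<and> proj (\<phi> (w m)) = m" if m: "m \<in> M" for m
  proof -
    let ?v = "w m"
    have v: "?v \<in> V" "?u ?v = m" using w(3) endosD(2)[OF w(1)] in_V(1)[OF m] by auto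
    have a: "proj (\<phi> (proj ?v)) \<in> M"
      by (rule proj(4)[OF endosD(2)[OF \<phi>(1) in_V(1)[OF proj(4)[OF v(1)]]]])
    have "?v - proj ?v = m - proj (\<phi> (proj ?v))" using v(2) by (simp add: algebra_simps)
    also have "\<dots> \<in> M" using subspace_diff[OF subspaces(1) m a] .
    finally have "?v - proj ?v = 0" using proj(5)[OF v(1)] by (rule disjoint)
    then have 2: "proj ?v = ?v" by simp
    then show ?thesis using v(2) proj(4)[OF v(1)] by simp
  qed
  \<comment> \<open>This is \<open>a\<close> composed with the inverse of \<open>x\<close>, because
    \<open>w\<close> inverts \<open>proj \<circ> \<phi>\<close> on M.\<close>
  define R where "R v = T (w (proj v))" for v
  have R_endo: "R \<in> endos" unfolding R_def[abs_def] by (intro endos_compose[OF T_endo] endos_compose[OF w(1)] proj)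
  have "R y = 0" if "y \<in> N" for y
    using proj(3)[OF that] by (simp add: R_def linear_simps[OF endosD(1)[OF w(1)]] linear_simps[OF endosD(1)[OF T_endo]])
  moreover have "R x \<in> N" if "x \<in> M" for x
    using TN in_V(1) wM proj(2)[OF that] that by (simp add: R_def)
  ultimately have R: "R \<in> offdiag M N"
    using subspace_0[OF subspaces(1)] by (intro offdiagI[OF R_endo]) auto
  have "M' = \<phi> ` M" using \<phi>(2) by (simp add: bij_betw_def)
  also have "\<dots> = graph R M"
  proof (intro equalityI subsetI)
    fix v assume "v \<in> \<phi> ` M"
    then obtain x where x: "x \<in> M" "v = \<phi> x" by blast
    let ?m = "proj (\<phi> x)"
    have m: "?m \<in> M" by (rule proj(4)[OF endosD(2)[OF \<phi>(1) in_V(1)[OF x(1)]]])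
    have "v = ?m + R ?m"
      using x proj(2)[OF m] wx[OF x(1)] proj(2)[OF x(1)] by (simp add: R_def T_def)
    then show "v \<in> graph R M" unfolding graph_def using m by blast
  next
    fix v assume "v \<in> graph R M"
    then obtain m where m: "m \<in> M" "v = m + R m" unfolding graph_def by blast
    have "v = \<phi> (w m)"
      using m proj(2)[OF m(1)] wM[OF m(1)] proj(2)[of "w m"] by (simp add: R_def T_def)
    then show "v \<in> \<phi> ` M" using wM[OF m(1)] by blast
  qed
  finally show ?thesis using that R by blast
qed

end

context decomposition
begin

text \<open>With \<open>1 + T\<close> acting through the M component and \<open>1 + S\<close>
  through the N component, the product of these automorphisms sends \<open>m\<close> to
  \<open>m + T m + S (T m)\<close>. If \<open>m + S (T m) = 0\<close> this is \<open>T m\<close>,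
  which lies in N and in a summand isomorphic to M. Complementarity of that summand with N gives
  \<open>m = 0\<close>.\<close>

lemma tightI:
  assumes compl: "\<And>M'. summand M' \<Longrightarrow> iso M M' \<Longrightarrow> direct_decomp V M' N"
  shows "tight_decomposition scale n G V \<rho> I M N"
proof (intro tight_decomposition.intro decomposition_axioms tight_decomposition_axioms.intro)
  fix S T m assume S: "S \<in> offdiag M N" and T: "T \<in> offdiag M N" and m: "m \<in> M" "m + S (T m) = 0"
  note linT = linear_simps[OF endosD(1)[OF offdiagD(1)[OF T]]]
    and linS = linear_simps[OF endosD(1)[OF offdiagD(1)[OF S]]]
  let ?a = "\<lambda>v. v + T (proj v)" and ?b = "\<lambda>v. v + S (v - proj v)"
  have a: "?a \<in> endos" by (intro endos_add endos_ident endos_compose[OF offdiagD(1)[OF T]] proj)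
  have b: "?b \<in> endos"
    by (intro endos_add endos_diff endos_ident endos_compose[OF offdiagD(1)[OF S]] proj)
  have a_inj: "v = 0" if v: "v \<in> V" "?a v = 0" for v
  proof -
    have "proj (?a v) = proj v"
      using proj(3)[OF offdiagD(2)[OF T proj(4)[OF v(1)]]] by (simp add: proj_simps)
    then have "proj v = 0" using v(2) by (simp add: proj_simps)
    then show "v = 0" using v(2) by (simp add: linT)
  qed
  have b_inj: "v = 0" if v: "v \<in> V" "?b v = 0" for v
  proof -
    have "proj (S (v - proj v)) = S (v - proj v)"
      by (rule proj(2)[OF offdiagD(3)[OF S proj(5)[OF v(1)]]])
    then have "?b v - proj (?b v) = v - proj v" by (simp add: proj_simps)
    then have "v - proj v = 0" using v(2) by (simp add: proj_simps)
    then show "v = 0" using v(2) by (simp add: linS)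
  qed
  let ?\<Phi> = "\<lambda>v. ?b (?a v)"
  have \<Phi>: "?\<Phi> \<in> endos" by (rule endos_compose[OF b a])
  have \<Phi>_inj: "v = 0" if "v \<in> V" "?\<Phi> v = 0" for v
    using b_inj[OF endosD(2)[OF a that(1)] that(2)] a_inj[OF that(1)] by blast
  have D: "direct_decomp V (?\<Phi> ` M) N"
    using automorphism_summand[OF \<Phi> \<Phi>_inj summand_M] by (intro compl)
  have "?\<Phi> m = m + T m + S (T m)"
    using proj(2)[OF m(1)] proj(3)[OF offdiagD(2)[OF T m(1)]] by (simp add: proj_simps)
  also have "\<dots> = T m" using m(2) by (metis add.commute add.left_commute add_0_right)
  finally have "?\<Phi> m \<in> N" using offdiagD(2)[OF T m(1)] by simp
  then have "?\<Phi> m = 0" by (rule direct_decomp_disjoint[OF D imageI[OF m(1)]])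
  then show "m = 0" using \<Phi>_inj[OF in_V(1)[OF m(1)]] by blast
qed

end

section \<open>Charts of the varieties of summands\<close>

context ambient_space
begin

lemma function_sheaf_frame_fspace: "function_sheaf (frame_fspace scale V m)"
  unfolding frame_fspace_def by (rule function_sheaf_affine_fspace)

lemma topspace_frame_fspace [simp]: "topspace (top_of (frame_fspace scale V m)) = frames scale V m"
  unfolding frame_fspace_def by (simp add: topspace_zariski)

lemma function_sheaf_grassmannian: "function_sheaf (grassmannian scale V m)"
  unfolding grassmannian_def by (rule function_sheaf_quotient_fspace[OF function_sheaf_frame_fspace])

lemma topspace_grassmannian [simp]:
  "topspace (top_of (grassmannian scale V m)) = (\<lambda>ws. span (set ws)) ` frames scale V m"
  unfolding grassmannian_def by simp

end

context scheme_module
begin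

abbreviation variety where "variety \<equiv> summand_variety I scale V \<rho>"

lemma function_sheaf_variety: "function_sheaf (variety M)"
  unfolding summand_variety_def by (rule function_sheaf_sub_fspace[OF function_sheaf_grassmannian])

lemma summands_iff: "L \<in> summands I scale V \<rho> M \<longleftrightarrow> summand L \<and> iso M L"
  unfolding summands_def by simp

end

context decomposition
begin

text \<open>For L in \<open>chart\<close> the projection maps L bijectively onto M, and this is the
  inverse. On the graph of T it sends \<open>m\<close> to \<open>m + T m\<close>.\<close>

definition lift :: "'v set \<Rightarrow> 'v \<Rightarrow> 'v" where
  "lift L v = (THE u. u \<in> L \<and> proj u = v)"

abbreviation frame_coordinates :: "('v list \<Rightarrow> 'k) set" where
  "frame_coordinates \<equiv> {\<lambda>ws. \<xi> (ws ! i) | \<xi> i. functional scale \<xi> \<and> i < dim M}"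

text \<open>On V the kernel of \<open>proj\<close> is N, so this is the standard chart of the
  Grassmannian formed by the complements of N.\<close>

definition chart :: "'v set set" where
  "chart = {L \<in> (\<lambda>ws. span (set ws)) ` frames scale V (dim M). \<forall>u\<in>L. proj u = 0 \<longrightarrow> u = 0}"

lemma lift_eq:
  assumes "L \<in> chart" "u \<in> L" "proj u = v"
  shows "lift L v = u"
  unfolding lift_def
proof (rule the_equality)
  fix w assume w: "w \<in> L \<and> proj w = v"
  have "subspace L" using assms(1) unfolding chart_def by auto
  then have "w - u \<in> L" using subspace_diff w assms(2) by blast
  moreover have "proj (w - u) = 0" using w assms(3) by (simp add: proj_simps)
  ultimately have "w - u = 0" using assms(1) unfolding chart_def by blast
  then show "w = u" by simp
qed (use assms in blast)

lemma dual_basis_M: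
  obtains u x where "\<And>i. i < dim M \<Longrightarrow> u i \<in> M" "\<And>i. functional scale (x i)"
    "\<And>i j. i < dim M \<Longrightarrow> j < dim M \<Longrightarrow> x i (u j) = (if i = j then 1 else 0)"
    "\<And>v. v \<in> M \<Longrightarrow> v = (\<Sum>i<dim M. scale (x i v) (u i))"
proof -
  obtain B where B: "finite B" "V = span B" by (rule V_span)
  have MB: "M \<subseteq> span B" using submoduleD(2)[OF submodule_M] B(2) by simp
  show ?thesis by (rule dual_basis[OF subspaces(1) MB B(1)]) (rule that)
qed

text \<open>On a frame \<open>ws\<close> of \<open>L\<close> the lift of \<open>v\<close> solves a linear system, and is given by Cramer's rule.\<close>

lemma chart_functions:
  assumes v: "v \<in> M" and \<xi>: "functional scale \<xi>"
  obtains A D where "A \<in> fun_algebra frame_coordinates" "D \<in> fun_algebra frame_coordinates"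
    "\<And>ws. ws \<in> frames scale V (dim M) \<Longrightarrow> span (set ws) \<in> chart \<longleftrightarrow> D ws \<noteq> 0"
    "\<And>ws. ws \<in> frames scale V (dim M) \<Longrightarrow> D ws \<noteq> 0 \<Longrightarrow> \<xi> (lift (span (set ws)) v) = A ws / D ws"
proof -
  obtain u x where u: "\<And>i. i < dim M \<Longrightarrow> u i \<in> M" "\<And>i. functional scale (x i)"
    "\<And>i j. i < dim M \<Longrightarrow> j < dim M \<Longrightarrow> x i (u j) = (if i = j then 1 else 0)"
    "\<And>v. v \<in> M \<Longrightarrow> v = (\<Sum>i<dim M. scale (x i v) (u i))"
    by (rule dual_basis_M) (rule that)
  let ?m = "dim M"
  have px: "functional scale (\<lambda>w. x i (proj w))" for i
    by (rule functional_compose[OF endosD(1)[OF proj(1)] u(2)])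
  \<comment> \<open>Column \<open>j\<close> consists of the coordinates of the projection of the
    \<open>j\<close>-th frame vector. The determinant is nonzero exactly if \<open>proj\<close> is
    injective on the span, and replacing column \<open>l\<close> by the coordinates of
    \<open>v\<close> gives the \<open>l\<close>-th numerator.\<close>
  define X where "X ws = mat ?m ?m (\<lambda>(i, j). x i (proj (ws ! j)))" for ws
  define b where "b = vec ?m (\<lambda>i. x i v)"
  define R where "R l ws = mat ?m ?m (\<lambda>(i, j). if j = l then b $ i else x i (proj (ws ! j)))" for l ws
  define D where "D ws = det (X ws)" for ws
  define A where "A ws = (\<Sum>l<?m. det (R l ws) * \<xi> (ws ! l))" for ws
  have X: "X ws \<in> carrier_mat ?m ?m" for ws unfolding X_def by simp
  have coord: "(\<lambda>ws. \<eta> (ws ! i)) \<in> fun_algebra frame_coordinates" if "functional scale \<eta>" "i < ?m" for \<eta> i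
    using that by (intro fun_algebra.gen) blast
  have D: "D \<in> fun_algebra frame_coordinates"
    unfolding D_def[abs_def]
  proof (rule fun_algebra_det[OF X])
    show "(\<lambda>ws. X ws $$ (i, j)) \<in> fun_algebra frame_coordinates" if "i < ?m" "j < ?m" for i j
      using coord[OF px that(2), of i] that by (simp add: X_def)
  qed
  have "(\<lambda>ws. det (R l ws)) \<in> fun_algebra frame_coordinates" for l
  proof (rule fun_algebra_det)
    show "R l ws \<in> carrier_mat ?m ?m" for ws unfolding R_def by simp
    show "(\<lambda>ws. R l ws $$ (i, j)) \<in> fun_algebra frame_coordinates" if "i < ?m" "j < ?m" for i j
      using coord[OF px that(2), of i] that fun_algebra.const[of "b $ i" frame_coordinates]
      by (cases "j = l") (simp_all add: R_def)
  qed
  then have A: "A \<in> fun_algebra frame_coordinates"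
    unfolding A_def[abs_def] by (intro fun_algebra_sum fun_algebra.mult coord \<xi>) auto
  have Xc: "(X ws *\<^sub>v c) $ i = x i (proj (\<Sum>l<?m. scale (c $ l) (ws ! l)))"
    if "i < ?m" "c \<in> carrier_vec ?m" for ws c i
    using that
    by (simp add: X_def scalar_prod_def atLeast0LessThan linear_simps[OF px] mult.commute)
  have zero: "w = 0" if w: "w \<in> M" "\<And>i. i < ?m \<Longrightarrow> x i w = 0" for w
    using u(4)[OF w(1)] w(2) by simp
  have combV: "(\<Sum>l<?m. scale (c l) (ws ! l)) \<in> V" "(\<Sum>l<?m. scale (c l) (ws ! l)) \<in> span (set ws)"
    if "ws \<in> frames scale V ?m" for c ws
  proof -
    have ws: "ws ! l \<in> set ws" "ws ! l \<in> V" if "l < ?m" for l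
      using \<open>ws \<in> frames scale V ?m\<close> that by (auto simp: frames_def)
    show "(\<Sum>l<?m. scale (c l) (ws ! l)) \<in> V"
      by (intro subspace_sum[OF subspace_V] subspace_scale[OF subspace_V] ws) simp
    show "(\<Sum>l<?m. scale (c l) (ws ! l)) \<in> span (set ws)"
      by (intro span_sum span_scale span_base ws) simp
  qed
  have chart: "span (set ws) \<in> chart \<longleftrightarrow> D ws \<noteq> 0" if ws: "ws \<in> frames scale V ?m" for ws
  proof
    assume ch: "span (set ws) \<in> chart"
    show "D ws \<noteq> 0"
    proof
      assume "D ws = 0"
      then obtain c where c: "c \<in> carrier_vec ?m" "c \<noteq> 0\<^sub>v ?m" "X ws *\<^sub>v c = 0\<^sub>v ?m"
        using det_0_iff_vec_prod_zero[OF X] unfolding D_def by blast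
      let ?w = "\<Sum>l<?m. scale (c $ l) (ws ! l)"
      have "x i (proj ?w) = 0" if "i < ?m" for i
        using Xc[OF that c(1), of ws] c(3) that by simp
      then have "proj ?w = 0" by (rule zero[OF proj(4)[OF combV(1)[OF ws]]])
      then have "?w = 0" using ch combV(2)[OF ws] unfolding chart_def by blast
      then have "c $ l = 0" if "l < ?m" for l
        by (rule frame_independent[OF ws _ that])
      then have "c = 0\<^sub>v ?m" using c(1) by (intro eq_vecI) auto
      then show False using c(2) by blast
    qed
  next
    assume D0: "D ws \<noteq> 0"
    have "w = 0" if w: "w \<in> span (set ws)" "proj w = 0" for w
    proof -
      obtain c where c: "w = (\<Sum>l<?m. scale (c l) (ws ! l))" by (rule span_frame[OF ws w(1)]) (rule that)
      let ?c = "vec ?m c"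
      have w': "w = (\<Sum>l<?m. scale (?c $ l) (ws ! l))" unfolding c by (rule sum.cong) auto
      have "X ws *\<^sub>v ?c = 0\<^sub>v ?m"
      proof (rule eq_vecI)
        fix i assume "i < dim_vec (0\<^sub>v ?m)"
        then have i: "i < ?m" by simp
        have "(X ws *\<^sub>v ?c) $ i = x i (proj w)" unfolding w' by (rule Xc[OF i]) simp
        then show "(X ws *\<^sub>v ?c) $ i = 0\<^sub>v ?m $ i"
          using i w(2) linear_simps(3)[OF u(2)] by simp
      qed (use X in auto)
      moreover have "?c \<in> carrier_vec ?m" by simp
      ultimately have c0: "?c = 0\<^sub>v ?m"
        using D0 det_0_iff_vec_prod_zero[OF X[of ws]] unfolding D_def by metis
      have "c l = 0" if "l < ?m" for l
        using arg_cong[OF c0, of "\<lambda>c. c $ l"] that by simp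
      then show "w = 0" unfolding c by simp
    qed
    then show "span (set ws) \<in> chart" unfolding chart_def using ws by blast
  qed
  have lift: "\<xi> (lift (span (set ws)) v) = A ws / D ws" if ws: "ws \<in> frames scale V ?m" and D0: "D ws \<noteq> 0" for ws
  proof -
    obtain Y where Y: "Y \<in> carrier_mat ?m ?m" "X ws * Y = 1\<^sub>m ?m"
      using det_non_zero_imp_unit[OF X] D0 by (auto simp: D_def Units_def ring_mat_def)
    define c where "c = Y *\<^sub>v b"
    have b: "b \<in> carrier_vec ?m" unfolding b_def by simp
    have c: "c \<in> carrier_vec ?m" unfolding c_def using Y(1) b by simp
    have "X ws *\<^sub>v c = X ws * Y *\<^sub>v b"
      unfolding c_def by (rule assoc_mult_mat_vec[OF X Y(1) b, symmetric])
    then have Xcb: "X ws *\<^sub>v c = b" using Y(2) b by simp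
    have cl: "c $ l = det (R l ws) / D ws" if "l < ?m" for l
    proof -
      have "replace_col (X ws) b l = R l ws"
        unfolding replace_col_def R_def using X by (auto simp: X_def)
      then show ?thesis
        using cramer_lemma_mat[OF X c that, of ws] D0 unfolding Xcb D_def by (simp add: field_simps)
    qed
    let ?w = "\<Sum>l<?m. scale (c $ l) (ws ! l)"
    have "x i (proj ?w - v) = 0" if "i < ?m" for i
      using Xc[OF that c, of ws] that unfolding Xcb by (simp add: linear_simps[OF u(2)] b_def)
    then have "proj ?w - v = 0"
      by (intro zero subspace_diff[OF subspaces(1) proj(4)[OF combV(1)[OF ws]] v])
    then have "lift (span (set ws)) v = ?w"
      using chart[OF ws] D0 by (intro lift_eq combV(2)[OF ws]) auto
    then show ?thesis
      by (simp add: linear_simps[OF \<xi>] A_def sum_divide_distrib cl)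
  qed
  show ?thesis using that[OF A D chart lift] .
qed

lemma openin_chart: "openin (top_of (grassmannian scale V (dim M))) chart"
proof -
  \<comment> \<open>Any vector and any form supply a determinant that cuts out the chart; zero is
    taken for both.\<close>
  obtain \<xi> :: "'v \<Rightarrow> 'k" where \<xi>: "functional scale \<xi>" using functionalI[of "\<lambda>_. 0"] by auto
  obtain A D where "D \<in> fun_algebra frame_coordinates"
    "\<And>ws. ws \<in> frames scale V (dim M) \<Longrightarrow> span (set ws) \<in> chart \<longleftrightarrow> D ws \<noteq> 0"
    by (rule chart_functions[OF subspace_0[OF subspaces(1)] \<xi>]) (rule that)
  then have "{ws \<in> frames scale V (dim M). span (set ws) \<in> chart} =
      {ws \<in> frames scale V (dim M). D ws \<noteq> 0}" "D \<in> fun_algebra frame_coordinates" by auto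
  then have "openin (top_of (frame_fspace scale V (dim M)))
      {ws \<in> frames scale V (dim M). span (set ws) \<in> chart}"
    by (simp add: frame_fspace_def openin_zariski_basic)
  moreover have "chart \<subseteq> (\<lambda>ws. span (set ws)) ` frames scale V (dim M)"
    unfolding chart_def by (rule Collect_restrict)
  ultimately show ?thesis
    unfolding grassmannian_def top_of_quotient_fspace topspace_frame_fspace by blast
qed

lemma lift_reg_chart:
  assumes v: "v \<in> M" and \<xi>: "functional scale \<xi>"
  shows "(\<lambda>L. \<xi> (lift L v)) \<in> reg_of (grassmannian scale V (dim M)) chart"
proof -
  obtain A D where AD: "A \<in> fun_algebra frame_coordinates" "D \<in> fun_algebra frame_coordinates"
    "\<And>ws. ws \<in> frames scale V (dim M) \<Longrightarrow> span (set ws) \<in> chart \<longleftrightarrow> D ws \<noteq> 0"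
    "\<And>ws. ws \<in> frames scale V (dim M) \<Longrightarrow> D ws \<noteq> 0 \<Longrightarrow> \<xi> (lift (span (set ws)) v) = A ws / D ws"
    by (rule chart_functions[OF v \<xi>]) (rule that)
  show ?thesis
    unfolding grassmannian_def reg_quotient_fspace topspace_frame_fspace
    unfolding frame_fspace_def
  proof (rule reg_affine_fspaceI)
    fix ws assume "ws \<in> {ws \<in> frames scale V (dim M). span (set ws) \<in> chart}"
    then have "D ws \<noteq> 0" using AD(3) by blast
    then show "\<exists>a\<in>fun_algebra frame_coordinates. \<exists>b\<in>fun_algebra frame_coordinates. b ws \<noteq> 0 \<and>
        (\<forall>y\<in>{ws \<in> frames scale V (dim M). span (set ws) \<in> chart}. b y \<noteq> 0 \<longrightarrow>
          ((\<lambda>L. \<xi> (lift L v)) \<circ> (\<lambda>ws. span (set ws))) y = a y / b y)"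
      using AD(4) by (intro bexI[OF _ AD(1)] bexI[OF _ AD(2)]) simp
  qed
qed

lemma graph_frame:
  assumes T: "lin T" and u: "M = span (u ` {..<dim M})"
  shows "span (set (map (\<lambda>i. u i + T (u i)) [0..<dim M])) = graph T M"
proof -
  have "lin (\<lambda>m. m + T m)" by (rule lin_add[OF lin_ident T])
  then interpret Vector_Spaces.linear scale scale "\<lambda>m. m + T m" .
  have "set (map (\<lambda>i. u i + T (u i)) [0..<dim M]) = (\<lambda>m. m + T m) ` u ` {..<dim M}"
    by (auto simp: image_image atLeast0LessThan)
  then have "span (set (map (\<lambda>i. u i + T (u i)) [0..<dim M])) = (\<lambda>m. m + T m) ` span (u ` {..<dim M})"
    by (simp only: span_image)
  then show ?thesis unfolding graph_def u[symmetric] .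
qed

text \<open>One basis of M serves for all T at once, which gives a lift of the map from T to its
  graph from the Grassmannian to the space of frames.\<close>

lemma frame_of_graph:
  obtains u where "M = span (u ` {..<dim M})" "\<And>i. i < dim M \<Longrightarrow> u i \<in> M"
    "\<And>T. T \<in> offdiag M N \<Longrightarrow> map (\<lambda>i. u i + T (u i)) [0..<dim M] \<in> frames scale V (dim M)"
proof -
  obtain u x where u: "\<And>i. i < dim M \<Longrightarrow> u i \<in> M" "\<And>i. functional scale (x i)"
    "\<And>i j. i < dim M \<Longrightarrow> j < dim M \<Longrightarrow> x i (u j) = (if i = j then 1 else 0)"
    "\<And>v. v \<in> M \<Longrightarrow> v = (\<Sum>i<dim M. scale (x i v) (u i))"
    by (rule dual_basis_M) (rule that)
  have "v \<in> span (u ` {..<dim M})" if "v \<in> M" for v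
    by (subst u(4)[OF that]) (intro span_sum span_scale span_base, simp)
  moreover have "span (u ` {..<dim M}) \<subseteq> M"
    using u(1) by (intro span_minimal subspaces) auto
  ultimately have span: "M = span (u ` {..<dim M})" by blast
  have frame: "map (\<lambda>i. u i + T (u i)) [0..<dim M] \<in> frames scale V (dim M)"
    (is "?ws \<in> _") if T: "T \<in> offdiag M N" for T
  proof (rule frameI)
    show "length ?ws = dim M" by simp
    show "set ?ws \<subseteq> V"
      using u(1) in_V offdiagD(2)[OF T] subspace_add[OF subspace_V] by auto
    fix c l assume 0: "(\<Sum>l<dim M. scale (c l) (?ws ! l)) = 0" and l: "l < dim M"
    \<comment> \<open>The projection of \<open>u i + T (u i)\<close> is \<open>u i\<close>, so the
      form \<open>x l\<close> composed with \<open>proj\<close> reads off the coefficient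
      \<open>c l\<close> of a relation.\<close>
    have "x l (proj (\<Sum>i<dim M. scale (c i) (?ws ! i))) = (\<Sum>i<dim M. c i * x l (proj (?ws ! i)))"
      by (simp add: proj_simps linear_simps[OF u(2)])
    also have "\<dots> = (\<Sum>i<dim M. if i = l then c i else 0)"
    proof (rule sum.cong[OF refl])
      fix i assume "i \<in> {..<dim M}"
      then show "c i * x l (proj (?ws ! i)) = (if i = l then c i else 0)"
        using proj(2)[OF u(1)] proj(3)[OF offdiagD(2)[OF T u(1)]] u(3)[OF l] by (simp add: proj_simps)
    qed
    also have "\<dots> = c l" using l by simp
    finally show "c l = 0" unfolding 0 by (simp add: proj_simps linear_simps[OF u(2)])
  qed
  show ?thesis by (rule that[OF span u(1) frame])
qed

lemma graph_in_chart:
  assumes T: "T \<in> offdiag M N"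
  shows "graph T M \<in> chart"
proof -
  obtain u where u: "M = span (u ` {..<dim M})" "\<And>i. i < dim M \<Longrightarrow> u i \<in> M"
    "\<And>T. T \<in> offdiag M N \<Longrightarrow> map (\<lambda>i. u i + T (u i)) [0..<dim M] \<in> frames scale V (dim M)"
    by (rule frame_of_graph) (rule that)
  have "graph T M \<in> (\<lambda>ws. span (set ws)) ` frames scale V (dim M)"
    using imageI[OF u(3)[OF T], of "\<lambda>ws. span (set ws)"]
    unfolding graph_frame[OF endosD(1)[OF offdiagD(1)[OF T]] u(1)] .
  moreover have "w = 0" if w: "w \<in> graph T M" "proj w = 0" for w
  proof -
    obtain m where m: "m \<in> M" "w = m + T m" using w(1) unfolding graph_def by blast
    then have "proj w = m" using proj(2)[OF m(1)] proj(3)[OF offdiagD(2)[OF T m(1)]] by (simp add: proj_simps)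
    then have "m = 0" using w(2) by simp
    then show ?thesis using m(2) by (simp add: linear_simps[OF endosD(1)[OF offdiagD(1)[OF T]]])
  qed
  ultimately show ?thesis unfolding chart_def by blast
qed

lemma lift_graph:
  assumes T: "T \<in> offdiag M N" and m: "m \<in> M"
  shows "lift (graph T M) m = m + T m"
proof (rule lift_eq[OF graph_in_chart[OF T]])
  show "m + T m \<in> graph T M" unfolding graph_def using m by blast
  show "proj (m + T m) = m"
    using proj(2)[OF m] proj(3)[OF offdiagD(2)[OF T m]] by (simp add: proj_simps)
qed

end

section \<open>The variety of summands inside its chart\<close>

context tight_decomposition
begin

lemma summands_graphs: "summands I scale V \<rho> M = (\<lambda>T. graph T M) ` offdiag M N"
proof (intro equalityI subsetI)
  fix L assume "L \<in> summands I scale V \<rho> M"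
  then have "summand L" "iso M L" by (simp_all add: summands_iff)
  then obtain T where "T \<in> offdiag M N" "L = graph T M" by (rule summand_is_graph)
  then show "L \<in> (\<lambda>T. graph T M) ` offdiag M N" by blast
next
  fix L assume "L \<in> (\<lambda>T. graph T M) ` offdiag M N"
  then show "L \<in> summands I scale V \<rho> M" using graph_summand by (auto simp: summands_iff)
qed

lemma summands_chart: "summands I scale V \<rho> M \<subseteq> chart"
  unfolding summands_graphs using graph_in_chart by blast

lemma topspace_variety: "topspace (top_of (variety M)) = summands I scale V \<rho> M"
proof -
  have "summands I scale V \<rho> M \<subseteq> topspace (top_of (grassmannian scale V (dim M)))"
    using summands_chart openin_subset[OF openin_chart] by (rule subset_trans)
  then show ?thesis unfolding summand_variety_def top_of_sub_fspace topspace_subtopology by blast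
qed

lemma lift_reg:
  assumes "v \<in> M" "functional scale \<xi>"
  shows "(\<lambda>L. \<xi> (lift L v)) \<in> reg_of (variety M) (topspace (top_of (variety M)))"
proof -
  have "L \<in> chart" if "L \<in> topspace (top_of (variety M))" for L
    using that summands_chart unfolding topspace_variety by blast
  then show ?thesis
    unfolding summand_variety_def
    by (intro reg_sub_fspaceI exI[of _ chart] exI[of _ "\<lambda>L. \<xi> (lift L v)"])
       (simp add: summand_variety_def openin_chart lift_reg_chart[OF assms])
qed

text \<open>A family of graphs is lifted to the frames given by a fixed basis of M, whose
  coordinates are regular by hypothesis. Linearity is asked for every parameter because the lift
  followed by the span is compared with the family as an equality of functions.\<close>

lemma graph_morphism:
  assumes Z: "function_sheaf Z"
    and lin: "\<And>z. lin (\<theta> z)"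
    and off: "\<And>z. z \<in> topspace (top_of Z) \<Longrightarrow> \<theta> z \<in> offdiag M N"
    and reg: "\<And>v \<xi>. v \<in> M \<Longrightarrow> functional scale \<xi> \<Longrightarrow> (\<lambda>z. \<xi> (\<theta> z v)) \<in> reg_of Z (topspace (top_of Z))"
  shows "fspace_morphism Z (variety M) (\<lambda>z. graph (\<theta> z) M)"
proof -
  interpret Z: function_sheaf Z by fact
  obtain u where u: "M = span (u ` {..<dim M})" "\<And>i. i < dim M \<Longrightarrow> u i \<in> M"
    "\<And>T. T \<in> offdiag M N \<Longrightarrow> map (\<lambda>i. u i + T (u i)) [0..<dim M] \<in> frames scale V (dim M)"
    by (rule frame_of_graph) (rule that)
  define s where "s z = map (\<lambda>i. u i + \<theta> z (u i)) [0..<dim M]" for z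
  have s: "fspace_morphism Z (frame_fspace scale V (dim M)) s"
    unfolding frame_fspace_def
  proof (rule fspace_morphism_affine[OF Z])
    show "s z \<in> frames scale V (dim M)" if "z \<in> topspace (top_of Z)" for z
      unfolding s_def by (rule u(3)[OF off[OF that]])
    fix f assume "f \<in> frame_coordinates"
    then obtain \<xi> i where f: "f = (\<lambda>ws. \<xi> (ws ! i))" "functional scale \<xi>" "i < dim M" by blast
    have "(\<lambda>z. \<xi> (u i) + \<xi> (\<theta> z (u i))) \<in> reg_of Z (topspace (top_of Z))"
      by (intro Z.add_reg Z.const_reg openin_topspace reg u(2) f)
    then show "(\<lambda>z. f (s z)) \<in> reg_of Z (topspace (top_of Z))"
      using f(3) by (simp add: f(1) s_def linear_simps[OF f(2)])
  qed
  have eq: "(\<lambda>ws. span (set ws)) \<circ> s = (\<lambda>z. graph (\<theta> z) M)"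
    by (rule ext) (simp only: comp_apply s_def graph_frame[OF lin u(1)])
  have "fspace_morphism Z (grassmannian scale V (dim M)) (\<lambda>z. graph (\<theta> z) M)"
    unfolding eq[symmetric] grassmannian_def by (rule fspace_morphism_quotient[OF s])
  then show ?thesis
    unfolding summand_variety_def
  proof (rule fspace_morphism_sub[OF Z])
    show "graph (\<theta> z) M \<in> summands I scale V \<rho> M" if "z \<in> topspace (top_of Z)" for z
      unfolding summands_graphs using off[OF that] by blast
  qed
qed

end

section \<open>Linearization\<close>

text \<open>Names the scalar multiplication written out in \<open>linearizable\<close>, so that it
  can be folded and used to interpret locales.\<close>

definition coord_module :: "'k::field \<Rightarrow> (nat \<Rightarrow> 'k) \<Rightarrow> nat \<Rightarrow> 'k" where
  "coord_module = (\<lambda>c v i. c * v i)"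

lemma vector_space_coord_module: "Vector_Spaces.vector_space coord_module"
  by unfold_locales (auto simp: coord_module_def algebra_simps fun_eq_iff)

text \<open>Matrices are encoded as sequences because \<open>linearizable\<close> asks for modules of sequences.\<close>

definition matrix_seqs :: "nat \<Rightarrow> (nat \<Rightarrow> 'k::field) set" where
  "matrix_seqs d = {t. \<forall>i j. \<not> (i < d \<and> j < d) \<longrightarrow> t (prod_encode (i, j)) = 0}"

definition unit_seq :: "nat \<Rightarrow> nat \<Rightarrow> 'k::field" where
  "unit_seq k = (\<lambda>l. if l = k then 1 else 0)"

lemma sum_apply:
  fixes f :: "'a \<Rightarrow> 'b \<Rightarrow> 'c::comm_monoid_add"
  shows "sum f A k = (\<Sum>a\<in>A. f a k)"
  by (induction A rule: infinite_finite_induct) auto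

lemma matrix_seq_expand:
  fixes t :: "nat \<Rightarrow> 'k::field"
  assumes "t \<in> matrix_seqs d"
  shows "t = (\<Sum>i<d. \<Sum>j<d. coord_module (t (prod_encode (i, j))) (unit_seq (prod_encode (i, j))))"
proof
  fix k
  obtain a b where k: "k = prod_encode (a, b)" by (metis prod_decode_inverse surj_pair)
  have "(\<Sum>i<d. \<Sum>j<d. coord_module (t (prod_encode (i, j))) (unit_seq (prod_encode (i, j)))) k =
      (\<Sum>i<d. \<Sum>j<d. if j = b \<and> i = a then t k else 0)"
    unfolding sum_apply
    by (intro sum.cong refl) (auto simp: coord_module_def unit_seq_def k prod_encode_eq)
  also have "\<dots> = (\<Sum>i<d. if i = a \<and> b < d then t k else 0)"
    by (intro sum.cong refl) (auto simp: sum.delta)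
  also have "\<dots> = (if a < d \<and> b < d then t k else 0)"
    by (auto simp: sum.delta)
  also have "\<dots> = t k"
    using assms unfolding matrix_seqs_def k by auto
  finally show "t k = (\<Sum>i<d. \<Sum>j<d. coord_module (t (prod_encode (i, j))) (unit_seq (prod_encode (i, j)))) k"
    by simp
qed

lemma functional_matrix_seq:
  fixes t :: "nat \<Rightarrow> 'k::field"
  assumes "t \<in> matrix_seqs d" and \<xi>: "functional coord_module \<xi>"
  shows "\<xi> t = (\<Sum>i<d. \<Sum>j<d. t (prod_encode (i, j)) * \<xi> (unit_seq (prod_encode (i, j))))"
  by (subst matrix_seq_expand[OF assms(1)]) (simp only: linear_simps[OF \<xi>])

lemma fin_dim_matrix_seqs:
  fixes W :: "(nat \<Rightarrow> 'k::field) set"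
  assumes W: "Modules.module.subspace coord_module W" "W \<subseteq> matrix_seqs d"
  shows "fin_dim_subspace coord_module W"
proof -
  interpret sq: ambient_space "coord_module :: 'k \<Rightarrow> _"
    using vector_space_coord_module by (simp add: ambient_space_def)
  let ?E = "(\<lambda>(i, j). unit_seq (prod_encode (i, j)) :: nat \<Rightarrow> 'k) ` ({..<d} \<times> {..<d})"
  have "t \<in> sq.span ?E" if "t \<in> W" for t
  proof -
    have "t \<in> matrix_seqs d" using that W(2) by blast
    then show ?thesis
      by (subst matrix_seq_expand, assumption) (intro sq.span_sum sq.span_scale sq.span_base, auto)
  qed
  then have "W \<subseteq> sq.span ?E" by blast
  then obtain C where "finite C" "W = sq.span C" using sq.finite_basis[OF W(1), of ?E] by auto
  then show ?thesis
    unfolding fin_dim_subspace_def using vector_space_coord_module by blast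
qed

context tight_decomposition
begin

lemma topspace_product:
  "topspace (top_of (prod_fspace (variety M) (variety N))) =
    summands I scale V \<rho> M \<times> summands I scale V \<rho> N"
proof -
  interpret sw: tight_decomposition scale n G V \<rho> I N M by (rule tight_swapped)
  interpret function_sheaf_pair "variety M" "variety N"
    by (intro function_sheaf_pair.intro function_sheaf_variety)
  show ?thesis unfolding topspace_prod_fspace topspace_variety sw.topspace_variety ..
qed

end

section \<open>The linear model of the product variety\<close>

locale coordinates = tight_decomposition scale n G V \<rho> I M N
  for scale :: "'k::field \<Rightarrow> 'v::ab_group_add \<Rightarrow> 'v" and n G V \<rho> I M N +
  fixes u :: "nat \<Rightarrow> 'v" and z :: "nat \<Rightarrow> 'v \<Rightarrow> 'k" and d :: nat
  assumes basis_V: "i < d \<Longrightarrow> u i \<in> V"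
    and coordinate: "functional scale (z i)"
    and dual: "i < d \<Longrightarrow> j < d \<Longrightarrow> z i (u j) = (if i = j then 1 else 0)"
    and expand: "v \<in> V \<Longrightarrow> v = (\<Sum>i<d. scale (z i v) (u i))"
begin

text \<open>Row \<open>i\<close> holds the coordinates of \<open>T (u i)\<close>, the transpose of
  the usual matrix convention.\<close>

definition code :: "('v \<Rightarrow> 'v) \<Rightarrow> nat \<Rightarrow> 'k" where
  "code T k = (case prod_decode k of (i, j) \<Rightarrow> if i < d \<and> j < d then z j (T (u i)) else 0)"

text \<open>For every sequence \<open>t\<close> this is linear on the ambient space with values in
  V. It returns a coded endomorphism up to its values off V, and it is linear in
  \<open>t\<close>.\<close>

definition decode :: "(nat \<Rightarrow> 'k) \<Rightarrow> 'v \<Rightarrow> 'v" where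
  "decode t v = (\<Sum>i<d. \<Sum>j<d. scale (t (prod_encode (i, j)) * z i v) (u j))"

text \<open>The sequence model of Hom(M,N) x Hom(N,M), on which H is going to act linearly.\<close>

definition W :: "(nat \<Rightarrow> 'k) set" where
  "W = code ` offdiag M N"

lemma code_pair: "code T (prod_encode (i, j)) = (if i < d \<and> j < d then z j (T (u i)) else 0)"
  unfolding code_def by simp

lemma code_cong: "(\<And>v. v \<in> V \<Longrightarrow> S v = T v) \<Longrightarrow> code S = code T"
  unfolding code_def fun_eq_iff using basis_V by (auto split: prod.split)

lemma code_matrix_seqs: "code T \<in> matrix_seqs d"
  unfolding matrix_seqs_def by (auto simp: code_pair)

lemma lin_decode: "lin (decode t)"
  unfolding decode_def[abs_def]
  by (rule linI)
     (simp_all add: linear_simps[OF coordinate] distrib_left scale_left_distrib sum.distrib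
       scale_sum_right mult.left_commute)

lemma decode_V: "decode t v \<in> V"
  unfolding decode_def by (intro subspace_sum[OF subspace_V] subspace_scale[OF subspace_V] basis_V) simp

lemma decode_add: "decode (s + t) v = decode s v + decode t v"
  unfolding decode_def by (simp add: distrib_right scale_left_distrib sum.distrib)

lemma decode_scale: "decode (coord_module c t) v = scale c (decode t v)"
  unfolding decode_def coord_module_def by (simp add: scale_sum_right mult.assoc)

lemma decode_code:
  assumes "lin T" "\<And>v. v \<in> V \<Longrightarrow> T v \<in> V" "v \<in> V"
  shows "decode (code T) v = T v"
proof -
  have "T v = (\<Sum>i<d. scale (z i v) (T (u i)))"
    by (subst expand[OF assms(3)]) (simp only: linear_simps[OF assms(1)])
  also have "\<dots> = (\<Sum>i<d. scale (z i v) (\<Sum>j<d. scale (z j (T (u i))) (u j)))"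
    by (rule sum.cong[OF refl]) (use expand[OF assms(2)[OF basis_V]] in simp)
  also have "\<dots> = decode (code T) v"
    unfolding decode_def scale_sum_right by (intro sum.cong refl) (simp add: code_pair mult.commute)
  finally show ?thesis by simp
qed

lemma decode_code_offdiag: "T \<in> offdiag M N \<Longrightarrow> v \<in> V \<Longrightarrow> decode (code T) v = T v"
  by (rule decode_code) (use endosD[OF offdiagD(1)] in auto)

lemma code_decode_W: "t \<in> W \<Longrightarrow> code (decode t) = t"
  unfolding W_def using code_cong[OF decode_code_offdiag] by auto

lemma W_matrix_seqs: "W \<subseteq> matrix_seqs d"
  unfolding W_def using code_matrix_seqs by blast

lemma offdiag_cong:
  assumes "T \<in> offdiag M N" "lin S" "\<And>v. v \<in> V \<Longrightarrow> S v = T v"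
  shows "S \<in> offdiag M N"
proof (rule offdiagI)
  show "S \<in> endos" by (rule endos_cong[OF offdiagD(1)[OF assms(1)] assms(2,3)])
  show "S x \<in> N" if "x \<in> M" for x
    using offdiagD(2)[OF assms(1) that] assms(3)[OF in_V(1)[OF that]] by simp
  show "S y \<in> M" if "y \<in> N" for y
    using offdiagD(3)[OF assms(1) that] assms(3)[OF in_V(2)[OF that]] by simp
qed

lemma decode_offdiag: "t \<in> W \<Longrightarrow> decode t \<in> offdiag M N"
  unfolding W_def using offdiag_cong[OF _ lin_decode decode_code_offdiag] by blast

lemma graph_cong: "L \<subseteq> V \<Longrightarrow> (\<And>v. v \<in> V \<Longrightarrow> S v = T v) \<Longrightarrow> graph S L = graph T L"
  unfolding graph_def by (rule image_cong) auto

lemma offdiag_zero: "(\<lambda>_. 0) \<in> offdiag M N"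
proof (rule offdiagI)
  have "(\<lambda>v. scale 0 v) \<in> endos" by (rule endos_scale[OF endos_ident])
  then show "(\<lambda>_. 0) \<in> endos" by simp
qed (use subspace_0 subspaces in auto)

lemma offdiag_add:
  assumes "S \<in> offdiag M N" "T \<in> offdiag M N"
  shows "(\<lambda>v. S v + T v) \<in> offdiag M N"
  using offdiagD[OF assms(1)] offdiagD[OF assms(2)] subspace_add[OF subspaces(1)] subspace_add[OF subspaces(2)]
  by (intro offdiagI endos_add) auto

lemma offdiag_scale:
  assumes "T \<in> offdiag M N"
  shows "(\<lambda>v. scale c (T v)) \<in> offdiag M N"
  using offdiagD[OF assms] subspace_scale[OF subspaces(1)] subspace_scale[OF subspaces(2)]
  by (intro offdiagI endos_scale) auto

lemma W_subspace: "Modules.module.subspace coord_module W"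
proof -
  interpret sq: ambient_space "coord_module :: 'k \<Rightarrow> _"
    using vector_space_coord_module by (simp add: ambient_space_def)
  have 0: "code (\<lambda>_. 0) = 0"
    unfolding code_def by (auto simp: fun_eq_iff linear_simps[OF coordinate] split: prod.split)
  have add: "code (\<lambda>v. S v + T v) = code S + code T" for S T
    unfolding code_def by (auto simp: fun_eq_iff linear_simps[OF coordinate] split: prod.split)
  have scale: "code (\<lambda>v. scale c (T v)) = coord_module c (code T)" for c T
    unfolding code_def coord_module_def by (auto simp: fun_eq_iff linear_simps[OF coordinate] split: prod.split)
  show ?thesis
  proof (rule sq.subspaceI)
    show "0 \<in> W" using imageI[OF offdiag_zero, of code] by (simp only: 0 W_def)
    fix s t assume "s \<in> W" "t \<in> W"
    then obtain S T where ST: "S \<in> offdiag M N" "T \<in> offdiag M N" "s = code S" "t = code T"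
      unfolding W_def by blast
    show "s + t \<in> W" using imageI[OF offdiag_add[OF ST(1,2)], of code] by (simp only: add W_def ST(3,4))
  next
    fix c t assume "t \<in> W"
    then obtain T where T: "T \<in> offdiag M N" "t = code T" unfolding W_def by blast
    show "coord_module c t \<in> W"
      using imageI[OF offdiag_scale[OF T(1), of c], of code] by (simp only: scale W_def T(2))
  qed
qed

lemma function_sheaf_W: "function_sheaf (vector_fspace coord_module W)"
  unfolding vector_fspace_def by (rule function_sheaf_affine_fspace)

lemma topspace_W: "topspace (top_of (vector_fspace coord_module W)) = W"
  unfolding vector_fspace_def by (simp add: topspace_zariski)

lemma decode_reg:
  assumes \<xi>: "functional scale \<xi>"
  shows "(\<lambda>t. \<xi> (decode t v)) \<in> reg_of (vector_fspace coord_module W) (topspace (top_of (vector_fspace coord_module W)))"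
proof -
  have k: "functional coord_module (\<lambda>t. t k :: 'k)" for k
    unfolding Vector_Spaces.linear_iff using vector_space_coord_module vector_space_field
    by (auto simp: coord_module_def)
  have "(\<lambda>t. \<Sum>i<d. \<Sum>j<d. t (prod_encode (i, j)) * (z i v * \<xi> (u j)))
      \<in> fun_algebra {\<xi>. functional coord_module \<xi>}"
    by (intro fun_algebra_sum fun_algebra.mult[OF fun_algebra.gen fun_algebra.const]) (simp add: k)
  then have "(\<lambda>t. \<xi> (decode t v)) \<in> fun_algebra {\<xi>. functional coord_module \<xi>}"
    by (simp add: decode_def linear_simps[OF \<xi>] mult.assoc)
  then show ?thesis unfolding vector_fspace_def by (rule fun_algebra_reg_affine)
qed

definition pair_of :: "(nat \<Rightarrow> 'k) \<Rightarrow> 'v set \<times> 'v set" where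
  "pair_of t = (graph (decode t) M, graph (decode t) N)"

text \<open>T is recovered blockwise from \<open>T v = T (proj v) + T (v - proj v)\<close>: lifting
  a vector to the graph and subtracting the vector leaves its image under T. The second lift belongs
  to the decomposition with M and N exchanged.\<close>

definition seq_of :: "'v set \<times> 'v set \<Rightarrow> nat \<Rightarrow> 'k" where
  "seq_of x = code (\<lambda>v. (lift (fst x) (proj v) - proj v) +
     (decomposition.lift scale V \<rho> I N M (snd x) (v - proj v) - (v - proj v)))"

abbreviation X where "X \<equiv> prod_fspace (variety M) (variety N)"

lemma pair_of_morphism: "fspace_morphism (vector_fspace coord_module W) X pair_of"
proof -
  interpret sw: tight_decomposition scale n G V \<rho> I N M by (rule tight_swapped)
  have off: "decode t \<in> offdiag M N" if "t \<in> topspace (top_of (vector_fspace coord_module W))" for t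
    using that unfolding topspace_W by (rule decode_offdiag)
  note off' = off[folded offdiag_commute[of N]]
  have "fspace_morphism (vector_fspace coord_module W) (variety M) (\<lambda>t. graph (decode t) M)"
    by (rule graph_morphism[where \<theta> = decode, OF function_sheaf_W lin_decode off decode_reg])
  moreover have "fspace_morphism (vector_fspace coord_module W) (variety N) (\<lambda>t. graph (decode t) N)"
    by (rule sw.graph_morphism[where \<theta> = decode, OF function_sheaf_W lin_decode off' decode_reg])
  ultimately show ?thesis
    unfolding pair_of_def[abs_def]
    by (rule fspace_morphism_pair[OF function_sheaf_W function_sheaf_variety function_sheaf_variety])
qed

lemma seq_of_pair:
  assumes T: "T \<in> offdiag M N"
  shows "seq_of (graph T M, graph T N) = code T"
proof -
  interpret sw: tight_decomposition scale n G V \<rho> I N M by (rule tight_swapped)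
  note T' = T[folded offdiag_commute[of N]]
  have "lift (graph T M) (proj v) - proj v + (sw.lift (graph T N) (v - proj v) - (v - proj v)) = T v"
    if v: "v \<in> V" for v
    using lift_graph[OF T proj(4)[OF v]] sw.lift_graph[OF T' proj(5)[OF v]]
    by (simp add: linear_simps[OF endosD(1)[OF offdiagD(1)[OF T]]])
  then show ?thesis unfolding seq_of_def fst_conv snd_conv by (rule code_cong)
qed

lemma summands_pair:
  assumes "x \<in> summands I scale V \<rho> M \<times> summands I scale V \<rho> N"
  obtains T where "T \<in> offdiag M N" "x = (graph T M, graph T N)"
proof -
  interpret sw: tight_decomposition scale n G V \<rho> I N M by (rule tight_swapped)
  obtain L L' where x: "x = (L, L')" "L \<in> summands I scale V \<rho> M" "L' \<in> summands I scale V \<rho> N"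
    using assms by blast
  obtain T where T: "T \<in> offdiag M N" "L = graph T M" using x(2) unfolding summands_graphs by blast
  obtain S where S: "S \<in> offdiag M N" "L' = graph S N"
    using x(3) unfolding sw.summands_graphs offdiag_commute[of N] by blast
  obtain R where R: "R \<in> offdiag M N" "\<And>x. x \<in> M \<Longrightarrow> R x = T x" "\<And>y. y \<in> N \<Longrightarrow> R y = S y"
    by (rule offdiag_block[OF S(1) T(1)]) (rule that)
  have "graph R M = graph T M" "graph R N = graph S N"
    unfolding graph_def using R(2,3) by (auto cong: image_cong)
  then show ?thesis using that[OF R(1)] x(1) T(2) S(2) by simp
qed

lemma pair_of_code:
  assumes T: "T \<in> offdiag M N"
  shows "pair_of (code T) = (graph T M, graph T N)"
proof -
  note sub = submoduleD(2)[OF submodule_M] submoduleD(2)[OF submodule_N]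
  have "graph (decode (code T)) L = graph T L" if "L \<subseteq> V" for L
    by (rule graph_cong[OF that decode_code_offdiag[OF T]])
  then show ?thesis unfolding pair_of_def using sub by simp
qed

lemma seq_of_morphism: "fspace_morphism X (vector_fspace coord_module W) seq_of"
proof -
  interpret sw: tight_decomposition scale n G V \<rho> I N M by (rule tight_swapped)
  interpret pr: function_sheaf_pair "variety M" "variety N"
    by (intro function_sheaf_pair.intro function_sheaf_variety)
  interpret X: function_sheaf X by (rule pr.function_sheaf_prod_fspace)
  let ?T = "topspace (top_of X)"
  \<comment> \<open>Each matrix entry is a lift coordinate on the first factor plus one on the
    second, up to constants.\<close>
  have entry: "(\<lambda>x. seq_of x (prod_encode (i, j))) \<in> reg_of X ?T" if ij: "i < d" "j < d" for i j
  proof -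
    let ?v = "u i"
    have v: "?v \<in> V" by (rule basis_V[OF ij(1)])
    have "(\<lambda>x. (z j (lift (fst x) (proj ?v)) + - z j (proj ?v)) +
        (z j (sw.lift (snd x) (?v - proj ?v)) + - z j (?v - proj ?v))) \<in> reg_of X ?T"
      by (intro X.add_reg X.const_reg openin_topspace pr.reg_prod_fst[OF lift_reg[OF proj(4)[OF v] coordinate]]
          pr.reg_prod_snd[OF sw.lift_reg[OF proj(5)[OF v] coordinate]])
    then show ?thesis
      using ij by (simp add: seq_of_def code_pair linear_simps[OF coordinate])
  qed
  show ?thesis
    unfolding vector_fspace_def
  proof (rule fspace_morphism_affine[OF X.function_sheaf_axioms])
    fix x assume "x \<in> ?T"
    then obtain T where "T \<in> offdiag M N" "x = (graph T M, graph T N)"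
      unfolding topspace_product by (rule summands_pair)
    then show "seq_of x \<in> W" using seq_of_pair unfolding W_def by auto
  next
    fix \<xi> :: "(nat \<Rightarrow> 'k) \<Rightarrow> 'k" assume "\<xi> \<in> {\<xi>. functional coord_module \<xi>}"
    then have \<xi>: "functional coord_module \<xi>" by simp
    have "(\<lambda>x. \<Sum>i<d. \<Sum>j<d. seq_of x (prod_encode (i, j)) * \<xi> (unit_seq (prod_encode (i, j)))) \<in> reg_of X ?T"
      by (intro X.sum_reg X.mult_reg X.const_reg openin_topspace entry) auto
    then show "(\<lambda>x. \<xi> (seq_of x)) \<in> reg_of X ?T"
      using functional_matrix_seq[OF _ \<xi>, of "seq_of _" d] code_matrix_seqs unfolding seq_of_def by simp
  qed
qed

lemma seq_of_iso: "fspace_iso X (vector_fspace coord_module W) seq_of"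
  unfolding fspace_iso_def
proof (intro exI[of _ pair_of] conjI ballI seq_of_morphism pair_of_morphism)
  fix x assume "x \<in> topspace (top_of X)"
  then obtain T where T: "T \<in> offdiag M N" "x = (graph T M, graph T N)"
    unfolding topspace_product by (rule summands_pair)
  then show "pair_of (seq_of x) = x" using seq_of_pair pair_of_code by simp
next
  fix t assume "t \<in> topspace (top_of (vector_fspace coord_module W))"
  then have "t \<in> W" by (simp only: topspace_W)
  then obtain T where "T \<in> offdiag M N" "t = code T" unfolding W_def by blast
  then show "seq_of (pair_of t) = t" using seq_of_pair pair_of_code by simp
qed

section \<open>The conjugation action and its rationality\<close>

definition conj_action :: "'k mat \<Rightarrow> (nat \<Rightarrow> 'k) \<Rightarrow> nat \<Rightarrow> 'k" where
  "conj_action h t = code (\<lambda>v. \<rho> h (decode t (\<rho> (gi h) v)))"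

text \<open>If \<open>h\<close> stabilizes M and N, conjugation preserves the off-diagonal shape.
  Equivariance is the identity
  \<open>\<rho> h (m + T m) = \<rho> h m + T' (\<rho> h m)\<close>.\<close>

lemma conj_action_code:
  assumes h: "h \<in> G" "\<rho> h ` M = M" "\<rho> h ` N = N" and T: "T \<in> offdiag M N"
  obtains T' where "T' \<in> offdiag M N" "conj_action h (code T) = code T'"
    "\<rho> h ` graph T M = graph T' M" "\<rho> h ` graph T N = graph T' N"
proof -
  obtain T' where T': "T' \<in> endos" "\<And>v. v \<in> V \<Longrightarrow> T' v = \<rho> h (T (\<rho> (gi h) v))"
    by (rule endos_conj[OF offdiagD(1)[OF T] h(1)]) (rule that)
  have T'h: "T' (\<rho> h v) = \<rho> h (T v)" if "v \<in> V" for v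
    using T'(2)[OF act_V[OF h(1) that]] act_inv(1)[OF h(1) that] by simp
  have off: "T' \<in> offdiag M N"
  proof (rule offdiagI[OF T'(1)])
    fix x assume "x \<in> M"
    then obtain y where y: "y \<in> M" "x = \<rho> h y" using h(2) by blast
    have "\<rho> h (T y) \<in> \<rho> h ` N" by (rule imageI[OF offdiagD(2)[OF T y(1)]])
    then show "T' x \<in> N" using T'h[OF in_V(1)[OF y(1)]] y(2) h(3) by simp
  next
    fix x assume "x \<in> N"
    then obtain y where y: "y \<in> N" "x = \<rho> h y" using h(3) by blast
    have "\<rho> h (T y) \<in> \<rho> h ` M" by (rule imageI[OF offdiagD(3)[OF T y(1)]])
    then show "T' x \<in> M" using T'h[OF in_V(2)[OF y(1)]] y(2) h(2) by simp
  qed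
  have "conj_action h (code T) = code T'"
    unfolding conj_action_def
  proof (rule code_cong)
    fix v assume v: "v \<in> V"
    show "\<rho> h (decode (code T) (\<rho> (gi h) v)) = T' v"
      unfolding T'(2)[OF v] decode_code_offdiag[OF T act_V[OF inv_G[OF h(1)] v]] ..
  qed
  moreover have "\<rho> h ` graph T L = graph T' L" if L: "L \<subseteq> V" "\<rho> h ` L = L" for L
  proof -
    have "\<rho> h (m + T m) = \<rho> h m + T' (\<rho> h m)" if "m \<in> L" for m
      using T'h act_add[OF h(1)] endosD(2)[OF offdiagD(1)[OF T]] subsetD[OF L(1) that] by simp
    then have "\<rho> h ` graph T L = (\<lambda>m. m + T' m) ` \<rho> h ` L"
      unfolding graph_def image_image by (intro image_cong) auto
    then show ?thesis unfolding L(2) graph_def .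
  qed
  moreover note submoduleD(2)[OF submodule_M] submoduleD(2)[OF submodule_N]
  ultimately show ?thesis using that[OF off] h by simp
qed

lemma conj_action_rational:
  assumes H: "subgroup H (GL n)" "H \<subseteq> G"
    and stable: "\<And>h. h \<in> H \<Longrightarrow> \<rho> h ` M = M" "\<And>h. h \<in> H \<Longrightarrow> \<rho> h ` N = N"
  shows "rational_module n H coord_module W conj_action"
proof -
  interpret H: matrix_group n H by (rule matrix_group.intro[OF H(1)])
  have HG: "h \<in> G" if "h \<in> H" for h using H(2) that by blast
  have gi_V: "\<rho> (gi h) v \<in> V" if "h \<in> H" "v \<in> V" for h v by (rule act_V[OF inv_G[OF HG[OF that(1)]] that(2)])

  show ?thesis
    unfolding rational_module_def
  proof (intro conjI ballI allI impI)
    show "fin_dim_subspace coord_module W" by (rule fin_dim_matrix_seqs[OF W_subspace W_matrix_seqs])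
  next
    fix h t assume h: "h \<in> H" and t: "t \<in> W"
    then obtain T where T: "T \<in> offdiag M N" "t = code T" unfolding W_def by blast
    obtain T' where "T' \<in> offdiag M N" "conj_action h (code T) = code T'"
      by (rule conj_action_code[OF HG[OF h] stable(1)[OF h] stable(2)[OF h] T(1)]) (rule that)
    then show "conj_action h t \<in> W" unfolding W_def T(2) by simp
  next
    fix h s t assume h: "h \<in> H"
    have "z j (\<rho> h (decode (s + t) v)) = z j (\<rho> h (decode s v)) + z j (\<rho> h (decode t v))" for j v
      by (simp add: decode_add act_add[OF HG[OF h] decode_V decode_V] linear_simps[OF coordinate])
    then show "conj_action h (s + t) = conj_action h s + conj_action h t"
      unfolding conj_action_def code_def fun_eq_iff by (auto split: prod.split)
  next
    fix h c t assume h: "h \<in> H"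
    have "z j (\<rho> h (decode (coord_module c t) v)) = c * z j (\<rho> h (decode t v))" for j v
      by (simp add: decode_scale act_scale[OF HG[OF h] decode_V] linear_simps[OF coordinate])
    then show "conj_action h (coord_module c t) = coord_module c (conj_action h t)"
      unfolding conj_action_def code_def coord_module_def fun_eq_iff by (auto split: prod.split)
  next
    fix t assume t: "t \<in> W"
    have "gi (1\<^sub>m n) = 1\<^sub>m n"
      using one_mult(1)[OF inv_G[OF one_G]] inv_mult(2)[OF one_G] by simp
    then have "conj_action (1\<^sub>m n) t = code (decode t)"
      unfolding conj_action_def by (intro code_cong) (simp add: act_one decode_V)
    then show "conj_action (1\<^sub>m n) t = t" using code_decode_W[OF t] by simp
  next
    fix g h t assume g: "g \<in> H" and h: "h \<in> H" and t: "t \<in> W"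
    note G = HG[OF g] HG[OF h]
    have inv: "gi (g * h) = gi h * gi g"
      using group.inv_mult_group[OF group_GL in_GL[OF G(1)] in_GL[OF G(2)]] by simp
    \<comment> \<open>The formula for the conjugate is guaranteed to be linear on V only. Decoding
      its code requires a representative that is linear on the ambient space.\<close>
    obtain T' where T': "T' \<in> endos" "\<And>v. v \<in> V \<Longrightarrow> T' v = \<rho> h (decode t (\<rho> (gi h) v))"
      by (rule endos_conj[OF offdiagD(1)[OF decode_offdiag[OF t]] G(2)]) (rule that)
    have eq: "decode (conj_action h t) v = \<rho> h (decode t (\<rho> (gi h) v))" if v: "v \<in> V" for v
    proof -
      have "conj_action h t = code T'" unfolding conj_action_def by (rule code_cong) (simp add: T'(2))
      then show ?thesis using decode_code[OF endosD(1,2)[OF T'(1)] v] T'(2)[OF v] by simp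
    qed
    show "conj_action (g * h) t = conj_action g (conj_action h t)"
      unfolding conj_action_def[of "g * h"] conj_action_def[of g]
    proof (rule code_cong)
      fix v assume v: "v \<in> V"
      have "\<rho> (gi (g * h)) v = \<rho> (gi h) (\<rho> (gi g) v)"
        unfolding inv by (rule act_mult[OF inv_G[OF G(2)] inv_G[OF G(1)] v])
      then show "\<rho> (g * h) (decode t (\<rho> (gi (g * h)) v)) =
          \<rho> g (decode (conj_action h t) (\<rho> (gi g) v))"
        using eq[OF gi_V[OF g v]] act_mult[OF G decode_V] by simp
    qed
  next
    fix \<xi> :: "(nat \<Rightarrow> 'k) \<Rightarrow> 'k" and t assume \<xi>: "functional coord_module \<xi>" and t: "t \<in> W"
    have mono: "f \<in> coord_ring n H" if "f \<in> coord_ring n G" for f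
      using that H(2) unfolding coord_ring_def by blast
    have entry: "(\<lambda>h. z j (\<rho> h (decode t (\<rho> (gi h) (u i))))) \<in> coord_ring n H" if ij: "i < d" "j < d" for i j
    proof -
      \<comment> \<open>Expanding \<open>decode t\<close> in coordinates writes the entry as a sum
        of products of a coefficient of \<open>h\<close> and one of its inverse, both regular on
        G.\<close>
      have "(\<lambda>h. \<Sum>k<d. \<Sum>l<d. (t (prod_encode (k, l)) * z k (\<rho> (gi h) (u i))) * z j (\<rho> h (u l))) \<in> coord_ring n H"
        using ij coord_ring_inv[OF act_coeff[OF coordinate basis_V]]
        by (intro coord_ring_sum coord_ring_mult coord_ring_const mono act_coeff coordinate basis_V) auto
      then show ?thesis
      proof (rule coord_ring_cong)
        fix h assume "h \<in> H"
        then have h: "h \<in> G" by (rule HG)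
        obtain F where F: "lin F" "\<And>v. v \<in> V \<Longrightarrow> F v = \<rho> h v"
          by (rule endo.linear_extension[OF subspace_V, of "\<rho> h"]) (auto simp: act_add act_scale h)
        have "\<rho> h (decode t v) = (\<Sum>k<d. \<Sum>l<d. scale (t (prod_encode (k, l)) * z k v) (\<rho> h (u l)))" for v
        proof -
          have "\<rho> h (decode t v) = F (decode t v)" by (rule F(2)[OF decode_V, symmetric])
          also have "\<dots> = (\<Sum>k<d. \<Sum>l<d. scale (t (prod_encode (k, l)) * z k v) (F (u l)))"
            unfolding decode_def linear_simps[OF F(1)] ..
          also have "\<dots> = (\<Sum>k<d. \<Sum>l<d. scale (t (prod_encode (k, l)) * z k v) (\<rho> h (u l)))"
            by (intro sum.cong refl) (simp add: F(2)[OF basis_V])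
          finally show ?thesis .
        qed
        then show "z j (\<rho> h (decode t (\<rho> (gi h) (u i)))) =
            (\<Sum>k<d. \<Sum>l<d. t (prod_encode (k, l)) * z k (\<rho> (gi h) (u i)) * z j (\<rho> h (u l)))"
          by (simp add: linear_simps[OF coordinate])
      qed
    qed
    have "(\<lambda>h. \<Sum>i<d. \<Sum>j<d. z j (\<rho> h (decode t (\<rho> (gi h) (u i)))) * \<xi> (unit_seq (prod_encode (i, j))))
        \<in> coord_ring n H"
      by (intro coord_ring_sum coord_ring_mult[OF entry coord_ring_const]) auto
    then show "(\<lambda>h. \<xi> (conj_action h t)) \<in> coord_ring n H"
    proof (rule coord_ring_cong)
      fix h assume "h \<in> H"
      show "\<xi> (conj_action h t) = (\<Sum>i<d. \<Sum>j<d. z j (\<rho> h (decode t (\<rho> (gi h) (u i)))) * \<xi> (unit_seq (prod_encode (i, j))))"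
        unfolding conj_action_def functional_matrix_seq[OF code_matrix_seqs \<xi>]
        by (intro sum.cong refl) (simp add: code_pair)
    qed
  qed
qed

lemma stable_linearizable:
  assumes H: "subgroup H (GL n)" "H \<subseteq> G"
    and stable: "\<And>h. h \<in> H \<Longrightarrow> \<rho> h ` M = M" "\<And>h. h \<in> H \<Longrightarrow> \<rho> h ` N = N"
  shows "linearizable n H X (diag_action \<rho>)"
  unfolding linearizable_def coord_module_def[symmetric]
proof (intro exI conjI ballI)
  show "rational_module n H coord_module W conj_action" by (rule conj_action_rational[OF H stable])
  show "fspace_iso X (vector_fspace coord_module W) seq_of" by (rule seq_of_iso)
  fix h x assume h: "h \<in> H" and "x \<in> topspace (top_of X)"
  then obtain T where T: "T \<in> offdiag M N" "x = (graph T M, graph T N)"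
    unfolding topspace_product using summands_pair by blast
  obtain T' where "T' \<in> offdiag M N" "conj_action h (code T) = code T'"
    "\<rho> h ` graph T M = graph T' M" "\<rho> h ` graph T N = graph T' N"
    by (rule conj_action_code[OF subsetD[OF H(2) h] stable(1)[OF h] stable(2)[OF h] T(1)]) (rule that)
  then show "seq_of (diag_action \<rho> h x) = conj_action h (seq_of x)"
    using seq_of_pair T by (simp add: diag_action_def)
qed

end

context tight_decomposition
begin

lemma stable_linearizable:
  assumes "subgroup H (GL n)" "H \<subseteq> G"
    and "\<And>h. h \<in> H \<Longrightarrow> \<rho> h ` M = M" "\<And>h. h \<in> H \<Longrightarrow> \<rho> h ` N = N"
  shows "linearizable n H (prod_fspace (variety M) (variety N)) (diag_action \<rho>)"
proof -
  obtain B where B: "finite B" "V = span B" by (rule V_span)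
  have VB: "V \<subseteq> span B" using B(2) by simp
  obtain u x where u: "\<And>i. i < dim V \<Longrightarrow> u i \<in> V" "\<And>i. functional scale (x i)"
    "\<And>i j. i < dim V \<Longrightarrow> j < dim V \<Longrightarrow> x i (u j) = (if i = j then 1 else 0)"
    "\<And>v. v \<in> V \<Longrightarrow> v = (\<Sum>i<dim V. scale (x i v) (u i))"
    by (rule dual_basis[OF subspace_V VB B(1)]) (rule that)
  interpret coordinates scale n G V \<rho> I M N u x "dim V"
    by (rule coordinates.intro[OF tight_decomposition_axioms coordinates_axioms.intro[OF u]])
  show ?thesis by (rule stable_linearizable[OF assms])
qed

text \<open>The fixed point is the point that corresponds to the origin of the linear action.\<close>

lemma linearizable_fixed_point:
  assumes conn: "connectedin (GL_zariski n) G" and H: "1\<^sub>m n \<in> H" "H \<subseteq> G"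
    and lin: "linearizable n H (prod_fspace (variety M) (variety N)) (diag_action \<rho>)"
  shows "has_fixed_point H (summands I scale V \<rho> M \<times> summands I scale V \<rho> N) (diag_action \<rho>)"
proof -
  let ?X = "prod_fspace (variety M) (variety N)"
  obtain W :: "(nat \<Rightarrow> 'k) set" and \<sigma> \<phi> where rm: "rational_module n H coord_module W \<sigma>"
    and iso: "fspace_iso ?X (vector_fspace coord_module W) \<phi>"
    and eqv: "\<forall>h \<in> H. \<forall>x \<in> topspace (top_of ?X). \<phi> (diag_action \<rho> h x) = \<sigma> h (\<phi> x)"
    using lin unfolding linearizable_def coord_module_def[symmetric] by blast
  obtain \<psi> where \<psi>: "fspace_morphism (vector_fspace coord_module W) ?X \<psi>"
    "\<forall>x \<in> topspace (top_of ?X). \<psi> (\<phi> x) = x"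
    "\<forall>y \<in> topspace (top_of (vector_fspace coord_module W)). \<phi> (\<psi> y) = y"
    using iso unfolding fspace_iso_def by blast
  have tW: "topspace (top_of (vector_fspace coord_module W)) = W"
    unfolding vector_fspace_def by (simp add: topspace_zariski)
  interpret sq: ambient_space "coord_module :: 'k \<Rightarrow> (nat \<Rightarrow> 'k) \<Rightarrow> _"
    using vector_space_coord_module by (simp add: ambient_space_def)
  have "fin_dim_subspace coord_module W" using rm unfolding rational_module_def by blast
  then obtain B where "W = sq.span B" unfolding fin_dim_subspace_def by blast
  then have W0: "0 \<in> W" by (simp add: sq.span_zero)
  have \<sigma>0: "\<sigma> h 0 = 0" if h: "h \<in> H" for h
  proof -
    \<comment> \<open>The laws of a rational module hold on W only, so the origin is fixed by
      homogeneity at the scalar 0, using that the origin lies in W.\<close>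
    have "\<sigma> h (coord_module 0 0) = coord_module 0 (\<sigma> h 0)"
      using rm h W0 unfolding rational_module_def by blast
    then show ?thesis by simp
  qed
  let ?x = "\<psi> 0"
  have x: "?x \<in> topspace (top_of ?X)" by (rule fspace_morphismD(1)[OF \<psi>(1)]) (simp add: tW W0)
  \<comment> \<open>The inverse of the linearizing map recovers points of the variety only, so the
    translate has to be placed in the variety first. This is where connectedness of G is
    used.\<close>
  have act: "summand (\<rho> h ` L) \<and> iso P (\<rho> h ` L)" if "summand L" "iso P L" "summand P" "h \<in> G" for h L P
    using twist_summand[OF that(1,4)] iso_trans[OF that(3,1) _ that(2) connected_iso[OF conn that(1,4)]]
      summand_subset by blast
  interpret sw: tight_decomposition scale n G V \<rho> I N M by (rule tight_swapped)
  have "diag_action \<rho> h ?x = ?x" if h: "h \<in> H" for h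
  proof -
    obtain L L' where L: "?x = (L, L')" "summand L" "iso M L" "summand L'" "iso N L'"
      using x unfolding topspace_product by (auto simp: summands_iff)
    have hG: "h \<in> G" using h H(2) by blast
    have "diag_action \<rho> h ?x \<in> topspace (top_of ?X)"
      unfolding topspace_product L(1) diag_action_def
      using act[OF L(2,3) summand_M hG] act[OF L(4,5) sw.summand_M hG] by (simp add: summands_iff)
    then have "\<psi> (\<phi> (diag_action \<rho> h ?x)) = diag_action \<rho> h ?x" by (rule bspec[OF \<psi>(2)])
    moreover have "\<phi> ?x = 0" by (rule bspec[OF \<psi>(3)]) (simp add: tW W0)
    then have "\<phi> (diag_action \<rho> h ?x) = 0"
      using bspec[OF bspec[OF eqv h] x] \<sigma>0[OF h] by (simp only:)
    ultimately show ?thesis by (simp only:)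
  qed
  then show ?thesis
    unfolding has_fixed_point_def by (intro bexI[OF _ x[unfolded topspace_product]] ballI)
qed

end

section \<open>The theorem\<close>

text \<open>Evaluating the coefficient of \<open>g * h\<close> at \<open>g = 1\<close> shows that
  every form killing W kills \<open>\<rho> h w\<close>, hence \<open>\<rho> h w\<close> is in W;
  taking \<open>h = 1\<close> gives the condition for \<open>I\<close> alone. Conversely
  \<open>\<rho> (g * h) w = \<rho> g (\<rho> h w)\<close> with \<open>\<rho> h w\<close> in
  W.\<close>

lemma (in scheme_module) GrH_submodule_iff:
  assumes I_one: "\<And>f. f \<in> I \<Longrightarrow> f (1\<^sub>m n) = 0"
    and H: "subgroup H (GL n)" "H \<subseteq> G"
  shows "scheme_submodule {f \<in> coord_ring n G. \<forall>h\<in>H. (\<lambda>g. f (g * h)) \<in> I} scale V \<rho> W \<longleftrightarrow>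
    submodule W \<and> (\<forall>h\<in>H. \<rho> h ` W = W)"
    (is "scheme_submodule ?J scale V \<rho> W \<longleftrightarrow> _")
proof -
  interpret H: matrix_group n H by (rule matrix_group.intro[OF H(1)])
  have HG: "h \<in> G" if "h \<in> H" for h using H(2) that by blast
  show ?thesis
  proof
    assume J: "scheme_submodule ?J scale V \<rho> W"
    then have sW: "subspace W" and WV: "W \<subseteq> V" unfolding scheme_submodule_def by auto
    have J': "(\<lambda>g. \<xi> (\<rho> (g * h) w)) \<in> I"
      if "w \<in> W" "functional scale \<xi>" "\<And>u. u \<in> W \<Longrightarrow> \<xi> u = 0" "h \<in> H" for w \<xi> h
      using J that unfolding scheme_submodule_def by blast
    have sub: "submodule W"
    proof (rule submoduleI[OF sW WV])
      fix w \<xi> assume w: "w \<in> W" and \<xi>: "functional scale \<xi>" "\<And>u. u \<in> W \<Longrightarrow> \<xi> u = 0"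
      show "(\<lambda>g. \<xi> (\<rho> g w)) \<in> I"
      proof (rule I_cong[OF J'[OF w \<xi> H.one_G]])
        fix g assume g: "g \<in> G"
        show "\<xi> (\<rho> g w) = \<xi> (\<rho> (g * 1\<^sub>m n) w)" unfolding one_mult(2)[OF g] ..
      qed
    qed
    have into: "\<rho> h w \<in> W" if h: "h \<in> H" and w: "w \<in> W" for h w
    proof (rule ccontr)
      assume "\<rho> h w \<notin> W"
      then obtain \<xi> where \<xi>: "functional scale \<xi>" "\<And>u. u \<in> W \<Longrightarrow> \<xi> u = 0" "\<xi> (\<rho> h w) = 1"
        by (rule separating_functional[OF sW]) (rule that)
      from I_one[OF J'[OF w \<xi>(1,2) h]] have "\<xi> (\<rho> h w) = 0"
        unfolding one_mult(1)[OF HG[OF h]] .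
      then show False using \<xi>(3) by simp
    qed
    have "\<rho> h ` W = W" if h: "h \<in> H" for h
    proof (intro equalityI subsetI)
      fix w assume w: "w \<in> W"
      have "w = \<rho> h (\<rho> (gi h) w)" using act_inv(2)[OF HG[OF h]] w WV by auto
      then show "w \<in> \<rho> h ` W" using into[OF H.inv_G[OF h] w] by blast
    qed (use into[OF h] in blast)
    then show "submodule W \<and> (\<forall>h\<in>H. \<rho> h ` W = W)" using sub by blast
  next
    assume *: "submodule W \<and> (\<forall>h\<in>H. \<rho> h ` W = W)"
    then have W: "submodule W" by blast
    have hW: "\<rho> h w \<in> W" if "h \<in> H" "w \<in> W" for h w
    proof -
      have "\<rho> h ` W = W" using * that(1) by blast
      then show ?thesis using that(2) by blast
    qed
    show "scheme_submodule ?J scale V \<rho> W"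
      unfolding scheme_submodule_def
    proof (intro conjI ballI allI impI)
      show "subspace W" "W \<subseteq> V" by (rule submoduleD[OF W])+
      fix w \<xi> assume w: "w \<in> W" and "functional scale \<xi> \<and> (\<forall>u\<in>W. \<xi> u = 0)"
      then have \<xi>: "functional scale \<xi>" "\<And>u. u \<in> W \<Longrightarrow> \<xi> u = 0" by auto
      have "(\<lambda>g. \<xi> (\<rho> (g * h) w)) \<in> I" if h: "h \<in> H" for h
        by (rule I_cong[OF submoduleD(4)[OF W hW[OF h w] \<xi>]])
           (use act_mult HG[OF h] submoduleD(3)[OF W w] in auto)
      then show "(\<lambda>g. \<xi> (\<rho> g w)) \<in> ?J"
        using act_coeff[OF \<xi>(1) submoduleD(3)[OF W w]] by simp
    qed
  qed
qed

theorem theorem4p1p3: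
  fixes n p r :: nat
    and G H :: "'k::alg_closed_field mat set"
    and scale :: "'k \<Rightarrow> 'v::ab_group_add \<Rightarrow> 'v"
    and V M N :: "'v set"
    and \<rho> :: "'k mat \<Rightarrow> 'v \<Rightarrow> 'v"
    and Ir J :: "('k mat \<Rightarrow> 'k) set"
    and X :: "('v set \<times> 'v set, 'k) fspace"
  assumes "CHAR('k) = p" and "p > 0" and "r \<ge> 1"
    and "algebraic_group n G" and "simple_group n G" and "simply_connected_group n G"
    and "Ir = frobenius_kernel_ideal n G r"
    and "rational_module n G scale V \<rho>"
    and "scheme_submodule Ir scale V \<rho> M" and "scheme_submodule Ir scale V \<rho> N"
    and "direct_decomp V M N"
    and "\<forall>M'. scheme_summand Ir scale V \<rho> M' \<and> scheme_iso Ir scale \<rho> M M' \<longrightarrow>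
              direct_decomp V M' N"
    and "closed_subgroup n H G"
    and "J = GrH_ideal n G r H"
    and "X = prod_fspace (summand_variety Ir scale V \<rho> M) (summand_variety Ir scale V \<rho> N)"
  shows "((\<exists>M' N'. scheme_submodule J scale V \<rho> M' \<and> scheme_submodule J scale V \<rho> N' \<and>
                    direct_decomp V M' N' \<and>
                    scheme_iso Ir scale \<rho> M M' \<and> scheme_iso Ir scale \<rho> N N')
          \<longleftrightarrow> has_fixed_point H (summands Ir scale V \<rho> M \<times> summands Ir scale V \<rho> N)
                (diag_action \<rho>))
       \<and> (has_fixed_point H (summands Ir scale V \<rho> M \<times> summands Ir scale V \<rho> N)
                (diag_action \<rho>)
          \<longleftrightarrow> linearizable n H X (diag_action \<rho>))"
proof -
  have sG: "subgroup G (GL n)" using assms(4) unfolding algebraic_group_def by blast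
  have conn: "connectedin (GL_zariski n) G"
    using assms(5) unfolding simple_group_def connected_group_def by blast
  interpret matrix_group n G by (rule matrix_group.intro[OF sG])
  have "fin_dim_subspace scale V" using assms(8) unfolding rational_module_def by blast
  then have "Vector_Spaces.vector_space scale" unfolding fin_dim_subspace_def by blast
  then interpret ambient_space scale by (simp add: ambient_space_def)
  interpret scheme_module scale n G V \<rho> Ir
  proof (intro scheme_module.intro ambient_space_axioms matrix_group_axioms scheme_module_axioms.intro)
    show "rational_module n G scale V \<rho>" by fact
    show "f' \<in> Ir" if "f \<in> Ir" "\<And>g. g \<in> G \<Longrightarrow> f' g = f g" for f f'
      using fun_ideal_cong that unfolding assms(7) frobenius_kernel_ideal_def by blast
    show "(\<lambda>_. 0) \<in> Ir"
      unfolding assms(7) frobenius_kernel_ideal_def by (rule fun_idealI[of 0]) auto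
    show "(\<lambda>g. f g + f' g) \<in> Ir" if "f \<in> Ir" "f' \<in> Ir" for f f'
      using fun_ideal_add that unfolding assms(7) frobenius_kernel_ideal_def by blast
    show "(\<lambda>g. c * f g) \<in> Ir" if "f \<in> Ir" for c f
      using that unfolding assms(7) by (rule frobenius_kernel_ideal_scale)
    show "(\<lambda>g. f (gi h * g * h)) \<in> Ir" if "h \<in> G" "f \<in> Ir" for h f
      using that unfolding assms(7) by (rule frobenius_kernel_ideal_conj)
  qed
  have I_one: "f (1\<^sub>m n) = 0" if "f \<in> Ir" for f
    using frobenius_kernel_ideal_one[of f r] that assms(1,2) unfolding assms(7) by simp
  have H: "subgroup H (GL n)" "H \<subseteq> G"
  proof -
    have H': "subgroup H (group_of n G)" using assms(13) unfolding closed_subgroup_def by blast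
    then show "subgroup H (GL n)" by (rule group.incl_subgroup[OF group_GL sG])
    show "H \<subseteq> G" using subgroup.subset[OF H'] by simp
  qed
  interpret H: matrix_group n H by (rule matrix_group.intro[OF H(1)])
  have J: "scheme_submodule J scale V \<rho> W \<longleftrightarrow> submodule W \<and> (\<forall>h\<in>H. \<rho> h ` W = W)" for W
    unfolding assms(14) GrH_ideal_def assms(7)[symmetric]
    by (rule GrH_submodule_iff[OF _ H]) (rule I_one)
  interpret decomposition scale n G V \<rho> Ir M N
    by (rule decomposition.intro[OF scheme_module_axioms decomposition_axioms.intro[OF assms(9-11)]])
  have "tight_decomposition scale n G V \<rho> Ir M N" by (rule tightI) (use assms(12) in blast)
  then interpret tight_decomposition scale n G V \<rho> Ir M N .
  interpret sw: tight_decomposition scale n G V \<rho> Ir N M by (rule tight_swapped)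
  let ?S = "summands Ir scale V \<rho> M \<times> summands Ir scale V \<rho> N"
  let ?fix = "has_fixed_point H ?S (diag_action \<rho>)"
  \<comment> \<open>A point of the product is a graph over M together with a graph over N. Such
    graphs are complementary by tightness, so a fixed point is already a decomposition of V.\<close>
  have fixE: "\<exists>M' N'. submodule M' \<and> submodule N' \<and> direct_decomp V M' N' \<and> iso M M' \<and> iso N N' \<and>
      (\<forall>h\<in>H. \<rho> h ` M' = M') \<and> (\<forall>h\<in>H. \<rho> h ` N' = N')" if fp: ?fix
  proof -
    obtain x where x: "x \<in> ?S" "\<forall>h\<in>H. diag_action \<rho> h x = x"
      using fp unfolding has_fixed_point_def by (rule bexE) (rule that)
    obtain M' N' where x': "x = (M', N')" by (rule prod.exhaust)
    note * = x[unfolded x']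
    have M'N': "M' \<in> summands Ir scale V \<rho> M" "N' \<in> summands Ir scale V \<rho> N" using *(1) by simp_all
    obtain T where T: "T \<in> offdiag M N" "M' = graph T M" using M'N'(1) unfolding summands_graphs by blast
    obtain S where S: "S \<in> offdiag M N" "N' = graph S N"
      using M'N'(2) unfolding sw.summands_graphs offdiag_commute[of N] by blast
    have "direct_decomp V M' N'" unfolding T(2) S(2) by (rule graphs_complementary[OF S(1) T(1)])
    then show ?thesis
      using * by (intro exI[of _ M'] exI[of _ N']) (simp add: summands_iff summand_submodule diag_action_def)
  qed
  have "(\<exists>M' N'. scheme_submodule J scale V \<rho> M' \<and> scheme_submodule J scale V \<rho> N' \<and>
      direct_decomp V M' N' \<and> iso M M' \<and> iso N N') \<longleftrightarrow> ?fix"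
  proof
    assume "\<exists>M' N'. scheme_submodule J scale V \<rho> M' \<and> scheme_submodule J scale V \<rho> N' \<and>
      direct_decomp V M' N' \<and> iso M M' \<and> iso N N'"
    then obtain M' N' where *: "submodule M'" "submodule N'" "direct_decomp V M' N'" "iso M M'" "iso N N'"
      "\<forall>h\<in>H. \<rho> h ` M' = M'" "\<forall>h\<in>H. \<rho> h ` N' = N'" unfolding J by blast
    have "summand M'" "summand N'"
      using summandI[OF *(1-3)] summandI[OF *(2,1) direct_decomp_commute[OF *(3)]] by auto
    then show ?fix
      unfolding has_fixed_point_def using *
      by (intro bexI[of _ "(M', N')"]) (simp_all add: diag_action_def summands_iff)
  next
    assume ?fix
    from fixE[OF this] show "\<exists>M' N'. scheme_submodule J scale V \<rho> M' \<and> scheme_submodule J scale V \<rho> N' \<and>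
      direct_decomp V M' N' \<and> iso M M' \<and> iso N N'" unfolding J by blast
  qed
  moreover have "linearizable n H X (diag_action \<rho>)" if fp: ?fix
  proof -
    \<comment> \<open>The linear coordinates are centred at the fixed pair, since conjugation acts
      on off-diagonal maps only if H stabilizes both summands.\<close>
    obtain M' N' where *: "submodule M'" "submodule N'" "direct_decomp V M' N'" "iso M M'" "iso N N'"
      "\<forall>h\<in>H. \<rho> h ` M' = M'" "\<forall>h\<in>H. \<rho> h ` N' = N'" using fixE[OF fp] by blast
    interpret d: decomposition scale n G V \<rho> Ir M' N'
      by (rule decomposition.intro[OF scheme_module_axioms decomposition_axioms.intro[OF *(1-3)]])
    have s: "summand M'" "summand N'"
      using summandI[OF *(1-3)] summandI[OF *(2,1) direct_decomp_commute[OF *(3)]] by auto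
    \<comment> \<open>The variety of summands depends only on the isomorphism class. Equality of
      dimensions is part of this, as the dimension selects the Grassmannian.\<close>
    have same: "variety P' = variety P" if P: "summand P" "summand P'" "iso P P'" for P P'
    proof -
      have "summands Ir scale V \<rho> P' = summands Ir scale V \<rho> P"
        using iso_trans[OF P(1,2) summand_subset P(3)] iso_trans[OF P(2,1) summand_subset iso_sym[OF P]]
        by (auto simp: summands_iff)
      then show ?thesis unfolding summand_variety_def iso_dim[OF P] by simp
    qed
    have "tight_decomposition scale n G V \<rho> Ir M' N'"
    proof (rule d.tightI)
      \<comment> \<open>Tightness is transported to the new pair by viewing L as a graph over M and
        N' as a graph over N.\<close>
      fix L assume L: "summand L" "iso M' L"
      have "iso M L" by (rule iso_trans[OF summand_M s(1) summand_subset[OF L(1)] *(4) L(2)])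
      then obtain T where T: "T \<in> offdiag M N" "L = graph T M" using summand_is_graph[OF L(1)] by blast
      obtain S where S: "S \<in> offdiag M N" "N' = graph S N"
        using sw.summand_is_graph[OF s(2) *(5)] unfolding offdiag_commute[of N] by blast
      show "direct_decomp V L N'" unfolding T(2) S(2) by (rule graphs_complementary[OF S(1) T(1)])
    qed
    then interpret t: tight_decomposition scale n G V \<rho> Ir M' N' .
    have "linearizable n H (prod_fspace (variety M') (variety N')) (diag_action \<rho>)"
      using *(6,7) by (intro t.stable_linearizable[OF H]) auto
    then show ?thesis
      unfolding assms(15) same[OF summand_M s(1) *(4)] same[OF sw.summand_M s(2) *(5)] .
  qed
  moreover have ?fix if "linearizable n H X (diag_action \<rho>)"
    using linearizable_fixed_point[OF conn H.one_G H(2)] that unfolding assms(15) by blast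
  ultimately show ?thesis by blast
qed

end
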